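(* Let $\beta>0$. There exists a constant $C_\beta>0$, depending only on $\beta$, such that the following two statements hold. (1) For every $n\ge 1$ and every arc $I$ of the unit circle, with length denoted $|I|$, the number of points of the Circular $\beta$ Ensemble of order $n$ which lie in $I$ has variance at most $C_\beta\log(2+n|I|)$. (2) For every bounded interval $I\subset\mathbb{R}$, with length denoted $|I|$, the number of points of the $\operatorname{Sine}_\beta$ point process which lie in $I$ has variance at most $C_\beta\log(2+|I|)$.
   Context: The Circular $\beta$ Ensemble of order $n$ is the set of $n$ random points $\lambda_1,\dots,\lambda_n$ on the unit circle whose joint distribution has a density proportional to $\prod_{1\le j<k\le n}|\lambda_j-\lambda_k|^\beta$ with respect to the Lebesgue measure on the $n$-th power of the unit circle. The $\operatorname{Sine}_\beta$ point process is the point process on $\mathbb{R}$ defined as the limit in law (for local weak convergence of the associated point measures), as $n\to\infty$, of the set $L_n$ of all determinations of the arguments of the $n$ points of a Circular $\beta$ Ensemble of order $n$, multiplied by $n$, i.e. $L_n=\{n\theta:\theta\in\mathbb{R},\ e^{i\theta}\in\{\lambda_1,\dots,\lambda_n\}\}$. This limit is known to exist (Killip and Stoiciu). With this normalization the average density of points is $1/(2\pi)$. *)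

theory Defs
  imports "HOL-Probability.Probability"
begin

subsection \<open>The Circular Beta Ensemble\<close>

text \<open>Arc-length measure on the unit circle, as a Borel measure on \<^typ>\<open>complex\<close>.\<close>

definition circle_measure :: "complex measure" where
  "circle_measure = distr (restrict_space lborel {0..<2 * pi}) borel cis"

definition cbe_weight :: "real \<Rightarrow> nat \<Rightarrow> (nat \<Rightarrow> complex) \<Rightarrow> real" where
  "cbe_weight \<beta> n z = (\<Prod>k<n. \<Prod>j<k. cmod (z j - z k) powr \<beta>)"

text \<open>The joint law of the labelled points, on the product space indexed by \<open>{..<n}\<close>.\<close>

definition cbe :: "real \<Rightarrow> nat \<Rightarrow> (nat \<Rightarrow> complex) measure" where
  "cbe \<beta> n =
     (let M = PiM {..<n} (\<lambda>_. circle_measure)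
      in density M (\<lambda>z. ennreal (cbe_weight \<beta> n z) / (\<integral>\<^sup>+z. ennreal (cbe_weight \<beta> n z) \<partial>M)))"

definition cbe_points :: "nat \<Rightarrow> (nat \<Rightarrow> complex) \<Rightarrow> complex set" where
  "cbe_points n z = z ` {..<n}"

text \<open>Arcs are the images of real intervals. An interval of length at least \<open>2\<pi>\<close> may give the
  whole circle, so the length of an arc is its \<^const>\<open>circle_measure\<close>, not the length of the
  parametrizing interval.\<close>

definition circle_arc :: "complex set \<Rightarrow> bool" where
  "circle_arc I \<longleftrightarrow> (\<exists>J :: real set. is_interval J \<and> I = cis ` J)"


subsection \<open>Point processes on the real line\<close>

text \<open>A point process is given by its law on the space of locally finite, integer-valued Borel
  measures (finiteness on bounded sets is implied by the values being natural numbers).\<close>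

definition point_measures :: "real measure set" where
  "point_measures =
     {\<mu>. sets \<mu> = sets borel \<and> (\<forall>A \<in> sets borel. bounded A \<longrightarrow> emeasure \<mu> A \<in> range of_nat)}"

definition point_measure_algebra :: "real measure measure" where
  "point_measure_algebra =
     (SUP A \<in> sets borel. vimage_algebra point_measures (\<lambda>\<mu>. emeasure \<mu> A) borel)"

text \<open>The topology of local weak (vague) convergence: the coarsest one making integration of
  every compactly supported continuous function continuous.\<close>

definition vague_topology :: "real measure topology" where
  "vague_topology = topology_generated_by
     {{\<mu> \<in> point_measures. (\<integral>x. f x \<partial>\<mu>) \<in> U} | (f :: real \<Rightarrow> real) (U :: real set).
        continuous_on UNIV f \<and> compact (closure {x. f x \<noteq> 0}) \<and> open U}"

definition converges_in_law :: "(nat \<Rightarrow> real measure measure) \<Rightarrow> real measure measure \<Rightarrow> bool" where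
  "converges_in_law P Q \<longleftrightarrow>
     (\<forall>F :: real measure \<Rightarrow> real.
        continuous_map vague_topology euclideanreal F \<and> bounded (F ` point_measures) \<longrightarrow>
        (\<lambda>n. \<integral>\<mu>. F \<mu> \<partial>P n) \<longlonglongrightarrow> (\<integral>\<mu>. F \<mu> \<partial>Q))"

definition point_measure_of :: "real set \<Rightarrow> real measure" where
  "point_measure_of S = distr (count_space S) borel (\<lambda>x. x)"


subsection \<open>The Sine-beta process\<close>

definition cbe_args :: "nat \<Rightarrow> (nat \<Rightarrow> complex) \<Rightarrow> real set" where
  "cbe_args n z = {real n * \<theta> | \<theta>. cis \<theta> \<in> cbe_points n z}"

definition cbe_args_law :: "real \<Rightarrow> nat \<Rightarrow> real measure measure" where
  "cbe_args_law \<beta> n =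
     distr (cbe \<beta> n) point_measure_algebra (\<lambda>z. point_measure_of (cbe_args n z))"

text \<open>\<open>P\<close> is the law of the Sine-beta process, viewed as a random point measure.\<close>

definition sine_beta_law :: "real \<Rightarrow> real measure measure \<Rightarrow> bool" where
  "sine_beta_law \<beta> P \<longleftrightarrow>
     prob_space P \<and> sets P = sets point_measure_algebra \<and> converges_in_law (cbe_args_law \<beta>) P"


subsection \<open>Variance bounds\<close>

text \<open>Square-integrability is required explicitly, since the Bochner integral defining the variance
  would be 0 by convention if the second moment were infinite.\<close>

definition variance_at_most :: "'a measure \<Rightarrow> ('a \<Rightarrow> real) \<Rightarrow> real \<Rightarrow> bool" where
  "variance_at_most M X c \<longleftrightarrow>
     integrable M X \<and> integrable M (\<lambda>x. (X x)\<^sup>2) \<and> prob_space.variance M X \<le> c"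


subsection \<open>Basic facts\<close>

lemma sets_circle_measure [simp, measurable_cong]: "sets circle_measure = sets borel"
  by (simp add: circle_measure_def)

lemma space_circle_measure [simp]: "space circle_measure = UNIV"
  by (simp add: circle_measure_def)

lemma measurable_cis: "cis \<in> restrict_space lborel {0..<2 * pi} \<rightarrow>\<^sub>M borel"
proof -
  have "cis \<in> borel_measurable borel"
    by (intro borel_measurable_continuous_onI continuous_intros)
  then show ?thesis
    by (intro measurable_restrict_space1) simp
qed

lemma emeasure_circle_measure_UNIV: "emeasure circle_measure UNIV = ennreal (2 * pi)"
proof -
  have "emeasure circle_measure UNIV = emeasure (restrict_space lborel {0..<2 * pi}) {0..<2 * pi}"
    unfolding circle_measure_def
    by (subst emeasure_distr[OF measurable_cis]) (simp_all add: space_restrict_space)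
  then show ?thesis by (simp add: emeasure_restrict_space)
qed

lemma space_point_measure_algebra [simp]: "space point_measure_algebra = point_measures"
  by (auto simp: point_measure_algebra_def space_Sup_eq_UN)

lemma measurable_emeasure_point_measure_algebra:
  "A \<in> sets borel \<Longrightarrow> (\<lambda>\<mu>. emeasure \<mu> A) \<in> borel_measurable point_measure_algebra"
  by (auto intro!: measurable_Sup1 measurable_vimage_algebra1 simp: point_measure_algebra_def)

lemma topspace_vague_topology [simp]: "topspace vague_topology = point_measures"
proof -
  have "\<exists>(f :: real \<Rightarrow> real) (U :: real set). point_measures = {\<mu> \<in> point_measures. (\<integral>x. f x \<partial>\<mu>) \<in> U}
      \<and> continuous_on UNIV f \<and> compact (closure {x. f x \<noteq> 0}) \<and> open U"
    by (rule exI[of _ "\<lambda>_. 0"], rule exI[of _ UNIV]) auto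
  then show ?thesis
    unfolding vague_topology_def topology_generated_by_topspace by blast
qed

lemma emeasure_point_measure_of:
  "A \<in> sets borel \<Longrightarrow> emeasure (point_measure_of S) A = emeasure (count_space UNIV) (A \<inter> S)"
  by (simp add: point_measure_of_def emeasure_distr emeasure_count_space)

end

theory Submission
  imports Defs
begin

text \<open>
  Let \<open>p\<^sub>k = \<Sum>\<^sub>j z\<^sub>j\<^sup>k\<close> be the power sums of the ensemble, put \<open>H(y) = r y / (1 - r y)\<close> for \<open>0 < r < 1\<close>,
  \<open>G = \<Sum>\<^sub>j H(z\<^sub>j) = \<Sum>\<^sub>k r\<^sup>k p\<^sub>k\<close> and \<open>D = \<Sum>\<^sub>j z\<^sub>j H'(z\<^sub>j)\<close>. Integration by parts along the vector field with
  components \<open>H(z\<^sub>i) cnj G\<close> in the angles gives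
  \<open>(\<beta>/2) E[(n + G) |G|\<^sup>2] = E[\<Sum>\<^sub>j H(z\<^sub>j) cnj (z\<^sub>j H'(z\<^sub>j))] + (\<beta>/2 - 1) E[D cnj G]\<close>.
  Now \<open>a = n + 2 Re G = \<Sum>\<^sub>j (1 - r\<^sup>2) / |1 - r z\<^sub>j|\<^sup>2\<close> is positive with mean \<open>n\<close>, and \<open>|D| \<le> r a / (1 - r\<^sup>2)\<close>.
  Since \<open>n + Re G = (n + a) / 2\<close>, the cubic term on the left is \<open>(\<beta>/4) E[n |G|\<^sup>2 + a |G|\<^sup>2]\<close>, and its second
  part absorbs the term with \<open>D\<close>. This yields \<open>E |G|\<^sup>2 \<le> C / (1 - r\<^sup>2)\<^sup>2\<close> uniformly in \<open>n\<close>. By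
  rotation invariance the left side is \<open>\<Sum>\<^sub>k r\<^sup>2\<^sup>k E |p\<^sub>k|\<^sup>2\<close>, so \<open>\<Sum>\<^sub>k\<^sub>\<le>\<^sub>K E |p\<^sub>k|\<^sup>2 \<le> C' K\<^sup>2\<close> for all \<open>K\<close>.

  The indicator of an arc lies between two functions smoothed at scale \<open>1/n\<close>, whose Fourier
  coefficients are bounded by \<open>min (|I| + 1/n) (2/k)\<close> times \<open>min 1 (2n/k)\<close>. Summation by parts then gives the logarithmic
  bound for the second moment of the deviation of the number of points from \<open>n|I|/(2\<pi>)\<close>. For the
  limit process the interval is compared with continuous functions of compact support; truncated
  squares of their integrals are continuous for the vague topology, and monotone convergence removes the truncation.
\<close>

subsection \<open>Integration on the torus\<close>

text \<open>For general \<beta> there is no determinantal structure, so the moments are reached only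
  through integration by parts, and the resulting identities do not close: the one for second
  moments contains a third moment. The factor \<open>cnj G\<close> in the field is chosen so that
  this third moment becomes (n + G) times |G|^2, whose real part has a sign by positivity of a; no
  third moment ever has to be estimated. What comes out is control of the averages of E |p_k|^2 over
  k up to K, not of single moments, which is why the Fourier bounds have to be monotone and are
  summed by parts. The bound of order K^2 ignores n and is wasteful for K above n: for \<beta> = 2,
  for instance, E |p_k|^2 is min(k, n). Frequencies above n must therefore be damped, which forces a
  smoothing. At scale 1/n it changes the expected count by a bounded amount only, and this is
  absorbed in the logarithm of a number that is at least 2.\<close>

lemma integral_circle_measure:
  fixes f :: "complex \<Rightarrow> 'b::{banach, second_countable_topology}"
  assumes "f \<in> borel_measurable borel"
  shows "(\<integral>y. f y \<partial>circle_measure) = set_lebesgue_integral lborel {0..<2 * pi} (\<lambda>t. f (cis t))"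
  unfolding circle_measure_def
  by (subst integral_distr[OF measurable_cis]) (auto simp: assms integral_restrict_space set_lebesgue_integral_def)

lemma borel_cis_preimage:
  assumes "A \<in> sets borel"
  shows "{t \<in> {0..<2 * pi}. cis t \<in> A} \<in> sets borel"
proof -
  have cis: "cis \<in> borel_measurable borel"
    by (intro borel_measurable_continuous_onI continuous_intros)
  have "{0..<2 * pi} \<inter> (cis -` A \<inter> space borel) \<in> sets borel"
    by (intro sets.Int measurable_sets[OF cis] assms) auto
  then show ?thesis by (simp add: Int_def vimage_def conj_commute)
qed

lemma emeasure_circle_measure:
  assumes "A \<in> sets borel"
  shows "emeasure circle_measure A = emeasure lborel {t \<in> {0..<2 * pi}. cis t \<in> A}"
  unfolding circle_measure_def using borel_cis_preimage[OF assms]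
  by (subst emeasure_distr[OF measurable_cis])
     (auto simp: assms emeasure_restrict_space space_restrict_space intro!: arg_cong[where f="emeasure lborel"])

lemma borel_measurable_cnj [measurable (raw)]:
  "f \<in> borel_measurable M \<Longrightarrow> (\<lambda>x. cnj (f x)) \<in> borel_measurable M"
  by (erule measurable_compose) (intro borel_measurable_continuous_onI continuous_intros)

lemma finite_measure_circle_measure: "finite_measure circle_measure"
  by (rule finite_measureI) (simp add: emeasure_circle_measure_UNIV)

interpretation circle: finite_measure circle_measure
  by (rule finite_measure_circle_measure)

interpretation torus: product_sigma_finite "\<lambda>_::nat. circle_measure"
  by unfold_locales

abbreviation torus :: "nat \<Rightarrow> (nat \<Rightarrow> complex) measure" where
  "torus n \<equiv> PiM {..<n} (\<lambda>_. circle_measure)"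

abbreviation on_torus :: "nat \<Rightarrow> (nat \<Rightarrow> complex) \<Rightarrow> bool" where
  "on_torus n z \<equiv> \<forall>i<n. cmod (z i) = 1"

lemma finite_measure_torus: "finite_measure (torus n)"
proof (rule finite_measureI)
  have "emeasure (torus n) (space (torus n)) = (\<Prod>i<n. emeasure circle_measure UNIV)"
    unfolding space_PiM by (subst torus.emeasure_PiM) auto
  then show "emeasure (torus n) (space (torus n)) \<noteq> \<infinity>"
    by (simp add: emeasure_circle_measure_UNIV ennreal_power)
qed

lemma torus_null_component:
  assumes "i < n" "N \<in> sets borel" "emeasure circle_measure N = 0"
  shows "AE z in torus n. z i \<notin> N"
proof (rule AE_I)
  let ?A = "PiE {..<n} (\<lambda>j. if j = i then N else UNIV)"
  show "{z \<in> space (torus n). \<not> z i \<notin> N} \<subseteq> ?A"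
    by (auto simp: space_PiM PiE_def Pi_def)
  show "emeasure (torus n) ?A = 0"
    using assms by (subst torus.emeasure_PiM) (auto intro!: prod_zero)
  show "?A \<in> sets (torus n)"
    using assms by (intro sets_PiM_I_finite) auto
qed

lemma AE_torus_norm: "AE z in torus n. on_torus n z"
proof -
  have N: "{y. cmod y \<noteq> 1} \<in> sets (borel :: complex measure)"
    by measurable
  then have "emeasure circle_measure {y. cmod y \<noteq> 1} = 0"
    by (subst emeasure_circle_measure) auto
  then have "AE z in torus n. z i \<notin> {y. cmod y \<noteq> 1}" if "i < n" for i
    using torus_null_component[OF that N] by simp
  then have "AE z in torus n. \<forall>i\<in>{..<n}. cmod (z i) = 1"
    by (intro AE_finite_allI) auto
  then show ?thesis by (simp add: Ball_def)
qed

lemma integral_circle_measure_deriv_eq_0: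
  fixes f f' :: "complex \<Rightarrow> complex"
  assumes deriv: "\<And>t. ((\<lambda>t. f (cis t)) has_vector_derivative f' (cis t)) (at t)"
    and meas: "f' \<in> borel_measurable borel"
  shows "(\<integral>y. f' y \<partial>circle_measure) = 0"
proof -
  let ?g = "\<lambda>t. f' (cis t)"
  have hi: "(?g has_integral f (cis (2 * pi)) - f (cis 0)) {0..2 * pi}"
    by (intro fundamental_theorem_of_calculus) (auto intro: has_vector_derivative_at_within deriv)
  have eq: "set_lebesgue_integral lborel {0..<2 * pi} ?g = set_lebesgue_integral lborel {0..2 * pi} ?g"
  proof -
    have "AE t in lborel. t \<noteq> 2 * pi" by (rule AE_lborel_singleton)
    moreover have "?g \<in> borel_measurable borel"
      by (intro measurable_compose[OF _ meas] borel_measurable_continuous_onI continuous_intros)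
    ultimately show ?thesis
      unfolding set_lebesgue_integral_def
      by (intro integral_cong_AE) (auto simp: indicator_def)
  qed
  have "set_lebesgue_integral lborel {0..2 * pi} ?g = 0"
  proof (cases "set_integrable lborel {0..2 * pi} ?g")
    case True
    then show ?thesis
      using set_borel_integral_eq_integral(2)[OF True] hi by (simp add: integral_unique)
  next
    \<comment> \<open>The Bochner integral is then 0 by convention.\<close>
    case False
    then show ?thesis
      unfolding set_integrable_def set_lebesgue_integral_def by (rule not_integrable_integral_eq)
  qed
  with eq show ?thesis
    by (subst integral_circle_measure[OF meas]) simp
qed

text \<open>Fubini with the i-th angle integrated first: each inner integral vanishes by
  periodicity. Slices on which the inner function is not integrable cause no trouble, since there
  the integral is 0 by convention.\<close>

lemma integral_torus_deriv_eq_0: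
  fixes f f' :: "(nat \<Rightarrow> complex) \<Rightarrow> complex"
  assumes i: "i < n"
    and deriv: "\<And>z t. ((\<lambda>t. f (z(i := cis t))) has_vector_derivative f' (z(i := cis t))) (at t)"
    and int: "integrable (torus n) f'"
  shows "(\<integral>z. f' z \<partial>torus n) = 0"
proof -
  have ins: "{..<n} = insert i ({..<n} - {i})" using i by auto
  have meas: "f' \<in> borel_measurable (PiM (insert i ({..<n} - {i})) (\<lambda>_. circle_measure))"
    using int ins by auto
  have "(\<integral>z. f' z \<partial>torus n) = (\<integral>z. (\<integral>y. f' (z(i := y)) \<partial>circle_measure) \<partial>PiM ({..<n} - {i}) (\<lambda>_. circle_measure))"
    using int ins by (subst ins, subst torus.product_integral_insert) auto
  also have "\<dots> = (\<integral>z. 0 \<partial>PiM ({..<n} - {i}) (\<lambda>_. circle_measure))"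
  proof (rule Bochner_Integration.integral_cong[OF refl])
    fix z :: "nat \<Rightarrow> complex"
    assume z: "z \<in> space (PiM ({..<n} - {i}) (\<lambda>_. circle_measure))"
    have "(\<lambda>y. z(i := y)) \<in> borel \<rightarrow>\<^sub>M PiM (insert i ({..<n} - {i})) (\<lambda>_. circle_measure)"
      using measurable_component_update[OF z, of i] by auto
    then have "(\<lambda>y. f' (z(i := y))) \<in> borel_measurable borel"
      by (rule measurable_compose) (rule meas)
    then show "(\<integral>y. f' (z(i := y)) \<partial>circle_measure) = 0"
      by (intro integral_circle_measure_deriv_eq_0[where f="\<lambda>y. f (z(i := y))"] deriv)
  qed
  finally show ?thesis by simp
qed

subsection \<open>Integration by parts\<close>

text \<open>\<open>f'\<close> is a function of the whole point rather than of the angle, so that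
  derivatives can be combined and integrated over the torus. Only coordinate \<open>i\<close> is put
  on the circle; the others are arbitrary complex numbers.\<close>

definition angular_deriv ::
    "nat \<Rightarrow> ((nat \<Rightarrow> complex) \<Rightarrow> complex) \<Rightarrow> ((nat \<Rightarrow> complex) \<Rightarrow> complex) \<Rightarrow> bool" where
  "angular_deriv i f f' \<longleftrightarrow>
     (\<forall>z t. ((\<lambda>t. f (z(i := cis t))) has_vector_derivative f' (z(i := cis t))) (at t))"

lemma angular_deriv_eq_rhs:
  "angular_deriv i f f' \<Longrightarrow> (\<And>z. f' z = g' z) \<Longrightarrow> angular_deriv i f g'"
  by (simp add: angular_deriv_def)

lemma angular_deriv_mult:
  assumes "angular_deriv i f f'" "angular_deriv i g g'"
  shows "angular_deriv i (\<lambda>z. f z * g z) (\<lambda>z. f z * g' z + f' z * g z)"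
  using assms unfolding angular_deriv_def by (auto intro!: has_vector_derivative_mult)

lemma angular_deriv_sum:
  assumes "\<And>j. j \<in> S \<Longrightarrow> angular_deriv i (f j) (f' j)"
  shows "angular_deriv i (\<lambda>z. \<Sum>j\<in>S. f j z) (\<lambda>z. \<Sum>j\<in>S. f' j z)"
  using assms unfolding angular_deriv_def by (auto intro!: has_vector_derivative_sum)

lemma angular_deriv_cnj:
  assumes "angular_deriv i f f'"
  shows "angular_deriv i (\<lambda>z. cnj (f z)) (\<lambda>z. cnj (f' z))"
  using assms unfolding angular_deriv_def by (auto intro!: has_vector_derivative_cnj)

lemma angular_deriv_component:
  assumes "\<And>y. cmod y = 1 \<Longrightarrow> (h has_field_derivative h' y) (at y)"
  shows "angular_deriv i (\<lambda>z. h (z j)) (\<lambda>z. if i = j then \<i> * z j * h' (z j) else 0)"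
  unfolding angular_deriv_def
proof (intro allI)
  fix z :: "nat \<Rightarrow> complex" and t :: real
  show "((\<lambda>t. h ((z(i := cis t)) j)) has_vector_derivative
      (if i = j then \<i> * (z(i := cis t)) j * h' ((z(i := cis t)) j) else 0)) (at t)"
  proof (cases "i = j")
    case True
    have "(cis has_vector_derivative (\<i> * cis t)) (at t)"
      unfolding has_vector_derivative_def by (auto intro!: derivative_eq_intros simp: scaleR_conv_of_real)
    then have "((h \<circ> cis) has_vector_derivative ((\<i> * cis t) * h' (cis t))) (at t)"
      by (rule field_vector_diff_chain_at) (rule assms, simp)
    with True show ?thesis by (simp add: o_def)
  next
    case False
    then show ?thesis by auto
  qed
qed

text \<open>On the unit circle, with angular difference x, \<open>angular_kernel 0\<close> is
  cot(x/2)/2, the derivative of the logarithm of the distance in the angle of \<open>u\<close>; a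
  positive \<open>\<epsilon>\<close> removes the pole at \<open>u = v\<close>.\<close>

definition angular_kernel :: "real \<Rightarrow> complex \<Rightarrow> complex \<Rightarrow> real" where
  "angular_kernel \<epsilon> u v = Im (u * cnj v) / ((cmod (u - v))\<^sup>2 + \<epsilon>)"

lemma abs_Im_mult_cnj_le:
  assumes "cmod v = 1"
  shows "\<bar>Im (u * cnj v)\<bar> \<le> cmod (u - v)"
proof -
  have "v * cnj v = 1"
    using assms by (simp add: complex_norm_square[symmetric])
  then have "Im (u * cnj v) = Im ((u - v) * cnj v)"
    by (simp add: algebra_simps)
  also have "\<bar>\<dots>\<bar> \<le> cmod ((u - v) * cnj v)" by (rule abs_Im_le_cmod)
  finally show ?thesis using assms by (simp add: norm_mult)
qed

text \<open>The singularity is of first order, so one factor \<open>cmod (u - v)\<close> cancels it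
  uniformly in \<open>\<epsilon>\<close>, including \<open>\<epsilon> = 0\<close>, where the kernel
  at \<open>u = v\<close> is 0 by division by zero.\<close>

lemma angular_kernel_bound:
  assumes "\<epsilon> \<ge> 0" "cmod v = 1"
  shows "cmod (u - v) * \<bar>angular_kernel \<epsilon> u v\<bar> \<le> 1"
proof -
  have "cmod (u - v) * \<bar>Im (u * cnj v)\<bar> \<le> (cmod (u - v))\<^sup>2"
    using mult_left_mono[OF abs_Im_mult_cnj_le[OF assms(2), of u], of "cmod (u - v)"]
    by (simp add: power2_eq_square)
  also have "\<dots> \<le> (cmod (u - v))\<^sup>2 + \<epsilon>" using assms by simp
  finally have "cmod (u - v) * \<bar>Im (u * cnj v)\<bar> / ((cmod (u - v))\<^sup>2 + \<epsilon>) \<le> 1"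
    using assms(1) by (intro divide_le_eq_1[THEN iffD2]) (smt (verit) zero_le_power2)
  then show ?thesis
    using assms(1) by (simp add: angular_kernel_def abs_divide abs_of_nonneg)
qed

lemma angular_kernel_bound':
  assumes "\<epsilon> > 0" "cmod u = 1" "cmod v = 1"
  shows "\<bar>angular_kernel \<epsilon> u v\<bar> \<le> 1 / \<epsilon>"
proof -
  have "\<bar>Im (u * cnj v)\<bar> \<le> 1"
    using abs_Im_le_cmod[of "u * cnj v"] assms by (simp add: norm_mult)
  then show ?thesis
    unfolding angular_kernel_def abs_divide using assms
    by (intro frac_le) auto
qed

text \<open>Each squared distance is increased by \<open>\<epsilon>\<close>. The exponential form
  makes differentiation a multiplication by the derivative of the exponent;
  \<open>cbe_weight_reg_eq\<close> recovers the product.\<close>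

definition cbe_weight_reg :: "real \<Rightarrow> real \<Rightarrow> nat \<Rightarrow> (nat \<Rightarrow> complex) \<Rightarrow> real" where
  "cbe_weight_reg \<beta> \<epsilon> n z = exp (\<Sum>k<n. \<Sum>j<k. \<beta> / 2 * ln ((cmod (z j - z k))\<^sup>2 + \<epsilon>))"

lemma has_derivative_log_dist:
  assumes "\<epsilon> > 0" "j \<noteq> k"
  shows "((\<lambda>t. ln ((cmod ((z(i := cis t)) j - (z(i := cis t)) k))\<^sup>2 + \<epsilon>)) has_real_derivative
     (of_bool (i = j) - of_bool (i = k)) * (2 * angular_kernel \<epsilon> ((z(i := cis t)) j) ((z(i := cis t)) k))) (at t)"
proof -
  have pos: "(x::real)\<^sup>2 + y\<^sup>2 + \<epsilon> > 0" for x y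
    using assms by (intro add_nonneg_pos) auto
  have D: "((\<lambda>t. ln ((cmod (cis t - v))\<^sup>2 + \<epsilon>)) has_real_derivative
      2 * angular_kernel \<epsilon> (cis t) v) (at t)" for v
  proof -
    have q: "(cmod (cis t - v))\<^sup>2 = (cos t - Re v)\<^sup>2 + (sin t - Im v)\<^sup>2" for t
      by (simp add: cmod_power2)
    show ?thesis
      unfolding angular_kernel_def q
      apply (rule derivative_eq_intros refl pos)+
      apply (simp add: algebra_simps diff_divide_distrib add_divide_distrib)
      done
  qed
  consider "i = j" | "i = k" "i \<noteq> j" | "i \<noteq> j" "i \<noteq> k" by blast
  then show ?thesis
  proof cases
    case 1 then show ?thesis using \<open>j \<noteq> k\<close> D[of "z k"] by simp
  next
    case 2
    have "angular_kernel \<epsilon> (cis t) (z j) = - angular_kernel \<epsilon> (z j) (cis t)"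
      by (simp add: angular_kernel_def norm_minus_commute minus_divide_left algebra_simps del: divide_minus_left)
    then show ?thesis using 2 \<open>j \<noteq> k\<close> D[of "z j"] by (simp add: norm_minus_commute)
  next
    case 3 then show ?thesis by simp
  qed
qed

definition log_weight_deriv :: "real \<Rightarrow> real \<Rightarrow> nat \<Rightarrow> nat \<Rightarrow> (nat \<Rightarrow> complex) \<Rightarrow> real" where
  "log_weight_deriv \<beta> \<epsilon> n i z =
     (\<Sum>k<n. \<Sum>j<k. \<beta> * (of_bool (i = j) - of_bool (i = k)) * angular_kernel \<epsilon> (z j) (z k))"

lemma angular_deriv_weight_reg:
  assumes "\<epsilon> > 0"
  shows "angular_deriv i (\<lambda>z. of_real (cbe_weight_reg \<beta> \<epsilon> n z))
    (\<lambda>z. of_real (cbe_weight_reg \<beta> \<epsilon> n z * log_weight_deriv \<beta> \<epsilon> n i z))"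
  unfolding angular_deriv_def log_weight_deriv_def
proof (intro allI has_vector_derivative_of_real)
  fix z :: "nat \<Rightarrow> complex" and t :: real
  show "((\<lambda>t. cbe_weight_reg \<beta> \<epsilon> n (z(i := cis t))) has_real_derivative
     cbe_weight_reg \<beta> \<epsilon> n (z(i := cis t)) * (\<Sum>k<n. \<Sum>j<k. \<beta> * (of_bool (i = j) - of_bool (i = k)) *
        angular_kernel \<epsilon> ((z(i := cis t)) j) ((z(i := cis t)) k))) (at t)"
    unfolding cbe_weight_reg_def
    by (rule derivative_eq_intros has_derivative_log_dist assms refl | simp add: mult_ac)+
qed

lemma cbe_weight_reg_le:
  assumes "\<beta> > 0" "0 < \<epsilon>" "\<epsilon> \<le> 1" "on_torus n z"
  shows "cbe_weight_reg \<beta> \<epsilon> n z \<le> exp (\<Sum>k<n. \<Sum>j<k. \<beta> / 2 * ln 5)"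
  unfolding cbe_weight_reg_def
proof (intro exp_le_cancel_iff[THEN iffD2] sum_mono)
  fix k j assume "k \<in> {..<n}" "j \<in> {..<k}"
  then have "cmod (z j) = 1" "cmod (z k) = 1" using assms by auto
  then have "cmod (z j - z k) \<le> 2" using norm_triangle_ineq4[of "z j" "z k"] by simp
  then have "(cmod (z j - z k))\<^sup>2 \<le> 2\<^sup>2" by (intro power_mono) auto
  then have "(cmod (z j - z k))\<^sup>2 + \<epsilon> \<le> 5" using assms by simp
  moreover have "(cmod (z j - z k))\<^sup>2 + \<epsilon> > 0" using assms by (intro add_nonneg_pos) auto
  ultimately show "\<beta> / 2 * ln ((cmod (z j - z k))\<^sup>2 + \<epsilon>) \<le> \<beta> / 2 * ln 5"
    using assms by (intro mult_left_mono) auto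
qed

lemma cbe_weight_reg_pos: "cbe_weight_reg \<beta> \<epsilon> n z > 0"
  by (simp add: cbe_weight_reg_def)

lemma cbe_weight_reg_eq:
  assumes "\<epsilon> > 0"
  shows "cbe_weight_reg \<beta> \<epsilon> n z = (\<Prod>k<n. \<Prod>j<k. ((cmod (z j - z k))\<^sup>2 + \<epsilon>) powr (\<beta> / 2))"
proof -
  have "(cmod (z j - z k))\<^sup>2 + \<epsilon> \<noteq> 0" for j k
    using assms by (smt (verit) zero_le_power2)
  then show ?thesis
    by (simp add: cbe_weight_reg_def exp_sum powr_def)
qed

lemma tendsto_cbe_weight_reg:
  assumes "\<beta> > 0" "e \<longlonglongrightarrow> 0" "\<And>m. e m > 0"
  shows "(\<lambda>m. cbe_weight_reg \<beta> (e m) n z) \<longlonglongrightarrow> cbe_weight \<beta> n z"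
proof -
  have "cbe_weight \<beta> n z = (\<Prod>k<n. \<Prod>j<k. ((cmod (z j - z k))\<^sup>2 + 0) powr (\<beta> / 2))"
    unfolding cbe_weight_def
  proof (intro prod.cong refl)
    fix k j
    have "((cmod (z j - z k))\<^sup>2) powr (\<beta> / 2) = (cmod (z j - z k) powr 2) powr (\<beta> / 2)"
      by simp
    also have "\<dots> = cmod (z j - z k) powr \<beta>" by (subst powr_powr) simp
    finally show "cmod (z j - z k) powr \<beta> = ((cmod (z j - z k))\<^sup>2 + 0) powr (\<beta> / 2)" by simp
  qed
  then show ?thesis
    using assms unfolding cbe_weight_reg_eq[OF assms(3)]
    by (auto intro!: tendsto_eq_intros always_eventually add_nonneg_nonneg simp: less_imp_le)
qed

lemma borel_measurable_torus_component:
  "j < n \<Longrightarrow> (\<lambda>z. z j) \<in> borel_measurable (torus n)"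
  using measurable_component_singleton[of j "{..<n}" "\<lambda>_. circle_measure"] by simp

lemma borel_measurable_angular_kernel:
  assumes "f \<in> borel_measurable M" "g \<in> borel_measurable M"
  shows "(\<lambda>z. angular_kernel \<epsilon> (f z) (g z)) \<in> borel_measurable M"
proof -
  have "Im (u * cnj v) = Im u * Re v - Re u * Im v" for u v
    by simp
  then show ?thesis
    unfolding angular_kernel_def using assms by simp
qed

lemma borel_measurable_cbe_weight_reg: "cbe_weight_reg \<beta> \<epsilon> n \<in> borel_measurable (torus n)"
  unfolding cbe_weight_reg_def
  by (intro borel_measurable_sum borel_measurable_times borel_measurable_const borel_measurable_ln
     borel_measurable_add borel_measurable_power borel_measurable_diff borel_measurable_torus_component measurable_compose[OF _ borel_measurable_exp]
     measurable_compose[OF _ borel_measurable_norm]) auto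

lemma borel_measurable_cbe_weight: "cbe_weight \<beta> n \<in> borel_measurable (torus n)"
  unfolding cbe_weight_def
  by (intro borel_measurable_prod powr_real_measurable borel_measurable_const
      measurable_compose[OF _ borel_measurable_norm] borel_measurable_diff borel_measurable_torus_component) auto

text \<open>The divergence of \<open>F\<close> relative to the weight: the ordinary divergence plus
  \<open>F\<close> paired with the gradient of the logarithm of the weight. The pairing is arranged
  by pairs of points, so that only differences \<open>F j z - F k z\<close> meet the singular
  kernel.\<close>

definition loop_integrand ::
    "real \<Rightarrow> real \<Rightarrow> nat \<Rightarrow> (nat \<Rightarrow> (nat \<Rightarrow> complex) \<Rightarrow> complex) \<Rightarrow>
     (nat \<Rightarrow> (nat \<Rightarrow> complex) \<Rightarrow> complex) \<Rightarrow> (nat \<Rightarrow> complex) \<Rightarrow> complex" where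
  "loop_integrand \<beta> \<epsilon> n F F' z =
     (\<Sum>i<n. F' i z) + \<beta> * (\<Sum>k<n. \<Sum>j<k. (F j z - F k z) * of_real (angular_kernel \<epsilon> (z j) (z k)))"

lemma sum_of_bool_diff:
  fixes f :: "nat \<Rightarrow> 'a::comm_ring_1"
  assumes "j < n" "k < n"
  shows "(\<Sum>i<n. f i * (of_bool (i = j) - of_bool (i = k))) = f j - f k"
proof -
  have "(\<Sum>i<n. f i * (of_bool (i = j) - of_bool (i = k))) =
      (\<Sum>i<n. if i = j then f i else 0) - (\<Sum>i<n. if i = k then f i else 0)"
    by (subst sum_subtractf[symmetric], rule sum.cong) (auto simp: algebra_simps)
  also have "\<dots> = f j - f k"
    using assms by (simp only: sum.delta finite_lessThan) auto
  finally show ?thesis .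
qed

lemma integral_torus_angular_deriv:
  assumes "i < n" "angular_deriv i f f'" "integrable (torus n) f'"
  shows "(\<integral>z. f' z \<partial>torus n) = 0"
  using assms unfolding angular_deriv_def by (intro integral_torus_deriv_eq_0[of i n f f']) auto

text \<open>\<open>F' i\<close> is the derivative of the single component \<open>F i\<close> in the
  i-th angle, as only the divergence matters. The condition \<open>lip\<close> compares two
  components at the same configuration, not one component at two configurations: points that merge
  must have merging velocities. One constant \<open>B\<close> serves all bounds.\<close>

locale torus_field =
  fixes n :: nat and F F' :: "nat \<Rightarrow> (nat \<Rightarrow> complex) \<Rightarrow> complex" and B :: real
  assumes deriv: "i < n \<Longrightarrow> angular_deriv i (F i) (F' i)"
    and meas: "i < n \<Longrightarrow> F i \<in> borel_measurable (torus n)" "i < n \<Longrightarrow> F' i \<in> borel_measurable (torus n)"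
    and bound: "i < n \<Longrightarrow> on_torus n z \<Longrightarrow> norm (F i z) \<le> B"
      "i < n \<Longrightarrow> on_torus n z \<Longrightarrow> norm (F' i z) \<le> B"
    and lip: "j < n \<Longrightarrow> k < n \<Longrightarrow> on_torus n z \<Longrightarrow>
      norm (F j z - F k z) \<le> B * cmod (z j - z k)"
    and B: "B \<ge> 0"
begin

lemma integrable_deriv_weight_reg:
  assumes i: "i < n" and \<beta>: "\<beta> > 0" and \<epsilon>: "0 < \<epsilon>" "\<epsilon> \<le> 1"
  shows "integrable (torus n) (\<lambda>z. F i z * of_real (cbe_weight_reg \<beta> \<epsilon> n z * log_weight_deriv \<beta> \<epsilon> n i z)
      + F' i z * of_real (cbe_weight_reg \<beta> \<epsilon> n z))" (is "integrable _ ?f")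
proof -
  interpret finite_measure "torus n" by (rule finite_measure_torus)
  let ?W = "exp (\<Sum>k<n. \<Sum>j<k. \<beta> / 2 * ln 5)"
  show ?thesis
  proof (rule integrable_const_bound)
    show "AE z in torus n. norm (?f z) \<le> B * (?W * (\<Sum>k<n. \<Sum>j<k. \<beta> * 1 * (1 / \<epsilon>))) + B * ?W"
      using AE_torus_norm
    proof eventually_elim
      fix z :: "nat \<Rightarrow> complex" assume z: "on_torus n z"
      have W: "\<bar>cbe_weight_reg \<beta> \<epsilon> n z\<bar> \<le> ?W"
        using cbe_weight_reg_le[OF \<beta> \<epsilon> z] cbe_weight_reg_pos[of \<beta> \<epsilon> n z] by simp
      have "\<bar>log_weight_deriv \<beta> \<epsilon> n i z\<bar>
          \<le> (\<Sum>k<n. \<Sum>j<k. \<bar>\<beta> * (of_bool (i = j) - of_bool (i = k)) * angular_kernel \<epsilon> (z j) (z k)\<bar>)"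
        unfolding log_weight_deriv_def by (intro order_trans[OF sum_abs] sum_mono order_refl)
      also have "\<dots> \<le> (\<Sum>k<n. \<Sum>j<k. \<beta> * 1 * (1 / \<epsilon>))"
        unfolding abs_mult using \<beta> \<epsilon> z
        by (intro sum_mono mult_mono angular_kernel_bound') (auto simp: of_bool_def)
      finally have S: "\<bar>log_weight_deriv \<beta> \<epsilon> n i z\<bar>
          \<le> (\<Sum>k<n. \<Sum>j<k. \<beta> * 1 * (1 / \<epsilon>))" .
      show "norm (?f z) \<le> B * (?W * (\<Sum>k<n. \<Sum>j<k. \<beta> * 1 * (1 / \<epsilon>))) + B * ?W"
        using W S bound[OF i z] B
        by (intro order_trans[OF norm_triangle_ineq] add_mono)
           (unfold norm_mult norm_of_real abs_mult, auto intro!: mult_mono)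
    qed
    show "?f \<in> borel_measurable (torus n)"
      unfolding log_weight_deriv_def using meas[OF i]
      by (intro borel_measurable_add borel_measurable_times measurable_compose[OF _ borel_measurable_of_real] borel_measurable_cbe_weight_reg
          borel_measurable_sum borel_measurable_const borel_measurable_angular_kernel borel_measurable_torus_component) auto
  qed
qed

lemma loop_integrand_measurable: "loop_integrand \<beta> \<epsilon> n F F' \<in> borel_measurable (torus n)"
  unfolding loop_integrand_def
  by (intro borel_measurable_add borel_measurable_times measurable_compose[OF _ borel_measurable_of_real] borel_measurable_diff
      borel_measurable_sum borel_measurable_const borel_measurable_angular_kernel borel_measurable_torus_component meas) auto

lemma integral_loop_integrand_reg:
  assumes \<beta>: "\<beta> > 0" and \<epsilon>: "0 < \<epsilon>" "\<epsilon> \<le> 1"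
  shows "(\<integral>z. loop_integrand \<beta> \<epsilon> n F F' z * of_real (cbe_weight_reg \<beta> \<epsilon> n z) \<partial>torus n) = 0"
proof -
  let ?f = "\<lambda>i z. F i z * of_real (cbe_weight_reg \<beta> \<epsilon> n z * log_weight_deriv \<beta> \<epsilon> n i z)
      + F' i z * of_real (cbe_weight_reg \<beta> \<epsilon> n z)"
  have "(\<integral>z. (\<Sum>i<n. ?f i z) \<partial>torus n) = (\<Sum>i<n. \<integral>z. ?f i z \<partial>torus n)"
    by (intro Bochner_Integration.integral_sum integrable_deriv_weight_reg assms) auto
  also have "\<dots> = 0"
  proof (intro sum.neutral ballI)
    fix i assume "i \<in> {..<n}"
    then have i: "i < n" by simp
    show "(\<integral>z. ?f i z \<partial>torus n) = 0"
      by (rule integral_torus_angular_deriv[OF i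
            angular_deriv_mult[OF deriv[OF i] angular_deriv_weight_reg[OF \<epsilon>(1)]]
            integrable_deriv_weight_reg[OF i assms]])
  qed
  also have "(\<lambda>z. \<Sum>i<n. ?f i z) = (\<lambda>z. loop_integrand \<beta> \<epsilon> n F F' z * of_real (cbe_weight_reg \<beta> \<epsilon> n z))"
  proof
    fix z :: "nat \<Rightarrow> complex"
    have factor: "(\<Sum>i<n. a i * of_real (w * s i) + b i * of_real w) =
        (\<Sum>i<n. a i * of_real (s i)) * of_real w + (\<Sum>i<n. b i) * of_real w"
      for a b :: "nat \<Rightarrow> complex" and s :: "nat \<Rightarrow> real" and w
      by (simp add: sum.distrib sum_distrib_left mult_ac)
    have "(\<Sum>i<n. F i z * of_real (log_weight_deriv \<beta> \<epsilon> n i z))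
       = (\<Sum>i<n. \<Sum>k<n. \<Sum>j<k. \<beta> * of_real (angular_kernel \<epsilon> (z j) (z k)) * (F i z * (of_bool (i = j) - of_bool (i = k))))"
      by (simp add: log_weight_deriv_def sum_distrib_left mult_ac of_bool_def if_distrib[of of_real] cong: if_cong)
    also have "\<dots> = (\<Sum>k<n. \<Sum>j<k. \<Sum>i<n. \<beta> * of_real (angular_kernel \<epsilon> (z j) (z k)) * (F i z * (of_bool (i = j) - of_bool (i = k))))"
      by (subst sum.swap, rule sum.cong[OF refl], rule sum.swap)
    also have "\<dots> = (\<Sum>k<n. \<Sum>j<k. \<beta> * of_real (angular_kernel \<epsilon> (z j) (z k)) * (F j z - F k z))"
      unfolding sum_distrib_left[symmetric]
      by (intro sum.cong refl arg_cong2[where f="(*)"] sum_of_bool_diff) auto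
    also have "\<dots> = \<beta> * (\<Sum>k<n. \<Sum>j<k. (F j z - F k z) * of_real (angular_kernel \<epsilon> (z j) (z k)))"
      by (simp add: sum_distrib_left mult_ac)
    finally have *: "(\<Sum>i<n. F i z * of_real (log_weight_deriv \<beta> \<epsilon> n i z))
       = \<beta> * (\<Sum>k<n. \<Sum>j<k. (F j z - F k z) * of_real (angular_kernel \<epsilon> (z j) (z k)))" .
    have "(\<Sum>i<n. ?f i z) = (\<Sum>i<n. F i z * of_real (log_weight_deriv \<beta> \<epsilon> n i z)) * of_real (cbe_weight_reg \<beta> \<epsilon> n z)
      + (\<Sum>i<n. F' i z) * of_real (cbe_weight_reg \<beta> \<epsilon> n z)"
      by (rule factor)
    then show "(\<Sum>i<n. ?f i z) = loop_integrand \<beta> \<epsilon> n F F' z * of_real (cbe_weight_reg \<beta> \<epsilon> n z)"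
      unfolding * loop_integrand_def by (simp add: algebra_simps)
  qed
  finally show ?thesis .
qed

text \<open>Each pair contributes at most \<open>B\<close>, by \<open>lip\<close> against
  \<open>angular_kernel_bound\<close>. The bound does not depend on \<open>\<epsilon>\<close> and
  covers \<open>\<epsilon> = 0\<close>, so it dominates the removal of the regularization and also
  makes the limiting integrand integrable.\<close>

lemma norm_loop_integrand_le:
  assumes \<beta>: "\<beta> > 0" and \<epsilon>: "0 \<le> \<epsilon>" and z: "on_torus n z"
  shows "norm (loop_integrand \<beta> \<epsilon> n F F' z) \<le> real n * B + \<beta> * (\<Sum>k<n. \<Sum>j<k. B)"
proof -
  have "norm (\<Sum>i<n. F' i z) \<le> (\<Sum>i<n. B)"
    using bound[OF _ z] by (intro sum_norm_le) auto
  moreover have "norm (\<Sum>k<n. \<Sum>j<k. (F j z - F k z) * of_real (angular_kernel \<epsilon> (z j) (z k))) \<le> (\<Sum>k<n. \<Sum>j<k. B)"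
  proof (intro sum_norm_le)
    fix k j assume kj: "k \<in> {..<n}" "j \<in> {..<k}"
    have "norm ((F j z - F k z) * of_real (angular_kernel \<epsilon> (z j) (z k)))
        \<le> (B * cmod (z j - z k)) * \<bar>angular_kernel \<epsilon> (z j) (z k)\<bar>"
      unfolding norm_mult norm_of_real using kj by (intro mult_right_mono lip z) auto
    also have "\<dots> = B * (cmod (z j - z k) * \<bar>angular_kernel \<epsilon> (z j) (z k)\<bar>)" by simp
    also have "\<dots> \<le> B * 1"
      using kj z \<epsilon> B by (intro mult_left_mono angular_kernel_bound) auto
    finally show "norm ((F j z - F k z) * of_real (angular_kernel \<epsilon> (z j) (z k))) \<le> B" by simp
  qed
  ultimately show ?thesis
    unfolding loop_integrand_def using \<beta>
    by (intro order_trans[OF norm_triangle_ineq] add_mono) (auto simp: norm_mult)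
qed

lemma tendsto_loop_integrand:
  assumes e: "e \<longlonglongrightarrow> 0" and z: "on_torus n z"
  shows "(\<lambda>m. loop_integrand \<beta> (e m) n F F' z) \<longlonglongrightarrow> loop_integrand \<beta> 0 n F F' z"
proof -
  have "(\<lambda>m. (F j z - F k z) * of_real (angular_kernel (e m) (z j) (z k)))
      \<longlonglongrightarrow> (F j z - F k z) * of_real (angular_kernel 0 (z j) (z k))"
    if kj: "k \<in> {..<n}" "j \<in> {..<k}" for k j
  proof (cases "z j = z k")
    case True
    with lip[of j k z] kj z have "F j z - F k z = 0" by simp
    then show ?thesis by simp
  next
    case False
    then show ?thesis
      unfolding angular_kernel_def by (intro tendsto_intros e) auto
  qed
  then show ?thesis
    unfolding loop_integrand_def
    by (intro tendsto_add tendsto_const tendsto_mult[OF tendsto_const[of "of_real \<beta>"]] tendsto_sum) auto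
qed

text \<open>The weight has a singular derivative at coinciding points when \<open>\<beta> < 1\<close>, so the integration
  by parts is done for the regularized weight; by the Lipschitz condition the drift terms, paired
  up, stay bounded as the regularization is removed.\<close>

proposition loop_equation:
  assumes \<beta>: "\<beta> > 0"
  shows "(\<integral>z. loop_integrand \<beta> 0 n F F' z * of_real (cbe_weight \<beta> n z) \<partial>torus n) = 0"
proof -
  interpret finite_measure "torus n" by (rule finite_measure_torus)
  define e where "e m = inverse (real (Suc m))" for m
  have e: "e m > 0" "e m \<le> 1" for m by (auto simp: e_def inverse_le_1_iff)
  have lim: "e \<longlonglongrightarrow> 0"
    unfolding e_def by (rule LIMSEQ_inverse_real_of_nat)
  let ?W = "exp (\<Sum>k<n. \<Sum>j<k. \<beta> / 2 * ln 5)"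
  let ?C = "real n * B + \<beta> * (\<Sum>k<n. \<Sum>j<k. B)"
  have "(\<lambda>m. \<integral>z. loop_integrand \<beta> (e m) n F F' z * of_real (cbe_weight_reg \<beta> (e m) n z) \<partial>torus n)
      \<longlonglongrightarrow> (\<integral>z. loop_integrand \<beta> 0 n F F' z * of_real (cbe_weight \<beta> n z) \<partial>torus n)"
  proof (rule integral_dominated_convergence[where w="\<lambda>_. ?C * ?W"])
    show "AE z in torus n. (\<lambda>m. loop_integrand \<beta> (e m) n F F' z * of_real (cbe_weight_reg \<beta> (e m) n z))
        \<longlonglongrightarrow> loop_integrand \<beta> 0 n F F' z * of_real (cbe_weight \<beta> n z)"
      using AE_torus_norm
      by eventually_elim (intro tendsto_intros tendsto_loop_integrand tendsto_cbe_weight_reg lim e \<beta>)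
    show "AE z in torus n. norm (loop_integrand \<beta> (e m) n F F' z * of_real (cbe_weight_reg \<beta> (e m) n z)) \<le> ?C * ?W" for m
      using AE_torus_norm
    proof eventually_elim
      fix z :: "nat \<Rightarrow> complex" assume z: "on_torus n z"
      then show "norm (loop_integrand \<beta> (e m) n F F' z * of_real (cbe_weight_reg \<beta> (e m) n z)) \<le> ?C * ?W"
        unfolding norm_mult norm_of_real
        using cbe_weight_reg_pos[of \<beta> "e m" n z] cbe_weight_reg_le[OF \<beta> e z]
        by (intro mult_mono norm_loop_integrand_le \<beta> less_imp_le[OF e(1)]) (auto intro!: add_nonneg_nonneg mult_nonneg_nonneg sum_nonneg simp: B less_imp_le[OF \<beta>])
    qed
  qed (auto intro!: borel_measurable_times measurable_compose[OF _ borel_measurable_of_real] loop_integrand_measurable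
        borel_measurable_cbe_weight borel_measurable_cbe_weight_reg integrable_const)
  moreover have "(\<lambda>m. \<integral>z. loop_integrand \<beta> (e m) n F F' z * of_real (cbe_weight_reg \<beta> (e m) n z) \<partial>torus n) = (\<lambda>m. 0)"
    using integral_loop_integrand_reg[OF \<beta> e] by simp
  ultimately show ?thesis by (simp add: LIMSEQ_const_iff)
qed

end

subsection \<open>The ensemble as a probability space\<close>

lemma cbe_weight_nonneg: "cbe_weight \<beta> n z \<ge> 0"
  unfolding cbe_weight_def by (intro prod_nonneg) auto

lemma cbe_weight_le:
  assumes "\<beta> > 0" "on_torus n z"
  shows "cbe_weight \<beta> n z \<le> (\<Prod>k<n. \<Prod>j<k. 2 powr \<beta>)"
  unfolding cbe_weight_def
proof (intro prod_mono conjI prod_nonneg)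
  fix k j assume "k \<in> {..<n}" "j \<in> {..<k}"
  then have "cmod (z j) = 1" "cmod (z k) = 1" using assms by auto
  then show "cmod (z j - z k) powr \<beta> \<le> 2 powr \<beta>"
    using norm_triangle_ineq4[of "z j" "z k"] assms by (intro powr_mono2) auto
qed auto

lemma cbe_weight_eq_0:
  assumes "j < n" "k < n" "j \<noteq> k" "z j = z k"
  shows "cbe_weight \<beta> n z = 0"
proof -
  have "cbe_weight \<beta> n z = 0" if "j < k" "k < n" "z j = z k" for j k
    unfolding cbe_weight_def using that
    by (intro prod_zero finite_lessThan bexI[of _ k] bexI[of _ j]) auto
  from this[of j k] this[of k j] assms show ?thesis by (cases "j < k") auto
qed

lemma cmod_cis_diff_le: "cmod (cis a - cis b) \<le> \<bar>a - b\<bar>"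
proof -
  have "cis a - cis b = cis b * (cis (a - b) - 1)"
    by (simp add: right_diff_distrib cis_mult)
  then have "cis a - cis b = cis b * (exp (\<i> * of_real (a - b)) - 1)"
    by (simp only: cis_conv_exp)
  then have "cmod (cis a - cis b) = 2 * \<bar>sin ((a - b) / 2)\<bar>"
    by (simp only: norm_mult norm_cis dist_exp_i_1 mult_1)
  also have "\<dots> \<le> 2 * \<bar>(a - b) / 2\<bar>"
    by (intro mult_left_mono abs_sin_x_le_abs_x) auto
  finally show ?thesis by simp
qed

lemma emeasure_circle_measure_ball_pos:
  assumes "0 \<le> a" "a < 2 * pi" "\<rho> > 0"
  shows "emeasure circle_measure (ball (cis a) \<rho>) > 0"
proof -
  let ?S = "{t \<in> {0..<2 * pi}. cis t \<in> ball (cis a) \<rho>}"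
  \<comment> \<open>Only the part to the right of \<open>a\<close> is used: cut at
    \<open>2 * pi\<close> it stays in \<open>{0..<2 * pi}\<close>, and it has positive length even
    for \<open>a = 0\<close>.\<close>
  let ?b = "min (a + \<rho>) (2 * pi)"
  have sub: "{a..<?b} \<subseteq> ?S"
  proof
    fix t assume t: "t \<in> {a..<?b}"
    have "cmod (cis a - cis t) \<le> \<bar>a - t\<bar>" by (rule cmod_cis_diff_le)
    also have "\<dots> < \<rho>" using t by auto
    finally show "t \<in> ?S" using t assms by (auto simp: dist_norm)
  qed
  have "?S \<in> sets borel" by (rule borel_cis_preimage) simp
  then have "emeasure lborel {a..<?b} \<le> emeasure lborel ?S"
    by (intro emeasure_mono sub) auto
  moreover have "emeasure lborel {a..<?b} > 0"
    using assms by (subst emeasure_lborel_Ico) auto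
  ultimately show ?thesis
    by (subst emeasure_circle_measure) auto
qed

lemma inj_on_cis_roots: "inj_on (\<lambda>j. cis (2 * pi * real j / real n)) {..<n}"
proof (rule inj_onI)
  fix j k assume jk: "j \<in> {..<n}" "k \<in> {..<n}"
    and eq: "cis (2 * pi * real j / real n) = cis (2 * pi * real k / real n)"
  have rng: "0 \<le> 2 * pi * real i / real n" "2 * pi * real i / real n < 2 * pi" if "i < n" for i
    using that by (auto simp: field_simps)
  have "2 * pi * real j / real n = 2 * pi * real k / real n"
    using eq rng[of j] rng[of k] jk Arg2pi_unique[of 1 "2 * pi * real j / real n" "cis (2 * pi * real j / real n)"]
      Arg2pi_unique[of 1 "2 * pi * real k / real n" "cis (2 * pi * real k / real n)"]
    by (simp add: cis_conv_exp)
  then show "j = k" using jk by (auto simp: field_simps)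
qed

lemma integrable_torus_bounded:
  fixes f :: "(nat \<Rightarrow> complex) \<Rightarrow> 'b::{banach, second_countable_topology}"
  assumes "f \<in> borel_measurable (torus n)" "\<And>z. on_torus n z \<Longrightarrow> norm (f z) \<le> B"
  shows "integrable (torus n) f"
proof -
  interpret finite_measure "torus n" by (rule finite_measure_torus)
  show ?thesis
    using AE_torus_norm[of n] assms by (intro integrable_const_bound[of _ B]) (auto elim: eventually_mono)
qed

lemma integrable_cbe_weight: "\<beta> > 0 \<Longrightarrow> integrable (torus n) (cbe_weight \<beta> n)"
  by (rule integrable_torus_bounded[where B="\<Prod>k<n. \<Prod>j<k. 2 powr \<beta>"])
     (auto simp: borel_measurable_cbe_weight cbe_weight_nonneg simp del: prod_constant intro!: cbe_weight_le)

text \<open>Disjoint balls around the n-th roots of unity: their product has positive measure, and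
  the weight is positive on it.\<close>

lemma cbe_weight_nn_integral_pos: "(\<integral>\<^sup>+z. ennreal (cbe_weight \<beta> n z) \<partial>torus n) > 0"
proof -
  define c where "c j = cis (2 * pi * real j / real n)" for j
  define D where "D = (\<lambda>(j, k). dist (c j) (c k)) ` {(j, k). j < n \<and> k < n \<and> j \<noteq> k}"
  have "finite {(j, k). j < n \<and> k < n \<and> j \<noteq> k}"
    by (rule finite_subset[of _ "{..<n} \<times> {..<n}"]) auto
  then have fin: "finite D" unfolding D_def by (rule finite_imageI)
  \<comment> \<open>\<open>insert 1\<close> keeps the minimum meaningful when there is no pair of
    distinct indices.\<close>
  define \<rho> where "\<rho> = Min (insert 1 D) / 2"
  have "x > 0" if "x \<in> D" for x
    using that inj_on_cis_roots[of n] by (auto simp: D_def c_def inj_on_def)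
  then have \<rho>: "\<rho> > 0" using fin by (auto simp: \<rho>_def)
  have sep: "2 * \<rho> \<le> dist (c j) (c k)" if "j < n" "k < n" "j \<noteq> k" for j k
    using that fin unfolding \<rho>_def D_def by (auto intro!: Min_le)
  define A where "A = PiE {..<n} (\<lambda>j. ball (c j) \<rho>)"
  have A: "A \<in> sets (torus n)"
    unfolding A_def by (intro sets_PiM_I_finite) auto
  have pos: "cbe_weight \<beta> n z > 0" if z: "z \<in> A" for z
    unfolding cbe_weight_def
  proof (intro prod_pos ballI)
    fix k j assume kj: "k \<in> {..<n}" "j \<in> {..<k}"
    have "dist (c j) (z j) < \<rho>" "dist (c k) (z k) < \<rho>"
      using z kj by (auto simp: A_def PiE_iff)
    with sep[of j k] kj have "z j \<noteq> z k"
      using dist_triangle2[of "c j" "c k" "z j"] by auto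
    then show "cmod (z j - z k) powr \<beta> > 0" by simp
  qed
  have "emeasure (torus n) A = (\<Prod>j<n. emeasure circle_measure (ball (c j) \<rho>))"
    unfolding A_def by (subst torus.emeasure_PiM) auto
  also have "\<dots> \<noteq> 0"
    using \<rho> by (auto simp: c_def field_simps intro!: emeasure_circle_measure_ball_pos less_imp_neq[THEN not_sym])
  finally have "emeasure (torus n) A \<noteq> 0" .
  show ?thesis
  proof (rule ccontr)
    assume "\<not> ?thesis"
    then have "AE z in torus n. ennreal (cbe_weight \<beta> n z) = 0"
      by (subst (asm) not_gr_zero, subst (asm) nn_integral_0_iff_AE)
         (auto intro: measurable_compose[OF borel_measurable_cbe_weight])
    then have "AE z in torus n. z \<notin> A"
      by eventually_elim (use pos cbe_weight_nonneg[of \<beta> n] in \<open>force simp: ennreal_eq_0_iff\<close>)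
    moreover have "{z \<in> space (torus n). z \<in> A} = A"
      using sets.sets_into_space[OF A] by auto
    ultimately have "emeasure (torus n) A = 0"
      using A by (subst (asm) AE_iff_null) (auto simp: null_sets_def)
    with \<open>emeasure (torus n) A \<noteq> 0\<close> show False by simp
  qed
qed

definition cbe_partition :: "real \<Rightarrow> nat \<Rightarrow> real" where
  "cbe_partition \<beta> n = (\<integral>z. cbe_weight \<beta> n z \<partial>torus n)"

lemma cbe_partition:
  assumes "\<beta> > 0"
  shows "(\<integral>\<^sup>+z. ennreal (cbe_weight \<beta> n z) \<partial>torus n) = ennreal (cbe_partition \<beta> n)"
    and "cbe_partition \<beta> n > 0"
proof -
  show *: "(\<integral>\<^sup>+z. ennreal (cbe_weight \<beta> n z) \<partial>torus n) = ennreal (cbe_partition \<beta> n)"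
    unfolding cbe_partition_def
    by (intro nn_integral_eq_integral integrable_cbe_weight assms AE_I2 cbe_weight_nonneg)
  show "cbe_partition \<beta> n > 0"
    using cbe_weight_nn_integral_pos[of n \<beta>] unfolding * by (simp add: ennreal_less_zero_iff)
qed

lemma cbe_eq_density:
  assumes "\<beta> > 0"
  shows "cbe \<beta> n = density (torus n) (\<lambda>z. ennreal (cbe_weight \<beta> n z / cbe_partition \<beta> n))"
  unfolding cbe_def Let_def cbe_partition(1)[OF assms]
  by (simp add: divide_ennreal[symmetric] cbe_partition[OF assms] cbe_weight_nonneg)

lemma sets_cbe [measurable_cong]: "sets (cbe \<beta> n) = sets (torus n)"
  by (simp add: cbe_def Let_def)

lemma borel_measurable_cbe_iff: "f \<in> borel_measurable (cbe \<beta> n) \<longleftrightarrow> f \<in> borel_measurable (torus n)"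
  by (simp cong: measurable_cong_sets add: measurable_cong_sets[OF sets_cbe refl])

lemma borel_measurable_cbe_component [measurable]:
  "j < n \<Longrightarrow> (\<lambda>z. z j) \<in> borel_measurable (cbe \<beta> n)"
  by (simp add: borel_measurable_cbe_iff borel_measurable_torus_component)

lemma AE_cbe_norm:
  assumes "\<beta> > 0"
  shows "AE z in cbe \<beta> n. on_torus n z"
  unfolding cbe_eq_density[OF assms]
  using AE_torus_norm[of n] borel_measurable_cbe_weight[of \<beta> n] by (subst AE_density) auto

text \<open>The density itself vanishes wherever two points coincide, so no separate argument about
  the measure of the diagonals is involved.\<close>

lemma AE_cbe_inj:
  assumes "\<beta> > 0"
  shows "AE z in cbe \<beta> n. inj_on z {..<n}"
  unfolding cbe_eq_density[OF assms]
proof (subst AE_density)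
  show "AE z in torus n. 0 < ennreal (cbe_weight \<beta> n z / cbe_partition \<beta> n) \<longrightarrow> inj_on z {..<n}"
    by (intro AE_I2) (auto simp: inj_on_def dest: cbe_weight_eq_0[of _ n _ _ \<beta>])
qed (use borel_measurable_cbe_weight[of \<beta> n] in auto)

lemma integral_cbe:
  fixes f :: "(nat \<Rightarrow> complex) \<Rightarrow> complex"
  assumes "\<beta> > 0" "f \<in> borel_measurable (torus n)"
  shows "(\<integral>z. f z \<partial>cbe \<beta> n) = (\<integral>z. f z * of_real (cbe_weight \<beta> n z) \<partial>torus n) / cbe_partition \<beta> n"
proof -
  have "(\<integral>z. f z \<partial>cbe \<beta> n) = (\<integral>z. (cbe_weight \<beta> n z / cbe_partition \<beta> n) *\<^sub>R f z \<partial>torus n)"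
    unfolding cbe_eq_density[OF assms(1)]
    using cbe_partition(2)[OF assms(1), of n] assms borel_measurable_cbe_weight[of \<beta> n]
    by (subst integral_density) (auto simp: cbe_weight_nonneg)
  also have "\<dots> = (\<integral>z. (f z * of_real (cbe_weight \<beta> n z)) / of_real (cbe_partition \<beta> n) \<partial>torus n)"
    by (simp add: scaleR_conv_of_real mult_ac)
  finally show ?thesis by simp
qed

lemma prob_space_cbe:
  assumes "\<beta> > 0"
  shows "prob_space (cbe \<beta> n)"
proof
  have "emeasure (cbe \<beta> n) (space (cbe \<beta> n)) =
      (\<integral>\<^sup>+z. ennreal (cbe_weight \<beta> n z) / ennreal (cbe_partition \<beta> n) \<partial>torus n)"
    unfolding cbe_def Let_def cbe_partition(1)[OF assms]
    using borel_measurable_cbe_weight[of \<beta> n]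
    by (subst emeasure_density) (auto intro!: nn_integral_cong)
  also have "\<dots> = ennreal (cbe_partition \<beta> n) / ennreal (cbe_partition \<beta> n)"
    using borel_measurable_cbe_weight[of \<beta> n]
    by (subst nn_integral_divide) (auto simp: cbe_partition[OF assms])
  also have "\<dots> = 1"
    using cbe_partition(2)[OF assms, of n] by (simp add: divide_ennreal)
  finally show "emeasure (cbe \<beta> n) (space (cbe \<beta> n)) = 1" .
qed

lemma integrable_cbe_bounded:
  fixes f :: "(nat \<Rightarrow> complex) \<Rightarrow> 'b::{banach, second_countable_topology}"
  assumes "\<beta> > 0" "f \<in> borel_measurable (cbe \<beta> n)" "\<And>z. on_torus n z \<Longrightarrow> norm (f z) \<le> B"
  shows "integrable (cbe \<beta> n) f"
proof -
  interpret prob_space "cbe \<beta> n" using assms(1) by (rule prob_space_cbe)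
  show ?thesis
    using AE_cbe_norm[OF assms(1), of n] assms by (intro integrable_const_bound[of _ B]) (auto elim: eventually_mono)
qed

lemma (in torus_field) cbe_loop_equation:
  assumes "\<beta> > 0"
  shows "(\<integral>z. loop_integrand \<beta> 0 n F F' z \<partial>cbe \<beta> n) = 0"
  using loop_equation[OF assms] by (simp add: integral_cbe[OF assms loop_integrand_measurable])

lemma (in torus_field) integrable_loop_integrand:
  assumes "\<beta> > 0"
  shows "integrable (cbe \<beta> n) (loop_integrand \<beta> 0 n F F')"
  using assms loop_integrand_measurable[of \<beta> 0]
  by (intro integrable_cbe_bounded[OF _ _ norm_loop_integrand_le]) (auto simp: borel_measurable_cbe_iff)

subsection \<open>Power sums and the resolvent\<close>

definition power_sum :: "nat \<Rightarrow> nat \<Rightarrow> (nat \<Rightarrow> complex) \<Rightarrow> complex" where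
  "power_sum n k z = (\<Sum>j<n. z j ^ k)"

lemma borel_measurable_power_sum [measurable]: "power_sum n k \<in> borel_measurable (cbe \<beta> n)"
  unfolding power_sum_def by measurable

lemma norm_power_sum_le: "on_torus n z \<Longrightarrow> norm (power_sum n k z) \<le> real n"
  unfolding power_sum_def by (rule order_trans[OF sum_norm_le[where g="\<lambda>_. 1"]]) (auto simp: norm_power)

lemma angular_deriv_power_sum:
  assumes "i < n"
  shows "angular_deriv i (power_sum n k) (\<lambda>z. \<i> * of_nat k * z i ^ k)"
proof -
  have *: "angular_deriv i (\<lambda>z. \<Sum>j<n. z j ^ k) (\<lambda>z. \<Sum>j<n. if i = j then \<i> * z j * (of_nat k * z j ^ (k - 1)) else 0)"
    by (intro angular_deriv_sum angular_deriv_component) (auto intro!: derivative_eq_intros)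
  have "y * (of_nat k * y ^ (k - 1)) = of_nat k * y ^ k" for y :: complex
    by (cases k) auto
  then show ?thesis
    unfolding power_sum_def using assms
    by (intro angular_deriv_eq_rhs[OF *]) (simp add: mult.assoc)
qed

text \<open>Orthogonality expresses invariance under rotation: the field that moves all points
  with the same speed.\<close>

lemma torus_field_rotation:
  "torus_field n (\<lambda>_ z. power_sum n k z * cnj (power_sum n l z))
     (\<lambda>i z. power_sum n k z * cnj (\<i> * of_nat l * z i ^ l) + \<i> * of_nat k * z i ^ k * cnj (power_sum n l z))
     (real n * real n + (real n * real l + real k * real n))" (is "torus_field n ?F ?F' ?B")
proof
  fix i assume i: "i < n"
  show "angular_deriv i (?F i) (?F' i)"
    by (intro angular_deriv_mult angular_deriv_cnj angular_deriv_power_sum i)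
  have m: "power_sum n m \<in> borel_measurable (torus n)" for m
    using borel_measurable_power_sum[of n m 1] by (simp add: borel_measurable_cbe_iff)
  show "?F i \<in> borel_measurable (torus n)" "?F' i \<in> borel_measurable (torus n)"
    by (intro borel_measurable_times borel_measurable_add borel_measurable_power m borel_measurable_cnj borel_measurable_const
        borel_measurable_torus_component i)+
  fix z :: "nat \<Rightarrow> complex" assume z: "on_torus n z"
  have "norm (?F i z) \<le> real n * real n"
    unfolding norm_mult complex_mod_cnj by (intro mult_mono norm_power_sum_le z) auto
  then show "norm (?F i z) \<le> ?B" by (rule order_trans) auto
  have "norm (?F' i z) \<le> real n * real l + real k * real n"
    using z i by (intro order_trans[OF norm_triangle_ineq] add_mono)
      (auto simp: norm_mult norm_power intro!: mult_mono norm_power_sum_le)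
  then show "norm (?F' i z) \<le> ?B" by (rule order_trans) auto
qed auto

text \<open>All components of the rotation field agree, so the interaction drops out and the
  divergence is \<open>\<i> * (of_nat k - of_nat l)\<close> times the integrand: rotating all points
  multiplies the product by a nontrivial phase.\<close>

lemma power_sum_orthogonal:
  assumes \<beta>: "\<beta> > 0" and kl: "k \<noteq> l"
  shows "(\<integral>z. power_sum n k z * cnj (power_sum n l z) \<partial>cbe \<beta> n) = 0"
proof -
  interpret torus_field n "\<lambda>_ z. power_sum n k z * cnj (power_sum n l z)"
     "\<lambda>i z. power_sum n k z * cnj (\<i> * of_nat l * z i ^ l) + \<i> * of_nat k * z i ^ k * cnj (power_sum n l z)"
     "real n * real n + (real n * real l + real k * real n)"
    by (rule torus_field_rotation)
  have "loop_integrand \<beta> 0 n (\<lambda>_ z. power_sum n k z * cnj (power_sum n l z))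
     (\<lambda>i z. power_sum n k z * cnj (\<i> * of_nat l * z i ^ l) + \<i> * of_nat k * z i ^ k * cnj (power_sum n l z)) z
     = \<i> * (of_nat k - of_nat l) * (power_sum n k z * cnj (power_sum n l z))" for z
  proof -
    have "(\<Sum>i<n. power_sum n k z * cnj (\<i> * of_nat l * z i ^ l) + \<i> * of_nat k * z i ^ k * cnj (power_sum n l z))
      = power_sum n k z * (- \<i> * of_nat l * cnj (power_sum n l z)) + \<i> * of_nat k * power_sum n k z * cnj (power_sum n l z)"
      unfolding power_sum_def[of n l] power_sum_def[of n k]
      by (simp add: sum.distrib sum_distrib_left sum_distrib_right mult_ac sum_negf sum_subtractf)
    then show ?thesis
      unfolding loop_integrand_def by (simp add: algebra_simps)
  qed
  with cbe_loop_equation[OF \<beta>] kl show ?thesis by simp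
qed

definition power_sum_moment :: "real \<Rightarrow> nat \<Rightarrow> nat \<Rightarrow> real" where
  "power_sum_moment \<beta> n k = (\<integral>z. (cmod (power_sum n k z))\<^sup>2 \<partial>cbe \<beta> n)"

lemma power_sum_moment_nonneg: "power_sum_moment \<beta> n k \<ge> 0"
  by (simp add: power_sum_moment_def)

lemma integral_square_sum_power_sum:
  assumes \<beta>: "\<beta> > 0"
  shows "(\<integral>z. (cmod (\<Sum>k=1..K. d k * power_sum n k z))\<^sup>2 \<partial>cbe \<beta> n)
      = (\<Sum>k=1..K. (cmod (d k))\<^sup>2 * power_sum_moment \<beta> n k)"
proof -
  let ?p = "\<lambda>k l z. power_sum n k z * cnj (power_sum n l z)"
  have int: "integrable (cbe \<beta> n) (?p k l)" for k l
    by (rule integrable_cbe_bounded[OF \<beta>, where B="real n * real n"])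
       (auto simp: norm_mult intro!: mult_mono norm_power_sum_le)
  have diag: "(\<integral>z. ?p k k z \<partial>cbe \<beta> n) = of_real (power_sum_moment \<beta> n k)" for k
    unfolding power_sum_moment_def
    by (subst integral_complex_of_real[symmetric]) (simp only: complex_norm_square)
  have "complex_of_real (\<integral>z. (cmod (\<Sum>k=1..K. d k * power_sum n k z))\<^sup>2 \<partial>cbe \<beta> n)
     = (\<integral>z. (\<Sum>k=1..K. \<Sum>l=1..K. d k * cnj (d l) * ?p k l z) \<partial>cbe \<beta> n)"
    by (subst integral_complex_of_real[symmetric])
       (simp only: complex_norm_square cnj_sum complex_cnj_mult sum_product mult_ac)
  also have "\<dots> = (\<Sum>k=1..K. \<Sum>l=1..K. d k * cnj (d l) * (\<integral>z. ?p k l z \<partial>cbe \<beta> n))"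
    using int by (simp add: Bochner_Integration.integral_sum)
  also have "\<dots> = (\<Sum>k=1..K. \<Sum>l=1..K. if l = k then d k * cnj (d k) * of_real (power_sum_moment \<beta> n k) else 0)"
    using power_sum_orthogonal[OF \<beta>, of _ _ n] diag by (intro sum.cong refl) auto
  also have "\<dots> = (\<Sum>k=1..K. d k * cnj (d k) * of_real (power_sum_moment \<beta> n k))"
    by (intro sum.cong refl) (subst sum.delta, auto)
  also have "\<dots> = of_real (\<Sum>k=1..K. (cmod (d k))\<^sup>2 * power_sum_moment \<beta> n k)"
    by (simp add: complex_norm_square del: of_real_power)
  finally show ?thesis by (simp only: of_real_eq_iff)
qed

section \<open>Algebra of the resolvent and of its pair interaction\<close>

lemma sum_pairs_symmetric:
  fixes s :: "nat \<Rightarrow> nat \<Rightarrow> 'a::comm_ring_1"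
  assumes "\<And>j k. s j k = s k j"
  shows "(\<Sum>j<n. \<Sum>k<n. s j k) = 2 * (\<Sum>k<n. \<Sum>j<k. s j k) + (\<Sum>k<n. s k k)"
proof (induction n)
  case (Suc n)
  have "(\<Sum>k<n. s n k) = (\<Sum>j<n. s j n)" by (intro sum.cong refl assms)
  then show ?case by (simp add: Suc sum.distrib algebra_simps)
qed simp

text \<open>Conjugation is inversion on the circle, which turns the half-angle cotangent into a
  rational function of the points.\<close>

lemma angular_kernel_0:
  assumes "u \<noteq> v" "cmod u = 1" "cmod v = 1"
  shows "of_real (angular_kernel 0 u v) = \<i> / 2 * (u + v) / (u - v)"
proof -
  have u: "u * cnj u = 1" and v: "v * cnj v = 1"
    using assms by (simp_all add: complex_norm_square[symmetric])
  have nz: "u \<noteq> 0" "v \<noteq> 0" "u - v \<noteq> 0" using assms by auto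
  have cu: "cnj u = 1 / u" "cnj v = 1 / v" using u v nz by (simp_all add: field_simps)
  have "complex_of_real (Im w) = (w - cnj w) / (2 * \<i>)" for w
    by (simp add: complex_eq_iff Re_divide Im_divide)
  then have num: "complex_of_real (Im (u * cnj v)) = (u / v - v / u) / (2 * \<i>)"
    by (simp add: cu)
  have "complex_of_real ((cmod (u - v))\<^sup>2) = (u - v) * (1 / u - 1 / v)"
    by (subst complex_norm_square) (simp add: cu)
  also have "\<dots> = - ((u - v)\<^sup>2 / (u * v))"
    using nz by (simp add: field_simps power2_eq_square)
  finally have den: "complex_of_real ((cmod (u - v))\<^sup>2) = - ((u - v)\<^sup>2 / (u * v))" .
  have "complex_of_real (angular_kernel 0 u v) = (u / v - v / u) / (2 * \<i>) / (- ((u - v)\<^sup>2 / (u * v)))"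
    unfolding angular_kernel_def of_real_divide add_0_right num den ..
  also have "\<dots> = \<i> / 2 * ((u + v) * (u - v) / (u - v)\<^sup>2)"
    using nz by (simp add: field_simps)
  also have "\<dots> = \<i> / 2 * (u + v) / (u - v)"
    using nz by (simp add: power2_eq_square)
  finally show ?thesis .
qed

definition resolvent :: "real \<Rightarrow> complex \<Rightarrow> complex" where
  "resolvent r y = of_real r * y / (1 - of_real r * y)"

text \<open>This is \<open>y\<close> times the derivative of \<open>resolvent r\<close>, that is,
  its angular derivative up to the factor \<open>\<i>\<close>.\<close>

definition resolvent_deriv :: "real \<Rightarrow> complex \<Rightarrow> complex" where
  "resolvent_deriv r y = of_real r * y / (1 - of_real r * y)\<^sup>2"

context
  fixes r :: real assumes r: "0 < r" "r < 1"
begin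

lemma resolvent_denom:
  assumes "cmod y = 1"
  shows "1 - r \<le> cmod (1 - of_real r * y)" "1 - of_real r * y \<noteq> 0"
proof -
  have "cmod 1 - cmod (of_real r * y) \<le> cmod (1 - of_real r * y)" by (rule norm_triangle_ineq2)
  then show *: "1 - r \<le> cmod (1 - of_real r * y)" using assms r by (simp add: norm_mult)
  then show "1 - of_real r * y \<noteq> 0" using r by auto
qed

lemma norm_resolvent_le: "cmod y = 1 \<Longrightarrow> cmod (resolvent r y) \<le> r / (1 - r)"
  unfolding resolvent_def norm_divide using resolvent_denom[of y] r
  by (auto simp: norm_mult intro!: frac_le)

text \<open>The bracket is the Poisson kernel
  \<open>(1 - r\<^sup>2) / (cmod (1 - of_real r * y))\<^sup>2\<close>. Having an equality lets the
  norms be summed over the points into a multiple of the Poisson sum, whose mean is known, instead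
  of being bounded one by one.\<close>

lemma norm_resolvent_deriv:
  assumes "cmod y = 1"
  shows "cmod (resolvent_deriv r y) = r / (1 - r\<^sup>2) * (1 + 2 * Re (resolvent r y))"
proof -
  let ?w = "of_real r * y"
  have n: "(cmod (1 - ?w))\<^sup>2 \<noteq> 0" using resolvent_denom[OF assms] by simp
  have nw: "(cmod ?w)\<^sup>2 = r\<^sup>2" using assms by (simp add: norm_mult power_mult_distrib)
  have "Re (resolvent r y) = Re (?w * cnj (1 - ?w)) / (cmod (1 - ?w))\<^sup>2"
    unfolding resolvent_def complex_div_cnj[of ?w] by simp
  also have "Re (w * cnj (1 - w)) = Re w - (cmod w)\<^sup>2" for w
    unfolding cmod_power2 by (simp add: power2_eq_square algebra_simps)
  finally have "1 + 2 * Re (resolvent r y) = ((cmod (1 - ?w))\<^sup>2 + 2 * Re ?w - 2 * (cmod ?w)\<^sup>2) / (cmod (1 - ?w))\<^sup>2"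
    using n by (simp add: field_simps)
  also have "(cmod (1 - w))\<^sup>2 + 2 * Re w - 2 * (cmod w)\<^sup>2 = 1 - (cmod w)\<^sup>2" for w
    unfolding cmod_power2 by (simp add: power2_eq_square algebra_simps)
  finally have *: "1 + 2 * Re (resolvent r y) = (1 - r\<^sup>2) / (cmod (1 - ?w))\<^sup>2" by (simp only: nw)
  have "1 - r\<^sup>2 > 0" using r by (simp add: power_less_one_iff abs_square_less_1)
  then show ?thesis
    unfolding * resolvent_deriv_def norm_divide norm_power using assms r by (simp add: norm_mult)
qed

lemma norm_resolvent_deriv_le: "cmod y = 1 \<Longrightarrow> cmod (resolvent_deriv r y) \<le> r / (1 - r)\<^sup>2"
  unfolding resolvent_deriv_def norm_divide norm_power using resolvent_denom[of y] r
  by (auto simp: norm_mult intro!: frac_le power_mono)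

lemma resolvent_diff:
  assumes "cmod u = 1" "cmod v = 1"
  shows "resolvent r u - resolvent r v =
    of_real r * (u - v) / ((1 - of_real r * u) * (1 - of_real r * v))"
  using resolvent_denom(2)[OF assms(1)] resolvent_denom(2)[OF assms(2)]
  unfolding resolvent_def by (simp add: field_simps)

lemma resolvent_lipschitz:
  assumes "cmod u = 1" "cmod v = 1"
  shows "cmod (resolvent r u - resolvent r v) \<le> r / (1 - r)\<^sup>2 * cmod (u - v)"
proof -
  have "cmod (resolvent r u - resolvent r v) =
      r * cmod (u - v) / (cmod (1 - of_real r * u) * cmod (1 - of_real r * v))"
    unfolding resolvent_diff[OF assms] using r by (simp add: norm_divide norm_mult)
  also have "\<dots> \<le> r * cmod (u - v) / ((1 - r) * (1 - r))"
    using r resolvent_denom(1)[OF assms(1)] resolvent_denom(1)[OF assms(2)]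
    by (intro divide_left_mono mult_mono mult_pos_pos) (auto intro: less_le_trans)
  finally show ?thesis by (simp add: power2_eq_square)
qed

text \<open>The pole of the kernel cancels against the difference, and what is left is a polynomial
  in the two values of the resolvent. Summed over pairs it becomes, up to diagonal terms, a
  polynomial in the resolvent sum; this is what makes the loop equation for this field
  tractable.\<close>

lemma resolvent_kernel:
  assumes "u \<noteq> v" "cmod u = 1" "cmod v = 1"
  shows "(resolvent r u - resolvent r v) * of_real (angular_kernel 0 u v) =
    \<i> / 2 * (2 * resolvent r u * resolvent r v + resolvent r u + resolvent r v)"
proof -
  have "(resolvent r u - resolvent r v) * of_real (angular_kernel 0 u v) =
     \<i> / 2 * (of_real r * (u + v) / ((1 - of_real r * u) * (1 - of_real r * v)))"
  proof -
    have "a * d / x * (\<i> / 2 * b / d) = \<i> / 2 * (a * b / x)" if "d \<noteq> 0" for a b d x :: complex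
      using that by (simp add: mult_ac)
    then show ?thesis
      unfolding resolvent_diff[OF assms(2,3)] angular_kernel_0[OF assms] using assms(1) by (metis right_minus_eq)
  qed
  also have "of_real r * (u + v) / ((1 - of_real r * u) * (1 - of_real r * v)) =
      2 * resolvent r u * resolvent r v + resolvent r u + resolvent r v"
  proof -
    have "(w1 + w2) / ((1 - w1) * (1 - w2)) = 2 * (w1 / (1 - w1)) * (w2 / (1 - w2)) + w1 / (1 - w1) + w2 / (1 - w2)"
      if "1 - w1 \<noteq> 0" "1 - w2 \<noteq> 0" for w1 w2 :: complex
      using that by (simp add: divide_simps) (simp add: algebra_simps)
    from this[OF resolvent_denom(2)[OF assms(2)] resolvent_denom(2)[OF assms(3)]]
    show ?thesis unfolding resolvent_def by (simp add: distrib_left)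
  qed
  finally show ?thesis .
qed

text \<open>The value on the diagonal of the polynomial in \<open>resolvent_kernel\<close>: the
  correction that appears when the sum over pairs is completed to a double sum.\<close>

lemma resolvent_square:
  assumes "cmod y = 1"
  shows "2 * resolvent r y * resolvent r y + resolvent r y + resolvent r y = 2 * resolvent_deriv r y"
  using resolvent_denom(2)[OF assms]
  unfolding resolvent_def resolvent_deriv_def by (simp add: divide_simps) (simp add: algebra_simps power2_eq_square)

lemma resolvent_expansion:
  assumes "cmod y = 1"
  shows "cmod (resolvent r y - (\<Sum>k=1..K. of_real (r ^ k) * y ^ k)) \<le> r ^ Suc K / (1 - r)"
proof -
  let ?w = "of_real r * y"
  have "(1 - w) * (\<Sum>k=1..K. w ^ k) = w - w ^ Suc K" for w :: complex
  proof (induction K)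
    case (Suc K)
    have "(1 - w) * (\<Sum>k=1..Suc K. w ^ k) = (1 - w) * (\<Sum>k=1..K. w ^ k) + (1 - w) * w ^ Suc K"
      by (simp add: distrib_left)
    then show ?case by (simp only: Suc) (simp add: algebra_simps)
  qed simp
  moreover have "resolvent r y - S = (?w - (1 - ?w) * S) / (1 - ?w)" for S
    using resolvent_denom(2)[OF assms] unfolding resolvent_def by (simp add: diff_divide_distrib)
  ultimately have "resolvent r y - (\<Sum>k=1..K. ?w ^ k) = ?w ^ Suc K / (1 - ?w)"
    by simp
  then have "cmod (resolvent r y - (\<Sum>k=1..K. ?w ^ k)) = r ^ Suc K / cmod (1 - ?w)"
    using assms r by (simp add: norm_divide norm_mult norm_power)
  also have "\<dots> \<le> r ^ Suc K / (1 - r)"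
    using resolvent_denom(1)[OF assms] r by (intro frac_le) auto
  finally show ?thesis by (simp add: power_mult_distrib)
qed

definition resolvent_sum :: "nat \<Rightarrow> (nat \<Rightarrow> complex) \<Rightarrow> complex" where
  "resolvent_sum n z = (\<Sum>j<n. resolvent r (z j))"

lemma borel_measurable_resolvent [measurable]:
  "resolvent r \<in> borel_measurable borel" "resolvent_deriv r \<in> borel_measurable borel"
  unfolding resolvent_def[abs_def] resolvent_deriv_def[abs_def] by measurable

lemma borel_measurable_resolvent_sum [measurable]: "resolvent_sum n \<in> borel_measurable (cbe \<beta> n)"
  unfolding resolvent_sum_def by measurable

lemma norm_resolvent_sum_le:
  "on_torus n z \<Longrightarrow> norm (resolvent_sum n z) \<le> real n * (r / (1 - r))"
  unfolding resolvent_sum_def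
  by (rule order_trans[OF sum_norm_le[where g="\<lambda>_. r / (1 - r)"]]) (auto intro!: norm_resolvent_le)

lemma angular_deriv_resolvent:
  "angular_deriv i (\<lambda>z. resolvent r (z j)) (\<lambda>z. if i = j then \<i> * resolvent_deriv r (z j) else 0)"
proof (rule angular_deriv_eq_rhs[OF angular_deriv_component[where h'="\<lambda>y. of_real r / (1 - of_real r * y)\<^sup>2"]])
  fix y :: complex assume y: "cmod y = 1"
  have "((\<lambda>y. of_real r * y / (1 - of_real r * y)) has_field_derivative
     (of_real r * (1 - of_real r * y) - of_real r * y * (- of_real r)) / ((1 - of_real r * y) * (1 - of_real r * y))) (at y)"
    using resolvent_denom(2)[OF y] by (auto intro!: derivative_eq_intros)
  then show "(resolvent r has_field_derivative of_real r / (1 - of_real r * y)\<^sup>2) (at y)"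
    unfolding resolvent_def[abs_def] by (simp add: algebra_simps power2_eq_square)
qed (simp add: resolvent_deriv_def)

lemma angular_deriv_resolvent_sum:
  assumes "i < n"
  shows "angular_deriv i (resolvent_sum n) (\<lambda>z. \<i> * resolvent_deriv r (z i))"
  unfolding resolvent_sum_def[abs_def]
  by (rule angular_deriv_eq_rhs[OF angular_deriv_sum[OF angular_deriv_resolvent]]) (use assms in simp)

definition resolvent_field :: "nat \<Rightarrow> nat \<Rightarrow> (nat \<Rightarrow> complex) \<Rightarrow> complex" where
  "resolvent_field n i z = resolvent r (z i) * cnj (resolvent_sum n z)"

definition resolvent_field_deriv :: "nat \<Rightarrow> nat \<Rightarrow> (nat \<Rightarrow> complex) \<Rightarrow> complex" where
  "resolvent_field_deriv n i z =
     resolvent r (z i) * cnj (\<i> * resolvent_deriv r (z i)) + \<i> * resolvent_deriv r (z i) * cnj (resolvent_sum n z)"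

lemma torus_field_resolvent:
  assumes b: "b = r / (1 - r)" and c: "c = r / (1 - r)\<^sup>2"
  shows "torus_field n (resolvent_field n)
     (resolvent_field_deriv n)
     (b * (real n * b) + (b * c + c * (real n * b)))"
  unfolding resolvent_field_def[abs_def] resolvent_field_deriv_def[abs_def]
proof
  let ?F = "\<lambda>i z. resolvent r (z i) * cnj (resolvent_sum n z)"
  let ?F' = "\<lambda>i z. resolvent r (z i) * cnj (\<i> * resolvent_deriv r (z i)) + \<i> * resolvent_deriv r (z i) * cnj (resolvent_sum n z)"
  have nn: "b \<ge> 0" "c \<ge> 0" using r by (auto simp: b c)
  fix i assume i: "i < n"
  have d: "angular_deriv i (\<lambda>z. resolvent r (z i)) (\<lambda>z. \<i> * resolvent_deriv r (z i))"
    by (rule angular_deriv_eq_rhs[OF angular_deriv_resolvent]) simp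
  show "angular_deriv i (?F i) (?F' i)"
    by (intro angular_deriv_mult angular_deriv_cnj angular_deriv_resolvent_sum d i)
  have "?F i \<in> borel_measurable (cbe 1 n)" "?F' i \<in> borel_measurable (cbe 1 n)"
    using i by measurable
  then show "?F i \<in> borel_measurable (torus n)" "?F' i \<in> borel_measurable (torus n)"
    by (simp_all only: borel_measurable_cbe_iff)
  fix z :: "nat \<Rightarrow> complex" assume z: "on_torus n z"
  have "norm (?F i z) \<le> b * (real n * b)"
    unfolding norm_mult complex_mod_cnj using z i nn
    by (intro mult_mono norm_resolvent_le[folded b] norm_resolvent_sum_le[folded b]) auto
  moreover have "norm (?F' i z) \<le> b * c + c * (real n * b)"
  proof (intro order_trans[OF norm_triangle_ineq] add_mono)
    show "norm (resolvent r (z i) * cnj (\<i> * resolvent_deriv r (z i))) \<le> b * c"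
      unfolding norm_mult complex_mod_cnj norm_ii mult_1 using z i nn
      by (intro mult_mono norm_resolvent_le[folded b] norm_resolvent_deriv_le[folded c]) auto
    show "norm (\<i> * resolvent_deriv r (z i) * cnj (resolvent_sum n z)) \<le> c * (real n * b)"
      unfolding norm_mult complex_mod_cnj using z i nn norm_resolvent_deriv_le[of "z i", folded c] norm_resolvent_sum_le[OF z, folded b]
      by (intro mult_mono) auto
  qed
  moreover have "0 \<le> b * (real n * b)" "0 \<le> b * c + c * (real n * b)"
    using nn by (auto intro!: add_nonneg_nonneg mult_nonneg_nonneg)
  ultimately show "norm (?F i z) \<le> b * (real n * b) + (b * c + c * (real n * b))"
    "norm (?F' i z) \<le> b * (real n * b) + (b * c + c * (real n * b))"
    by linarith+
next
  let ?F = "\<lambda>i z. resolvent r (z i) * cnj (resolvent_sum n z)"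
  have nn: "b \<ge> 0" "c \<ge> 0" using r by (auto simp: b c)
  fix j k and z :: "nat \<Rightarrow> complex"
  assume jk: "j < n" "k < n" and z: "on_torus n z"
  have "norm (?F j z - ?F k z) = cmod (resolvent r (z j) - resolvent r (z k)) * cmod (resolvent_sum n z)"
    by (simp add: norm_mult left_diff_distrib[symmetric])
  also have "\<dots> \<le> (c * cmod (z j - z k)) * (real n * b)"
    using z jk nn by (intro mult_mono resolvent_lipschitz[folded c] norm_resolvent_sum_le[folded b]) auto
  also have "\<dots> = (c * (real n * b)) * cmod (z j - z k)" by simp
  also have "\<dots> \<le> (b * (real n * b) + (b * c + c * (real n * b))) * cmod (z j - z k)"
    using nn by (intro mult_right_mono) (auto intro!: add_nonneg_nonneg mult_nonneg_nonneg)
  finally show "norm (?F j z - ?F k z) \<le> (b * (real n * b) + (b * c + c * (real n * b))) * cmod (z j - z k)" .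
next
  have nn: "b \<ge> 0" "c \<ge> 0" using r by (auto simp: b c)
  then show "0 \<le> b * (real n * b) + (b * c + c * (real n * b))"
    by (auto intro!: add_nonneg_nonneg mult_nonneg_nonneg)
qed

text \<open>Completing the sum over pairs to all indices and removing the diagonal gives
  \<open>G * G + n * G - D\<close>. At coinciding points the kernel is 0 by convention and
  \<open>resolvent_kernel\<close> does not apply, hence the distinctness of the points.\<close>

lemma resolvent_loop_integrand:
  assumes z: "on_torus n z" and inj: "inj_on z {..<n}"
  defines "G \<equiv> resolvent_sum n z" and "D \<equiv> (\<Sum>j<n. resolvent_deriv r (z j))"
  shows "loop_integrand \<beta> 0 n (resolvent_field n)
     (resolvent_field_deriv n) z
   = \<i> * (D * cnj G - (\<Sum>j<n. resolvent r (z j) * cnj (resolvent_deriv r (z j)))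
       + of_real \<beta> / 2 * (G * G + n * G - D) * cnj G)"
proof -
  let ?h = "\<lambda>j. resolvent r (z j)"
  let ?s = "\<lambda>j k. 2 * ?h j * ?h k + ?h j + ?h k"
  have 1: "(\<Sum>k<n. \<Sum>j<k. (?h j * cnj G - ?h k * cnj G) * of_real (angular_kernel 0 (z j) (z k)))
     = (\<Sum>k<n. \<Sum>j<k. cnj G * (\<i> / 2) * ?s j k)"
  proof (intro sum.cong refl)
    fix k j assume kj: "k \<in> {..<n}" "j \<in> {..<k}"
    then have "z j \<noteq> z k" using inj by (auto simp: inj_on_def)
    with resolvent_kernel[of "z j" "z k"] z kj
    have "(?h j - ?h k) * of_real (angular_kernel 0 (z j) (z k)) = \<i> / 2 * ?s j k" by simp
    moreover have "(?h j * cnj G - ?h k * cnj G) * x = cnj G * ((?h j - ?h k) * x)" for x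
      by (simp add: algebra_simps)
    ultimately show "(?h j * cnj G - ?h k * cnj G) * of_real (angular_kernel 0 (z j) (z k)) = cnj G * (\<i> / 2) * ?s j k"
      by (simp only: mult.assoc)
  qed
  have "(\<Sum>j<n. \<Sum>k<n. ?s j k) = 2 * G * G + 2 * (n * G)"
    by (simp add: sum.distrib sum_distrib_left[symmetric] sum_distrib_right[symmetric] G_def resolvent_sum_def mult_ac)
  moreover have "(\<Sum>k<n. ?s k k) = 2 * D"
    unfolding D_def sum_distrib_left using z by (intro sum.cong refl resolvent_square) auto
  moreover have "(\<Sum>j<n. \<Sum>k<n. ?s j k) = 2 * (\<Sum>k<n. \<Sum>j<k. ?s j k) + (\<Sum>k<n. ?s k k)"
    by (rule sum_pairs_symmetric) simp
  ultimately have "2 * (\<Sum>k<n. \<Sum>j<k. ?s j k) = 2 * (G * G + n * G - D)"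
    by (simp add: algebra_simps)
  then have 2: "(\<Sum>k<n. \<Sum>j<k. ?s j k) = G * G + n * G - D" by (simp only: mult_cancel_left) simp
  have 3: "(\<Sum>i<n. ?h i * cnj (\<i> * resolvent_deriv r (z i)) + \<i> * resolvent_deriv r (z i) * cnj G)
     = \<i> * (D * cnj G - (\<Sum>j<n. ?h j * cnj (resolvent_deriv r (z j))))"
    by (simp add: sum.distrib sum_subtractf sum_distrib_left sum_distrib_right sum_negf D_def algebra_simps)
  show ?thesis
    unfolding loop_integrand_def resolvent_field_def resolvent_field_deriv_def G_def[symmetric] 1 3 sum_distrib_left[symmetric] 2
    by (simp add: algebra_simps)
qed

text \<open>Besides \<open>(cmod G)\<^sup>2\<close>, the lower bound contains only a term linear in
  \<open>Re G\<close>, whose mean is zero; taking expectations therefore closes the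
  estimate.\<close>

lemma resolvent_pointwise_bound:
  assumes z: "on_torus n z" and \<beta>: "\<beta> > 0"
  defines "G \<equiv> resolvent_sum n z" and "D \<equiv> (\<Sum>j<n. resolvent_deriv r (z j))"
  shows "Re (D * cnj G - (\<Sum>j<n. resolvent r (z j) * cnj (resolvent_deriv r (z j)))
       + of_real \<beta> / 2 * (G * G + n * G - D) * cnj G)
     \<ge> \<beta> / 4 * n * (cmod G)\<^sup>2 - (2 + (\<beta> / 2 - 1)\<^sup>2 / \<beta>) / (1 - r\<^sup>2)\<^sup>2 * (n + 2 * Re G)"
proof -
  define a where "a = n + 2 * Re G"
  define c where "c = 1 / (1 - r\<^sup>2)"
  have r2: "1 - r\<^sup>2 > 0" using r by (simp add: power_less_one_iff abs_square_less_1)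
  then have c: "c > 0" by (simp add: c_def)
  have a_eq: "a = (\<Sum>j<n. 1 + 2 * Re (resolvent r (z j)))"
    by (simp add: a_def G_def resolvent_sum_def sum.distrib sum_distrib_left)
  have nD: "(\<Sum>j<n. cmod (resolvent_deriv r (z j))) = r * c * a"
    unfolding a_eq sum_distrib_left c_def
    using z by (intro sum.cong refl) (simp add: norm_resolvent_deriv)
  have "0 \<le> r * c * a" unfolding nD[symmetric] by (intro sum_nonneg) auto
  moreover have "r * c > 0" using r c by simp
  ultimately have a: "a \<ge> 0" using mult_pos_neg[of "r * c" a] by linarith
  have D: "cmod D \<le> r * c * a"
    unfolding D_def nD[symmetric] by (rule norm_sum)
  also have "\<dots> \<le> 1 * c * a" using r c a by (intro mult_right_mono) auto
  finally have D: "cmod D \<le> c * a" by simp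
  have "cmod (\<Sum>j<n. resolvent r (z j) * cnj (resolvent_deriv r (z j)))
      \<le> (\<Sum>j<n. r / (1 - r) * cmod (resolvent_deriv r (z j)))"
  proof (intro sum_norm_le)
    fix j assume "j \<in> {..<n}"
    then show "cmod (resolvent r (z j) * cnj (resolvent_deriv r (z j))) \<le> r / (1 - r) * cmod (resolvent_deriv r (z j))"
      unfolding norm_mult complex_mod_cnj using z by (intro mult_right_mono norm_resolvent_le) auto
  qed
  also have "\<dots> = r / (1 - r) * (r * c * a)" by (simp only: sum_distrib_left[symmetric] nD)
  also have "r / (1 - r) = r * (1 + r) * c"
  proof -
    have "1 - r\<^sup>2 = (1 - r) * (1 + r)" by (simp add: power2_eq_square algebra_simps)
    then show ?thesis using r by (simp add: c_def)
  qed
  also have "r * (1 + r) * c * (r * c * a) = (r * r * (1 + r)) * (c\<^sup>2 * a)" by (simp add: power2_eq_square)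
  also have "\<dots> \<le> 2 * (c\<^sup>2 * a)"
  proof (rule mult_right_mono)
    have "r * r * (1 + r) \<le> 1 * 1 * 2" using r by (intro mult_mono) auto
    then show "r * r * (1 + r) \<le> 2" by simp
  qed (use a in auto)
  finally have H: "cmod (\<Sum>j<n. resolvent r (z j) * cnj (resolvent_deriv r (z j))) \<le> 2 * (c\<^sup>2 * a)" .
  let ?S = "\<Sum>j<n. resolvent r (z j) * cnj (resolvent_deriv r (z j))"
  have "(\<beta> / 2 - 1) * Re (D * cnj G) \<le> \<bar>\<beta> / 2 - 1\<bar> * (c * a * cmod G)"
  proof -
    have "\<bar>Re (D * cnj G)\<bar> \<le> cmod D * cmod G" using abs_Re_le_cmod[of "D * cnj G"] by (simp add: norm_mult)
    also have "\<dots> \<le> c * a * cmod G" by (intro mult_right_mono D) auto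
    finally have "\<bar>(\<beta> / 2 - 1) * Re (D * cnj G)\<bar> \<le> \<bar>\<beta> / 2 - 1\<bar> * (c * a * cmod G)"
      unfolding abs_mult by (intro mult_left_mono) auto
    then show ?thesis by linarith
  qed
  also have "\<dots> = a * ((\<bar>\<beta> / 2 - 1\<bar> * c) * cmod G)" by simp
  \<comment> \<open>Completing the square with weight \<open>\<beta> / 4\<close>: then
    \<open>a * (\<beta> / 4 * (cmod G)\<^sup>2)\<close> is exactly the part of the cubic term
    proportional to \<open>a\<close>, which absorbs it.\<close>
  also have "\<dots> \<le> a * (\<beta> / 4 * (cmod G)\<^sup>2 + (\<beta> / 2 - 1)\<^sup>2 / \<beta> * c\<^sup>2)"
  proof (rule mult_left_mono[OF _ a])
    let ?x = "\<bar>\<beta> / 2 - 1\<bar> * c"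
    have "0 \<le> (\<beta> / 2 * cmod G - ?x)\<^sup>2" by simp
    also have "\<dots> = \<beta> * (\<beta> / 4 * (cmod G)\<^sup>2 + ?x\<^sup>2 / \<beta> - ?x * cmod G)"
      using \<beta> by (simp add: power2_eq_square field_simps)
    finally have "?x * cmod G \<le> \<beta> / 4 * (cmod G)\<^sup>2 + ?x\<^sup>2 / \<beta>"
      using \<beta> by (simp add: zero_le_mult_iff)
    then show "?x * cmod G \<le> \<beta> / 4 * (cmod G)\<^sup>2 + (\<beta> / 2 - 1)\<^sup>2 / \<beta> * c\<^sup>2"
      by (simp add: power_mult_distrib)
  qed
  finally have cross: "(\<beta> / 2 - 1) * Re (D * cnj G) \<le> a * (\<beta> / 4 * (cmod G)\<^sup>2 + (\<beta> / 2 - 1)\<^sup>2 / \<beta> * c\<^sup>2)" .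
  have "G * cnj G = of_real ((cmod G)\<^sup>2)" by (simp only: complex_norm_square)
  then have "(G * G + n * G) * cnj G = (G + n) * of_real ((cmod G)\<^sup>2)"
    by (simp only: distrib_right mult.assoc)
  then have "Re ((G * G + n * G) * cnj G) = (Re G + n) * (cmod G)\<^sup>2" by simp
  moreover have "Re G + n = (n + a) / 2" by (simp add: a_def)
  ultimately have main: "Re ((G * G + n * G) * cnj G) = (n + a) / 2 * (cmod G)\<^sup>2" by simp
  have Re_mult: "Re (of_real x * w) = x * Re w" for x w by simp
  have "D * cnj G - ?S + of_real \<beta> / 2 * (G * G + n * G - D) * cnj G
      = of_real (\<beta> / 2) * ((G * G + n * G) * cnj G) - ?S - of_real (\<beta> / 2 - 1) * (D * cnj G)"
    by (simp add: algebra_simps)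
  then have "Re (D * cnj G - ?S + of_real \<beta> / 2 * (G * G + n * G - D) * cnj G)
      = \<beta> / 2 * Re ((G * G + n * G) * cnj G) - Re ?S - (\<beta> / 2 - 1) * Re (D * cnj G)"
    by (simp only: minus_complex.simps Re_mult)
  also have "\<dots> = \<beta> / 4 * n * (cmod G)\<^sup>2 + a * (\<beta> / 4 * (cmod G)\<^sup>2) - Re ?S - (\<beta> / 2 - 1) * Re (D * cnj G)"
    unfolding main by (simp add: field_simps)
  also have "\<dots> \<ge> \<beta> / 4 * n * (cmod G)\<^sup>2 - 2 * (c\<^sup>2 * a) - a * ((\<beta> / 2 - 1)\<^sup>2 / \<beta> * c\<^sup>2)"
    using cross complex_Re_le_cmod[of ?S] H by (simp add: distrib_left)
  finally have "Re (D * cnj G - ?S + of_real \<beta> / 2 * (G * G + n * G - D) * cnj G)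
     \<ge> \<beta> / 4 * n * (cmod G)\<^sup>2 - 2 * (c\<^sup>2 * a) - a * ((\<beta> / 2 - 1)\<^sup>2 / \<beta> * c\<^sup>2)" .
  moreover have "2 * (c\<^sup>2 * a) + a * ((\<beta> / 2 - 1)\<^sup>2 / \<beta> * c\<^sup>2) = (2 + (\<beta> / 2 - 1)\<^sup>2 / \<beta>) / (1 - r\<^sup>2)\<^sup>2 * a"
    by (simp add: c_def power_divide add_divide_distrib algebra_simps)
  ultimately show ?thesis unfolding a_def by linarith
qed

end

section \<open>From the resolvent to the moments of power sums\<close>

lemma resolvent_sum_expansion:
  assumes r: "0 < r" "r < 1" and z: "on_torus n z"
  shows "cmod (resolvent_sum r n z - (\<Sum>k=1..K. of_real (r ^ k) * power_sum n k z))
     \<le> real n * (r ^ Suc K / (1 - r))"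
proof -
  have "(\<Sum>k=1..K. of_real (r ^ k) * power_sum n k z) = (\<Sum>j<n. \<Sum>k=1..K. of_real (r ^ k) * z j ^ k)"
    unfolding power_sum_def sum_distrib_left by (rule sum.swap)
  then have "resolvent_sum r n z - (\<Sum>k=1..K. of_real (r ^ k) * power_sum n k z)
     = (\<Sum>j<n. resolvent r (z j) - (\<Sum>k=1..K. of_real (r ^ k) * z j ^ k))"
    by (simp add: resolvent_sum_def[OF r] sum_subtractf)
  also have "cmod \<dots> \<le> (\<Sum>j<n. r ^ Suc K / (1 - r))"
    using z by (intro sum_norm_le resolvent_expansion r) auto
  finally show ?thesis by simp
qed

lemma resolvent_sum_limit:
  assumes r: "0 < r" "r < 1" and z: "on_torus n z"
  shows "(\<lambda>K. \<Sum>k=1..K. of_real (r ^ k) * power_sum n k z) \<longlonglongrightarrow> resolvent_sum r n z"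
proof -
  have "(\<lambda>K. real n * (r ^ Suc K / (1 - r))) \<longlonglongrightarrow> real n * (0 / (1 - r))"
    using r by (intro tendsto_intros LIMSEQ_Suc LIMSEQ_power_zero) auto
  then have lim: "(\<lambda>K. real n * (r ^ Suc K / (1 - r))) \<longlonglongrightarrow> 0" by simp
  have "(\<lambda>K. resolvent_sum r n z - (\<Sum>k=1..K. of_real (r ^ k) * power_sum n k z)) \<longlonglongrightarrow> 0"
    by (rule Lim_null_comparison[OF _ lim])
       (intro always_eventually allI resolvent_sum_expansion assms)
  from tendsto_diff[OF tendsto_const[of "resolvent_sum r n z"] this] show ?thesis by simp
qed

lemma norm_partial_resolvent_sum_le:
  assumes r: "0 < r" "r < 1" and z: "on_torus n z"
  shows "cmod (\<Sum>k=1..K. of_real (r ^ k) * power_sum n k z) \<le> 2 * real n / (1 - r)"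
proof -
  let ?S = "\<Sum>k=1..K. of_real (r ^ k) * power_sum n k z"
  have "cmod ?S \<le> cmod (resolvent_sum r n z) + cmod (resolvent_sum r n z - ?S)"
    using norm_triangle_ineq4[of "resolvent_sum r n z" "resolvent_sum r n z - ?S"] by simp
  also have "\<dots> \<le> real n * (r / (1 - r)) + real n * (r ^ Suc K / (1 - r))"
    by (intro add_mono norm_resolvent_sum_le resolvent_sum_expansion r z)
  also have "\<dots> \<le> real n * (1 / (1 - r)) + real n * (1 / (1 - r))"
    using r by (intro add_mono mult_left_mono divide_right_mono power_le_one) auto
  finally show ?thesis by simp
qed

text \<open>Orthogonality to \<open>power_sum n 0\<close>, which is the constant \<open>n\<close>;
  for \<open>n = 0\<close> the sum is empty.\<close>

lemma integral_power_sum: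
  assumes "\<beta> > 0" "k > 0"
  shows "(\<integral>z. power_sum n k z \<partial>cbe \<beta> n) = 0"
proof (cases "n = 0")
  case True
  then show ?thesis by (simp add: power_sum_def)
next
  case False
  have "power_sum n 0 z = of_nat n" for z by (simp add: power_sum_def)
  then show ?thesis
    using power_sum_orthogonal[OF assms(1), of k 0 n] assms False by simp
qed

lemma integral_resolvent_sum:
  assumes r: "0 < r" "r < 1" and \<beta>: "\<beta> > 0"
  shows "(\<integral>z. resolvent_sum r n z \<partial>cbe \<beta> n) = 0"
proof -
  interpret prob_space "cbe \<beta> n" using \<beta> by (rule prob_space_cbe)
  note [measurable] = borel_measurable_resolvent_sum[OF r]
  have "(\<lambda>K. \<integral>z. (\<Sum>k=1..K. of_real (r ^ k) * power_sum n k z) \<partial>cbe \<beta> n)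
      \<longlonglongrightarrow> (\<integral>z. resolvent_sum r n z \<partial>cbe \<beta> n)"
  proof (rule integral_dominated_convergence[where w="\<lambda>_. 2 * real n / (1 - r)"])
    show "AE z in cbe \<beta> n. (\<lambda>K. \<Sum>k=1..K. of_real (r ^ k) * power_sum n k z) \<longlonglongrightarrow> resolvent_sum r n z"
      using AE_cbe_norm[OF \<beta>] by eventually_elim (rule resolvent_sum_limit[OF r])
    show "AE z in cbe \<beta> n. norm (\<Sum>k=1..K. of_real (r ^ k) * power_sum n k z) \<le> 2 * real n / (1 - r)" for K
      using AE_cbe_norm[OF \<beta>] by eventually_elim (rule norm_partial_resolvent_sum_le[OF r])
  qed auto
  moreover have "(\<integral>z. (\<Sum>k=1..K. of_real (r ^ k) * power_sum n k z) \<partial>cbe \<beta> n) = 0" for K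
  proof -
    have "integrable (cbe \<beta> n) (power_sum n k)" for k
      by (rule integrable_cbe_bounded[OF \<beta> _ norm_power_sum_le]) auto
    then show ?thesis
      by (subst Bochner_Integration.integral_sum) (auto simp: integral_power_sum[OF \<beta>])
  qed
  ultimately show ?thesis by (simp add: LIMSEQ_const_iff)
qed

text \<open>The coefficient in \<open>resolvent_pointwise_bound\<close>, divided by the factor
  \<open>\<beta> / 4\<close> of the main term.\<close>

definition resolvent_constant :: "real \<Rightarrow> real" where
  "resolvent_constant \<beta> = 4 / \<beta> * (2 + (\<beta> / 2 - 1)\<^sup>2 / \<beta>)"

lemma resolvent_constant_pos: "\<beta> > 0 \<Longrightarrow> resolvent_constant \<beta> > 0"
  unfolding resolvent_constant_def by (intro mult_pos_pos add_pos_nonneg) auto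

text \<open>The loop equation integrates the pointwise bound to \<open>\<beta> / 4 * n\<close> times
  the second moment minus \<open>K * n\<close>, because the real part of the resolvent sum has mean
  zero. Both terms carry the factor \<open>n\<close>, and its cancellation makes the estimate
  uniform in \<open>n\<close>.\<close>

proposition resolvent_second_moment:
  assumes r: "0 < r" "r < 1" and \<beta>: "\<beta> > 0" and n: "n > 0"
  shows "(\<integral>z. (cmod (resolvent_sum r n z))\<^sup>2 \<partial>cbe \<beta> n) \<le> resolvent_constant \<beta> / (1 - r\<^sup>2)\<^sup>2"
proof -
  interpret prob_space "cbe \<beta> n" using \<beta> by (rule prob_space_cbe)
  note [measurable] = borel_measurable_resolvent_sum[OF r] borel_measurable_resolvent[OF r]
  interpret F: torus_field n "resolvent_field r n"
     "resolvent_field_deriv r n"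
     "r / (1 - r) * (real n * (r / (1 - r))) + (r / (1 - r) * (r / (1 - r)\<^sup>2) + r / (1 - r)\<^sup>2 * (real n * (r / (1 - r))))"
    by (rule torus_field_resolvent[OF r refl refl])
  let ?L = "loop_integrand \<beta> 0 n (resolvent_field r n)
     (resolvent_field_deriv r n)"
  let ?G = "resolvent_sum r n"
  define K where "K = (2 + (\<beta> / 2 - 1)\<^sup>2 / \<beta>) / (1 - r\<^sup>2)\<^sup>2"
  have intG: "integrable (cbe \<beta> n) ?G"
    by (rule integrable_cbe_bounded[OF \<beta> _ norm_resolvent_sum_le[OF r]]) auto
  have intG2: "integrable (cbe \<beta> n) (\<lambda>z. (cmod (?G z))\<^sup>2)"
  proof (rule integrable_cbe_bounded[OF \<beta>, where B="(real n * (r / (1 - r)))\<^sup>2"])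
    fix z :: "nat \<Rightarrow> complex" assume z: "on_torus n z"
    show "norm ((cmod (?G z))\<^sup>2) \<le> (real n * (r / (1 - r)))\<^sup>2"
      using power_mono[OF norm_resolvent_sum_le[OF r z], of 2] by simp
  qed simp
  have ReG: "(\<integral>z. Re (?G z) \<partial>cbe \<beta> n) = 0"
    using intG integral_resolvent_sum[OF r \<beta>, of n] by simp
  have "AE z in cbe \<beta> n. \<beta> / 4 * n * (cmod (?G z))\<^sup>2 - K * (n + 2 * Re (?G z)) \<le> Im (?L z)"
    using AE_cbe_norm[OF \<beta>, of n] AE_cbe_inj[OF \<beta>, of n]
  proof eventually_elim
    fix z :: "nat \<Rightarrow> complex" assume z: "on_torus n z" "inj_on z {..<n}"
    have "Im (\<i> * w) = Re w" for w by simp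
    then show "\<beta> / 4 * n * (cmod (?G z))\<^sup>2 - K * (n + 2 * Re (?G z)) \<le> Im (?L z)"
      unfolding resolvent_loop_integrand[OF r z] K_def
      using resolvent_pointwise_bound[OF r z(1) \<beta>] by (simp only:)
  qed
  moreover have intL: "integrable (cbe \<beta> n) ?L"
    by (rule F.integrable_loop_integrand[OF \<beta>])
  ultimately have "(\<integral>z. \<beta> / 4 * n * (cmod (?G z))\<^sup>2 - K * (n + 2 * Re (?G z)) \<partial>cbe \<beta> n) \<le> (\<integral>z. Im (?L z) \<partial>cbe \<beta> n)"
    using intG intG2 by (intro integral_mono_AE) auto
  also have "\<dots> = 0" using F.cbe_loop_equation[OF \<beta>] intL by simp
  also have "(\<integral>z. \<beta> / 4 * n * (cmod (?G z))\<^sup>2 - K * (n + 2 * Re (?G z)) \<partial>cbe \<beta> n)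
      = \<beta> / 4 * n * (\<integral>z. (cmod (?G z))\<^sup>2 \<partial>cbe \<beta> n) - K * n"
    using intG intG2 ReG by (simp add: prob_space)
  finally have "real n * (\<beta> / 4 * (\<integral>z. (cmod (?G z))\<^sup>2 \<partial>cbe \<beta> n)) \<le> real n * K" by (simp add: mult_ac)
  then have "\<beta> / 4 * (\<integral>z. (cmod (?G z))\<^sup>2 \<partial>cbe \<beta> n) \<le> K" using n by simp
  then have "(\<integral>z. (cmod (?G z))\<^sup>2 \<partial>cbe \<beta> n) \<le> 4 / \<beta> * K" using \<beta> by (simp add: field_simps)
  then show ?thesis by (simp add: K_def resolvent_constant_def)
qed

lemma sum_power_sum_moment_le_resolvent:
  assumes r: "0 < r" "r < 1" and \<beta>: "\<beta> > 0" and n: "n > 0"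
  shows "(\<Sum>k=1..K. r ^ (2 * k) * power_sum_moment \<beta> n k) \<le> resolvent_constant \<beta> / (1 - r\<^sup>2)\<^sup>2"
proof -
  interpret prob_space "cbe \<beta> n" using \<beta> by (rule prob_space_cbe)
  note [measurable] = borel_measurable_resolvent_sum[OF r]
  let ?S = "\<lambda>K. \<Sum>k=1..K. r ^ (2 * k) * power_sum_moment \<beta> n k"
  have "(\<lambda>K. \<integral>z. (cmod (\<Sum>k=1..K. of_real (r ^ k) * power_sum n k z))\<^sup>2 \<partial>cbe \<beta> n)
      \<longlonglongrightarrow> (\<integral>z. (cmod (resolvent_sum r n z))\<^sup>2 \<partial>cbe \<beta> n)"
  proof (rule integral_dominated_convergence[where w="\<lambda>_. (2 * real n / (1 - r))\<^sup>2"])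
    show "AE z in cbe \<beta> n. (\<lambda>K. (cmod (\<Sum>k=1..K. of_real (r ^ k) * power_sum n k z))\<^sup>2)
        \<longlonglongrightarrow> (cmod (resolvent_sum r n z))\<^sup>2"
      using AE_cbe_norm[OF \<beta>] by eventually_elim (intro tendsto_intros resolvent_sum_limit[OF r])
    show "AE z in cbe \<beta> n. norm ((cmod (\<Sum>k=1..K. of_real (r ^ k) * power_sum n k z))\<^sup>2) \<le> (2 * real n / (1 - r))\<^sup>2" for K
      using AE_cbe_norm[OF \<beta>]
    proof eventually_elim
      case (elim z)
      then show ?case
        using power_mono[OF norm_partial_resolvent_sum_le[OF r elim, of K], of 2] by simp
    qed
  qed auto
  also have "(\<lambda>K. \<integral>z. (cmod (\<Sum>k=1..K. of_real (r ^ k) * power_sum n k z))\<^sup>2 \<partial>cbe \<beta> n) = ?S"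
    unfolding integral_square_sum_power_sum[OF \<beta>] using r
    by (intro ext sum.cong refl) (simp add: norm_power power_mult[symmetric] mult.commute)
  finally have "?S \<longlonglongrightarrow> (\<integral>z. (cmod (resolvent_sum r n z))\<^sup>2 \<partial>cbe \<beta> n)" .
  moreover have "incseq ?S"
    using r by (intro incseq_SucI) (simp add: power_sum_moment_nonneg)
  ultimately have "?S K \<le> (\<integral>z. (cmod (resolvent_sum r n z))\<^sup>2 \<partial>cbe \<beta> n)"
    by (rule incseq_le[rotated])
  also have "\<dots> \<le> resolvent_constant \<beta> / (1 - r\<^sup>2)\<^sup>2"
    by (rule resolvent_second_moment[OF r \<beta> n])
  finally show ?thesis .
qed

proposition sum_power_sum_moment_le:
  assumes \<beta>: "\<beta> > 0" and n: "n > 0"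
  shows "(\<Sum>k=1..K. power_sum_moment \<beta> n k) \<le> 8 * resolvent_constant \<beta> * (real K)\<^sup>2"
proof (cases "K = 0")
  case False
  \<comment> \<open>\<open>x\<close> is the square of the radius: by Bernoulli every
    \<open>x ^ k\<close> with \<open>k \<le> K\<close> is at least 1/2, while
    \<open>1 / (1 - x)\<^sup>2\<close> equals \<open>4 * (real K)\<^sup>2\<close>; hence the factor
    8.\<close>
  define x where "x = 1 - 1 / (2 * real K)"
  define r where "r = sqrt x"
  have x: "0 < x" "x < 1" using False by (auto simp: x_def field_simps)
  then have r: "0 < r" "r < 1" "r\<^sup>2 = x" by (auto simp: r_def)
  have "(\<Sum>k=1..K. 1 / 2 * power_sum_moment \<beta> n k) \<le> (\<Sum>k=1..K. r ^ (2 * k) * power_sum_moment \<beta> n k)"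
  proof (intro sum_mono mult_right_mono power_sum_moment_nonneg)
    fix k assume k: "k \<in> {1..K}"
    have "1 / 2 \<le> 1 + real k * (x - 1)" using k False by (simp add: x_def field_simps)
    also have "\<dots> \<le> (1 + (x - 1)) ^ k" using x by (intro Bernoulli_inequality) auto
    finally show "1 / 2 \<le> r ^ (2 * k)" by (simp add: power_mult r)
  qed
  also have "\<dots> \<le> resolvent_constant \<beta> / (1 - r\<^sup>2)\<^sup>2"
    by (rule sum_power_sum_moment_le_resolvent[OF r(1,2) \<beta> n])
  also have "\<dots> = 4 * resolvent_constant \<beta> * (real K)\<^sup>2"
    by (simp add: r x_def power_divide power_mult_distrib)
  finally show ?thesis by (simp add: sum_distrib_left[symmetric] sum_divide_distrib[symmetric])
qed simp

subsection \<open>A smoothed counting function\<close>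

text \<open>The term \<open>n = 0\<close> vanishes because \<open>1 / 0 = 0\<close>.\<close>

definition dilog :: "complex \<Rightarrow> complex" where
  "dilog w = (\<Sum>n. of_real (1 / (real n)\<^sup>2) * w ^ n)"

lemma summable_inverse_square: "summable (\<lambda>n. 1 / (real n)\<^sup>2)"
  using inverse_power_summable[of 2, where ?'a=real] by (simp add: divide_inverse)

lemma summable_dilog:
  assumes "cmod w \<le> 1"
  shows "summable (\<lambda>n. of_real (1 / (real n)\<^sup>2) * w ^ n)"
proof (rule summable_comparison_test'[OF summable_inverse_square, of 0])
  fix n :: nat
  have "cmod w ^ n \<le> 1" using assms by (intro power_le_one) auto
  then have "1 / (real n)\<^sup>2 * cmod w ^ n \<le> 1 / (real n)\<^sup>2 * 1"
    by (intro mult_left_mono) auto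
  then show "norm (of_real (1 / (real n)\<^sup>2) * w ^ n) \<le> 1 / (real n)\<^sup>2"
    by (simp add: norm_mult norm_power norm_divide)
qed

lemma continuous_on_dilog: "continuous_on (cball 0 1) dilog"
proof -
  have "uniform_limit (cball 0 1) (\<lambda>N w. \<Sum>n<N. of_real (1 / (real n)\<^sup>2) * w ^ n) dilog sequentially"
    unfolding dilog_def[abs_def]
  proof (rule Weierstrass_m_test[OF _ summable_inverse_square])
    fix n :: nat and w :: complex assume "w \<in> cball 0 1"
    then have "cmod w ^ n \<le> 1" by (intro power_le_one) auto
    then have "1 / (real n)\<^sup>2 * cmod w ^ n \<le> 1 / (real n)\<^sup>2 * 1"
      by (intro mult_left_mono) auto
    then show "norm (of_real (1 / (real n)\<^sup>2) * w ^ n) \<le> 1 / (real n)\<^sup>2"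
      by (simp add: norm_mult norm_power norm_divide)
  qed
  then show ?thesis
  proof (rule uniform_limit_theorem[rotated])
    show "\<forall>\<^sub>F N in sequentially. continuous_on (cball 0 1) (\<lambda>w. \<Sum>n<N. complex_of_real (1 / (real n)\<^sup>2) * w ^ n)"
      by (intro always_eventually allI continuous_intros)
  qed simp
qed

text \<open>Term by term, w times the derivative of the dilogarithm at w is
  \<open>- Ln (1 - w)\<close>; the factor w comes from differentiating along the circle.\<close>

lemma has_vector_derivative_dilog_circle:
  assumes r: "0 < r" "r < 1"
  shows "((\<lambda>t. dilog (of_real r * cis t)) has_vector_derivative - \<i> * Ln (1 - of_real r * cis t)) (at t)"
proof -
  let ?c = "\<lambda>n. complex_of_real (1 / (real n)\<^sup>2)" and ?w = "of_real r * cis t"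
  have w: "cmod ?w < 1" using r by (simp add: norm_mult)
  have "((\<lambda>w. \<Sum>n. ?c n * w ^ n) has_field_derivative (\<Sum>n. diffs ?c n * ?w ^ n)) (at ?w)"
    using summable_dilog[of 1] w by (intro termdiffs_strong[where K=1]) auto
  then have "(dilog has_field_derivative (\<Sum>n. diffs ?c n * ?w ^ n)) (at ?w)"
    by (simp only: dilog_def[abs_def])
  moreover have "((\<lambda>t. of_real r * cis t) has_vector_derivative \<i> * ?w) (at t)"
    unfolding has_vector_derivative_def
    by (auto intro!: derivative_eq_intros simp: scaleR_conv_of_real)
  ultimately have "((dilog \<circ> (\<lambda>t. of_real r * cis t)) has_vector_derivative \<i> * ?w * (\<Sum>n. diffs ?c n * ?w ^ n)) (at t)"
    by (intro field_vector_diff_chain_at)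
  moreover have "?w * (\<Sum>n. diffs ?c n * ?w ^ n) = - Ln (1 - ?w)"
  proof -
    have "(\<lambda>n. - ((- (- ?w)) ^ n) / of_nat n) sums ln (1 + (- ?w))"
      using w by (intro Ln_series') simp
    from sums_minus[OF this] have "(\<lambda>n. ?w ^ n / of_nat n) sums (- ln (1 - ?w))"
      by (simp only: minus_minus minus_divide_left[symmetric] add_uminus_conv_diff)
    then have "(\<lambda>n. ?w ^ Suc n / of_nat (Suc n)) sums (- ln (1 - ?w))"
      by (subst sums_Suc_iff) simp
    moreover have "?w ^ Suc n / of_nat (Suc n) = ?w * (diffs ?c n * ?w ^ n)" for n
    proof -
      have "complex_of_nat (Suc n) * (?w ^ Suc n / (of_nat (Suc n))\<^sup>2) = ?w ^ Suc n / of_nat (Suc n)"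
        by (simp add: power2_eq_square del: of_nat_Suc)
      then show ?thesis by (simp add: diffs_def mult_ac del: of_nat_Suc)
    qed
    ultimately have "(\<lambda>n. ?w * (diffs ?c n * ?w ^ n)) sums (- ln (1 - ?w))" by simp
    moreover have "?w \<noteq> 0" using r by simp
    ultimately have "(\<lambda>n. diffs ?c n * ?w ^ n) sums (- ln (1 - ?w) / ?w)"
      by (rule sums_mult_D)
    then have S: "(\<Sum>n. diffs ?c n * ?w ^ n) = - ln (1 - ?w) / ?w" by (rule sums_unique[symmetric])
    have "w * S = L" if "w \<noteq> 0" "S = L / w" for w S L :: complex
      using that by simp
    from this[OF \<open>?w \<noteq> 0\<close> S] show ?thesis .
  qed
  ultimately show ?thesis by (simp add: o_def mult.assoc)
qed

lemma Im_Ln_one_minus_cis: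
  assumes "0 < t" "t < 2 * pi"
  shows "Im (Ln (1 - cis t)) = (t - pi) / 2" "1 - cis t \<notin> \<real>\<^sub>\<le>\<^sub>0"
proof -
  have s: "sin (t / 2) > 0" using assms by (intro sin_gt_zero) auto
  have "1 - cis t = of_real (2 * sin (t / 2)) * cis ((t - pi) / 2)"
  proof -
    have "cos t = 1 - 2 * (sin (t / 2))\<^sup>2" using cos_double_sin[of "t / 2"] by simp
    moreover have "sin t = 2 * sin (t / 2) * cos (t / 2)" using sin_double[of "t / 2"] by simp
    moreover have "cos ((t - pi) / 2) = sin (t / 2)" "sin ((t - pi) / 2) = - cos (t / 2)"
      by (simp_all add: diff_divide_distrib cos_diff sin_diff)
    ultimately show ?thesis by (simp add: complex_eq_iff power2_eq_square)
  qed
  also have "\<dots> = exp (Complex (ln (2 * sin (t / 2))) ((t - pi) / 2))"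
    using s by (simp add: exp_eq_polar exp_of_real[symmetric])
  finally have e: "1 - cis t = exp (Complex (ln (2 * sin (t / 2))) ((t - pi) / 2))" .
  have "Ln (1 - cis t) = Complex (ln (2 * sin (t / 2))) ((t - pi) / 2)"
    unfolding e using assms by (intro Ln_exp) auto
  then show "Im (Ln (1 - cis t)) = (t - pi) / 2" by simp
  have "cos t = 1 - 2 * (sin (t / 2))\<^sup>2" using cos_double_sin[of "t / 2"] by simp
  then have "Re (1 - cis t) > 0" using s by simp
  then show "1 - cis t \<notin> \<real>\<^sub>\<le>\<^sub>0" by (auto simp: complex_nonpos_Reals_iff)
qed

text \<open>The Fourier series with terms cos(k y)/k^2 is a parabola on one period; its value at 0
  is left open because \<open>ramp\<close> uses only differences. The dilogarithm is differentiated
  inside the disc, at radius \<open>r m < 1\<close>. The imaginary parts of the logarithms are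
  bounded by \<open>pi\<close>, so dominated convergence lets the radius tend to 1.\<close>

lemma Re_dilog_cis:
  assumes y: "0 \<le> y" "y \<le> 2 * pi"
  shows "Re (dilog (cis y)) = Re (dilog 1) - pi * y / 2 + y\<^sup>2 / 4"
proof -
  define r where "r m = 1 - 1 / (real m + 2)" for m
  have r: "0 < r m" "r m < 1" for m by (auto simp: r_def field_simps)
  have rlim: "r \<longlonglongrightarrow> 1"
  proof -
    have "(\<lambda>m. inverse (real (Suc (Suc m)))) \<longlonglongrightarrow> 0" by (rule LIMSEQ_Suc[OF LIMSEQ_inverse_real_of_nat])
    then have "(\<lambda>m. 1 - inverse (real (Suc (Suc m)))) \<longlonglongrightarrow> 1 - 0" by (intro tendsto_intros)
    then show ?thesis by (simp add: r_def[abs_def] field_simps)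
  qed
  let ?g = "\<lambda>m t. Im (Ln (1 - of_real (r m) * cis t))"
  let ?lim = "\<lambda>t. if t = 0 \<or> t = 2 * pi then 0 else (t - pi) / 2"
  have nz: "1 - of_real (r m) * cis t \<noteq> 0" for m t
  proof
    assume "1 - of_real (r m) * cis t = 0"
    then have "cmod (of_real (r m) * cis t) = 1" by simp
    then show False using r[of m] by (simp add: norm_mult)
  qed
  have int: "(?g m has_integral Re (dilog (of_real (r m) * cis y)) - Re (dilog (of_real (r m) * cis 0))) {0..y}" for m
  proof (rule fundamental_theorem_of_calculus[OF y(1)])
    fix t
    have "((\<lambda>t. Re (dilog (of_real (r m) * cis t))) has_vector_derivative Re (- \<i> * Ln (1 - of_real (r m) * cis t))) (at t)"
      using bounded_linear.has_vector_derivative[OF bounded_linear_Re has_vector_derivative_dilog_circle[OF r]] .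
    then show "((\<lambda>t. Re (dilog (of_real (r m) * cis t))) has_vector_derivative ?g m t) (at t within {0..y})"
      by (simp add: has_vector_derivative_at_within)
  qed
  have lim2: "(\<lambda>m. integral {0..y} (?g m)) \<longlonglongrightarrow> integral {0..y} ?lim"
  proof (rule dominated_convergence(2)[where h="\<lambda>_. pi"])
    show "?g m integrable_on {0..y}" for m using int[of m] by blast
    show "(\<lambda>_. pi) integrable_on {0..y}" by (rule integrable_const_ivl)
    show "norm (?g m t) \<le> pi" for m t
      using mpi_less_Im_Ln[OF nz[of m t]] Im_Ln_le_pi[OF nz[of m t]] by simp
    fix t assume t: "t \<in> {0..y}"
    show "(\<lambda>m. ?g m t) \<longlonglongrightarrow> ?lim t"
    proof (cases "t = 0 \<or> t = 2 * pi")
      case True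
      then have "cis t = 1" by (auto simp: complex_eq_iff)
      moreover have "Im (Ln (1 - of_real (r m))) = 0" for m
        using r[of m] by (subst of_real_1[symmetric], subst of_real_diff[symmetric], subst Ln_of_real) auto
      ultimately show ?thesis using True by simp
    next
      case False
      then have t': "0 < t" "t < 2 * pi" using t y by auto
      have "(\<lambda>m. 1 - of_real (r m) * cis t) \<longlonglongrightarrow> 1 - of_real 1 * cis t"
        by (intro tendsto_intros rlim)
      then have "(\<lambda>m. ?g m t) \<longlonglongrightarrow> Im (Ln (1 - cis t))"
        using Im_Ln_one_minus_cis(2)[OF t'] by (intro tendsto_Im tendsto_Ln) auto
      then show ?thesis using False Im_Ln_one_minus_cis(1)[OF t'] by simp
    qed
  qed
  have lim1: "(\<lambda>m. integral {0..y} (?g m)) \<longlonglongrightarrow> Re (dilog (cis y)) - Re (dilog 1)"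
  proof -
    have "(\<lambda>m. dilog (of_real (r m) * cis x)) \<longlonglongrightarrow> dilog (of_real 1 * cis x)" for x
    proof (rule continuous_on_tendsto_compose[OF continuous_on_dilog])
      show "(\<lambda>m. of_real (r m) * cis x) \<longlonglongrightarrow> of_real 1 * cis x"
        by (intro tendsto_intros rlim)
      have "\<bar>r m\<bar> \<le> 1" for m using r[of m] by simp
      then show "\<forall>\<^sub>F m in sequentially. of_real (r m) * cis x \<in> cball 0 1"
        by (simp add: norm_mult)
    qed (simp add: norm_mult)
    from tendsto_diff[OF tendsto_Re[OF this[of y]] tendsto_Re[OF this[of 0]]]
    have "(\<lambda>m. Re (dilog (of_real (r m) * cis y)) - Re (dilog (of_real (r m) * cis 0)))
        \<longlonglongrightarrow> Re (dilog (cis y)) - Re (dilog 1)" by simp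
    then show ?thesis unfolding integral_unique[OF int] .
  qed
  have "integral {0..y} ?lim = y\<^sup>2 / 4 - pi * y / 2"
  proof (rule integral_unique)
    have "((\<lambda>t. (t - pi) / 2) has_integral (y\<^sup>2 / 4 - pi * y / 2) - (0\<^sup>2 / 4 - pi * 0 / 2)) {0..y}"
      by (intro fundamental_theorem_of_calculus y(1))
         (auto intro!: derivative_eq_intros simp: has_real_derivative_iff_has_vector_derivative[symmetric])
    then have "((\<lambda>t. (t - pi) / 2) has_integral (y\<^sup>2 / 4 - pi * y / 2)) {0..y}"
      by simp
    then show "(?lim has_integral (y\<^sup>2 / 4 - pi * y / 2)) {0..y}"
      by (rule has_integral_spike_finite[where S="{0, 2 * pi}", rotated 2]) auto
  qed
  with LIMSEQ_unique[OF lim1 lim2] show ?thesis by linarith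
qed

text \<open>This is the convex piecewise linear function whose slope on
  \<open>[2\<pi>(M - 1), 2\<pi>M]\<close> is the integer \<open>M\<close>: its difference quotients are smoothed versions
  of the function counting the multiples of \<open>2\<pi>\<close> up to a given point.\<close>

definition ramp :: "real \<Rightarrow> real" where
  "ramp y = y\<^sup>2 / (4 * pi) + y / 2 - (Re (dilog (cis y)) - Re (dilog 1)) / pi"

lemma ramp_eq:
  assumes "2 * pi * (of_int M - 1) \<le> y" "y \<le> 2 * pi * of_int M"
  shows "ramp y = of_int M * y - pi * of_int M * (of_int M - 1)"
proof -
  define x where "x = y - 2 * pi * (of_int M - 1)"
  have x: "0 \<le> x" "x \<le> 2 * pi" using assms by (auto simp: x_def algebra_simps)
  have y: "y = x + 2 * pi * of_int (M - 1)" by (simp add: x_def)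
  have "cis y = cis x"
    unfolding y by (simp only: cis_mult[symmetric] cis_multiple_2pi[OF Ints_of_int] mult_1_right)
  then have "ramp y = y\<^sup>2 / (4 * pi) + y / 2 - (x\<^sup>2 / 4 - pi * x / 2) / pi"
    unfolding ramp_def using Re_dilog_cis[OF x] by simp
  also have "\<dots> = of_int M * y - pi * of_int M * (of_int M - 1)"
    unfolding x_def by (simp add: field_simps power2_eq_square)
  finally show ?thesis .
qed

section \<open>Convexity of the ramp and comparison with indicators\<close>

lemma floor_bounds_2pi:
  "2 * pi * ((of_int (\<lfloor>y / (2 * pi)\<rfloor> + 1)) - 1) \<le> y" "y < 2 * pi * of_int (\<lfloor>y / (2 * pi)\<rfloor> + 1)"
proof -
  have "real_of_int \<lfloor>y / (2 * pi)\<rfloor> \<le> y / (2 * pi)" "y / (2 * pi) < real_of_int \<lfloor>y / (2 * pi)\<rfloor> + 1"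
    by linarith+
  moreover have "2 * pi * ((q + 1) - 1) \<le> y" "y < 2 * pi * (q + 1)" if "q \<le> y / (2 * pi)" "y / (2 * pi) < q + 1" for q
    using that by (simp_all add: field_simps)
  ultimately show "2 * pi * ((of_int (\<lfloor>y / (2 * pi)\<rfloor> + 1)) - 1) \<le> y" "y < 2 * pi * of_int (\<lfloor>y / (2 * pi)\<rfloor> + 1)"
    unfolding of_int_add of_int_1 by blast+
qed

lemma ceiling_bounds_2pi:
  "2 * pi * (of_int \<lceil>y / (2 * pi)\<rceil> - 1) < y" "y \<le> 2 * pi * of_int \<lceil>y / (2 * pi)\<rceil>"
proof -
  have "real_of_int \<lceil>y / (2 * pi)\<rceil> - 1 < y / (2 * pi)" "y / (2 * pi) \<le> real_of_int \<lceil>y / (2 * pi)\<rceil>"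
    by linarith+
  moreover have "2 * pi * (q - 1) < y" "y \<le> 2 * pi * q" if "q - 1 < y / (2 * pi)" "y / (2 * pi) \<le> q" for q
    using that by (simp_all add: field_simps)
  ultimately show "2 * pi * (of_int \<lceil>y / (2 * pi)\<rceil> - 1) < y" "y \<le> 2 * pi * of_int \<lceil>y / (2 * pi)\<rceil>"
    by blast+
qed

text \<open>Supporting lines of a convex function. The lines of slopes N and M differ by
  \<open>(N - M) * (y - pi * (N + M - 1))\<close>, and where \<open>ramp\<close> has slope N the two
  factors have the same sign because N and M are integers.\<close>

lemma ramp_ge: "of_int M * y - pi * of_int M * (of_int M - 1) \<le> ramp y"
proof -
  define N where "N = \<lfloor>y / (2 * pi)\<rfloor> + 1"
  have N: "2 * pi * (of_int N - 1) \<le> y" "y < 2 * pi * of_int N"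
    unfolding N_def by (rule floor_bounds_2pi)+
  have "ramp y = of_int N * y - pi * of_int N * (of_int N - 1)"
    using N by (intro ramp_eq) auto
  moreover have "0 \<le> (real_of_int N - of_int M) * (y - pi * (of_int N + of_int M - 1))"
  proof -
    consider "M = N" | "M + 1 \<le> N" | "N + 1 \<le> M" by linarith
    then show ?thesis
    proof cases
      case 2
      then have "real_of_int M + 1 \<le> real_of_int N" by linarith
      then have "pi * (of_int N + of_int M - 1) \<le> pi * (2 * (of_int N - 1))"
        by (intro mult_left_mono) auto
      with N 2 show ?thesis by (intro mult_nonneg_nonneg) (auto simp: algebra_simps)
    next
      case 3
      then have "real_of_int N + 1 \<le> real_of_int M" by linarith
      then have "pi * (2 * of_int N) \<le> pi * (of_int N + of_int M - 1)"
        by (intro mult_left_mono) auto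
      with N 3 show ?thesis by (intro mult_nonpos_nonpos) (auto simp: algebra_simps)
    qed simp
  qed
  ultimately show ?thesis by (simp add: algebra_simps)
qed

lemma ramp_slope:
  assumes "2 * pi * (of_int M - 1) \<le> y" "y \<le> 2 * pi * of_int M" "h > 0"
  shows "real_of_int M \<le> (ramp (y + h) - ramp y) / h" "(ramp y - ramp (y - h)) / h \<le> real_of_int M"
  using ramp_ge[of M "y + h"] ramp_ge[of M "y - h"] ramp_eq[OF assms(1,2)] assms(3)
  by (simp_all add: pos_le_divide_eq pos_divide_le_eq algebra_simps)

text \<open>The average over shifts u in [0, h] of the number of points
  \<open>x + 2 * pi * m\<close>, m an integer, in the window [s + u, t + u), counted negatively if t
  < s.\<close>

definition smooth_count :: "real \<Rightarrow> real \<Rightarrow> real \<Rightarrow> real \<Rightarrow> real" where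
  "smooth_count h s t x = (ramp (t - x + h) - ramp (t - x)) / h - (ramp (s - x + h) - ramp (s - x)) / h"

text \<open>The window starts at \<open>a - h\<close>, so each of its shifts by u in (0, h] contains
  the closed interval from \<open>a\<close> to \<open>b\<close>.\<close>

lemma smooth_count_upper:
  assumes "h > 0" "a \<le> b"
  shows "of_bool (\<exists>m::int. a \<le> x + 2 * pi * m \<and> x + 2 * pi * m \<le> b) \<le> smooth_count h (a - h) b x"
proof -
  \<comment> \<open>Floor plus one is the right slope of \<open>ramp\<close> at
    \<open>b - x\<close>, and the ceiling is the left slope at \<open>a - x\<close>; thus points
    exactly at \<open>a\<close> or \<open>b\<close> are counted.\<close>
  define M where "M = \<lfloor>(b - x) / (2 * pi)\<rfloor> + 1"
  define N where "N = \<lceil>(a - x) / (2 * pi)\<rceil>"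
  have M: "2 * pi * (of_int M - 1) \<le> b - x" "b - x < 2 * pi * of_int M"
    unfolding M_def by (rule floor_bounds_2pi)+
  have N: "2 * pi * (of_int N - 1) < a - x" "a - x \<le> 2 * pi * of_int N"
    unfolding N_def by (rule ceiling_bounds_2pi)+
  have "real_of_int M - real_of_int N \<le> smooth_count h (a - h) b x"
    using ramp_slope(1)[OF M(1) less_imp_le[OF M(2)] assms(1)] ramp_slope(2)[OF less_imp_le[OF N(1)] N(2) assms(1)]
    by (simp add: smooth_count_def algebra_simps)
  moreover have "of_bool (\<exists>m::int. a \<le> x + 2 * pi * m \<and> x + 2 * pi * m \<le> b) \<le> real_of_int M - of_int N"
  proof (cases "\<exists>m::int. a \<le> x + 2 * pi * m \<and> x + 2 * pi * m \<le> b")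
    case True
    then obtain m :: int where m: "a \<le> x + 2 * pi * m" "x + 2 * pi * m \<le> b" by auto
    have "2 * pi * of_int m < 2 * pi * of_int M" using M m by linarith
    then have "m < M" by simp
    moreover have "2 * pi * (of_int N - 1) < 2 * pi * of_int m" using N m by linarith
    then have "real_of_int N - 1 < real_of_int m" by simp
    ultimately have "N + 1 \<le> M" by linarith
    then have "1 \<le> real_of_int M - real_of_int N" by linarith
    then show ?thesis using True by simp
  next
    case False
    have "2 * pi * (of_int N - 1) < 2 * pi * of_int M" using M N assms by linarith
    then have "real_of_int N - 1 < real_of_int M" by simp
    then have "N \<le> M" by linarith
    with False show ?thesis by (simp only: of_bool_def if_False)
  qed
  ultimately show ?thesis by linarith
qed

text \<open>The shifts of the window by u in (0, h] stay inside the open interval from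
  \<open>a\<close> to \<open>b\<close>, and by the length condition this interval holds at most one
  translate of \<open>x\<close>, so that a count is bounded by an indicator.\<close>

lemma smooth_count_lower:
  assumes "h > 0" "b - a \<le> 2 * pi"
  shows "smooth_count h a (b - h) x \<le> of_bool (\<exists>m::int. a < x + 2 * pi * m \<and> x + 2 * pi * m < b)"
proof -
  define M where "M = \<lfloor>(a - x) / (2 * pi)\<rfloor> + 1"
  define N where "N = \<lceil>(b - x) / (2 * pi)\<rceil>"
  have M: "2 * pi * (of_int M - 1) \<le> a - x" "a - x < 2 * pi * of_int M"
    unfolding M_def by (rule floor_bounds_2pi)+
  have N: "2 * pi * (of_int N - 1) < b - x" "b - x \<le> 2 * pi * of_int N"
    unfolding N_def by (rule ceiling_bounds_2pi)+
  have "smooth_count h a (b - h) x \<le> real_of_int N - real_of_int M"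
    using ramp_slope(1)[OF M(1) less_imp_le[OF M(2)] assms(1)] ramp_slope(2)[OF less_imp_le[OF N(1)] N(2) assms(1)]
    by (simp add: smooth_count_def algebra_simps)
  moreover have "real_of_int N - of_int M \<le> of_bool (\<exists>m::int. a < x + 2 * pi * m \<and> x + 2 * pi * m < b)"
  proof (cases "M + 1 \<le> N")
    case True
    have "2 * pi * (of_int N - 1) < 2 * pi * (of_int M + 1)"
      using M N assms by (simp add: algebra_simps)
    then have "real_of_int N - 1 < real_of_int M + 1" by simp
    then have "N \<le> M + 1" by linarith
    then have "real_of_int N - real_of_int M \<le> 1" by linarith
    moreover have "real_of_int M \<le> real_of_int N - 1" using True by linarith
    then have "2 * pi * of_int M \<le> 2 * pi * (of_int N - 1)" by (intro mult_left_mono) auto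
    then have "a < x + 2 * pi * M" "x + 2 * pi * M < b" using M N by linarith+
    ultimately show ?thesis by auto
  next
    case False
    then have "real_of_int N - real_of_int M \<le> 0" by simp
    then show ?thesis by (rule order_trans) simp
  qed
  ultimately show ?thesis by linarith
qed

text \<open>Twice the usual Fourier coefficient at \<open>k > 0\<close>: only positive frequencies
  are kept, and the real part supplies the negative ones. Summed over the points, the exponentials
  become power sums.\<close>

definition fourier_coeff :: "real \<Rightarrow> real \<Rightarrow> real \<Rightarrow> nat \<Rightarrow> complex" where
  "fourier_coeff h s t k =
     - of_real (1 / (pi * h * (real k)\<^sup>2)) * ((cis (- (real k * h)) - 1) * (cis (- (real k * t)) - cis (- (real k * s))))"

lemma dilog_limit:
  assumes "cmod w \<le> 1"
  shows "(\<lambda>K. \<Sum>k=1..K. of_real (1 / (real k)\<^sup>2) * w ^ k) \<longlonglongrightarrow> dilog w"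
proof -
  have "(\<lambda>K. \<Sum>k\<le>K. of_real (1 / (real k)\<^sup>2) * w ^ k) \<longlonglongrightarrow> dilog w"
    unfolding dilog_def by (rule summable_LIMSEQ'[OF summable_dilog[OF assms]])
  moreover have "(\<Sum>k\<le>K. of_real (1 / (real k)\<^sup>2) * w ^ k) = (\<Sum>k=1..K. of_real (1 / (real k)\<^sup>2) * w ^ k)" for K
    by (intro sum.mono_neutral_right) auto
  ultimately show ?thesis by simp
qed

text \<open>The quadratic part of \<open>ramp\<close> contributes the mean
  \<open>(t - s) / (2 * pi)\<close>, and its dilogarithms contribute the oscillating series.\<close>

lemma smooth_count_fourier:
  assumes "h > 0"
  shows "(\<lambda>K. Re (\<Sum>k=1..K. fourier_coeff h s t k * cis x ^ k)) \<longlonglongrightarrow> smooth_count h s t x - (t - s) / (2 * pi)"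
proof -
  let ?D = "\<lambda>K y. \<Sum>k=1..K. of_real (1 / (real k)\<^sup>2) * cis (x - y) ^ k"
  have sym: "Re (dilog (cis (- y))) = Re (dilog (cis y))" for y
  proof -
    have "(\<lambda>K. Re (\<Sum>k=1..K. of_real (1 / (real k)\<^sup>2) * cis (- y) ^ k)) \<longlonglongrightarrow> Re (dilog (cis (- y)))"
      by (intro tendsto_Re dilog_limit) simp
    moreover have "(\<lambda>K. Re (\<Sum>k=1..K. of_real (1 / (real k)\<^sup>2) * cis y ^ k)) \<longlonglongrightarrow> Re (dilog (cis y))"
      by (intro tendsto_Re dilog_limit) simp
    moreover have "Re (\<Sum>k=1..K. of_real (1 / (real k)\<^sup>2) * cis (- y) ^ k)
        = Re (\<Sum>k=1..K. of_real (1 / (real k)\<^sup>2) * cis y ^ k)" for K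
      unfolding Re_sum Complex.DeMoivre by simp
    ultimately show ?thesis using LIMSEQ_unique by (simp only:)
  qed
  have "(\<lambda>K. - (1 / (pi * h)) * Re (?D K (t + h) - ?D K t - (?D K (s + h) - ?D K s)))
      \<longlonglongrightarrow> - (1 / (pi * h)) * Re (dilog (cis (x - (t + h))) - dilog (cis (x - t)) - (dilog (cis (x - (s + h))) - dilog (cis (x - s))))"
    by (intro tendsto_intros dilog_limit) auto
  also have "(\<lambda>K. - (1 / (pi * h)) * Re (?D K (t + h) - ?D K t - (?D K (s + h) - ?D K s)))
      = (\<lambda>K. Re (\<Sum>k=1..K. fourier_coeff h s t k * cis x ^ k))"
  proof
    fix K
    have "fourier_coeff h s t k * cis x ^ k = of_real (- (1 / (pi * h))) *
      (of_real (1 / (real k)\<^sup>2) * cis (x - (t + h)) ^ k - of_real (1 / (real k)\<^sup>2) * cis (x - t) ^ k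
      - (of_real (1 / (real k)\<^sup>2) * cis (x - (s + h)) ^ k - of_real (1 / (real k)\<^sup>2) * cis (x - s) ^ k))" for k
    proof -
      have pw: "cis (x - y) ^ k = cis x ^ k * cis (- (real k * y))" for y
        unfolding Complex.DeMoivre cis_mult by (simp add: algebra_simps)
      have ph: "cis (- (real k * (y + h))) = cis (- (real k * y)) * cis (- (real k * h))" for y
        unfolding cis_mult by (simp add: algebra_simps)
      show ?thesis
        unfolding fourier_coeff_def pw ph by (simp add: algebra_simps)
    qed
    then have "(\<Sum>k=1..K. fourier_coeff h s t k * cis x ^ k)
      = of_real (- (1 / (pi * h))) * (?D K (t + h) - ?D K t - (?D K (s + h) - ?D K s))"
      by (simp only: sum_distrib_left[symmetric] sum_subtractf)
    moreover have "Re (of_real c * w) = c * Re w" for c w by simp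
    ultimately show "- (1 / (pi * h)) * Re (?D K (t + h) - ?D K t - (?D K (s + h) - ?D K s)) = Re (\<Sum>k=1..K. fourier_coeff h s t k * cis x ^ k)"
      by (simp only:)
  qed
  also have "- (1 / (pi * h)) * Re (dilog (cis (x - (t + h))) - dilog (cis (x - t)) - (dilog (cis (x - (s + h))) - dilog (cis (x - s))))
      = smooth_count h s t x - (t - s) / (2 * pi)"
    using sym[of "t - x + h"] sym[of "t - x"] sym[of "s - x + h"] sym[of "s - x"] assms
    unfolding smooth_count_def ramp_def by (simp add: field_simps power2_eq_square)
  finally show ?thesis .
qed

subsection \<open>Number of points in an arc\<close>

text \<open>Summation by parts against \<open>A * (2 * real k - 1)\<close>, whose partial sums are
  exactly \<open>A * (real K)\<^sup>2\<close>. The subtracted boundary term is what carries the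
  induction.\<close>

lemma sum_mult_decreasing_le:
  fixes b c :: "nat \<Rightarrow> real"
  assumes dec: "\<And>k. k \<ge> 1 \<Longrightarrow> b (Suc k) \<le> b k"
    and sum: "\<And>K. (\<Sum>k=1..K. c k) \<le> A * (real K)\<^sup>2"
  shows "(\<Sum>k=1..K. b k * c k) \<le> A * (\<Sum>k=1..K. (2 * real k - 1) * b k)
     - b K * (A * (real K)\<^sup>2 - (\<Sum>k=1..K. c k))"
proof (induction K)
  case (Suc K)
  let ?X = "A * (real K)\<^sup>2 - (\<Sum>k=1..K. c k)"
  have X: "?X \<ge> 0" using sum[of K] by simp
  have "b (Suc K) * ?X \<le> b K * ?X"
  proof (cases "K = 0")
    case False
    then show ?thesis using dec[of K] X by (intro mult_right_mono) auto
  qed simp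
  then show ?case using Suc by (simp add: algebra_simps power2_eq_square)
qed simp

text \<open>Squared coefficients in three regimes: constant up to order 1/L, then decay of order
  1/k^2 from the jumps of the indicator, and beyond order n a further factor of order n^2/k^2 from
  the smoothing.\<close>

definition fourier_bound :: "nat \<Rightarrow> real \<Rightarrow> nat \<Rightarrow> real" where
  "fourier_bound n L k = (min 1 (2 * real n / real k))\<^sup>2 * (min L (2 / real k))\<^sup>2"

lemma fourier_bound_antimono:
  assumes "L > 0" "k \<ge> 1"
  shows "fourier_bound n L (Suc k) \<le> fourier_bound n L k"
  unfolding fourier_bound_def using assms
  by (intro mult_mono power_mono min.mono order_refl divide_left_mono) auto

text \<open>Both parts telescope: up to \<open>n\<close> each term is at most 8 times an increment
  of \<open>ln (1 + k * L)\<close>, beyond \<open>n\<close> at most 16 times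
  \<open>n / (k - 1) - n / k\<close>. The \<open>min\<close> and \<open>max\<close> freeze the part
  that is not active.\<close>

lemma sum_fourier_bound_le:
  assumes L: "L > 0" and n: "n \<ge> 1"
  shows "(\<Sum>k=1..K. real k * fourier_bound n L k)
    \<le> 8 * ln (1 + real (min K n) * L) + 16 * (1 - real n / real (max K n))"
proof (induction K)
  case 0
  then show ?case using n by simp
next
  case (Suc K)
  define k where "k = real (Suc K)"
  have k: "k \<ge> 1" by (simp add: k_def)
  have "k * fourier_bound n L (Suc K) \<le> 8 * (ln (1 + k * L) - ln (1 + real K * L))" (is "?l \<le> _") if "Suc K \<le> n"
  proof -
    have p: "1 + k * L > 0" "1 + real K * L > 0" using L k by (auto intro: add_pos_nonneg)
    have "ln ((1 + real K * L) / (1 + k * L)) \<le> (1 + real K * L) / (1 + k * L) - 1"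
      using p by (intro ln_le_minus_one) auto
    also have "\<dots> = - (L / (1 + k * L))"
      using p by (simp add: field_simps k_def)
    finally have "L / (1 + k * L) \<le> ln (1 + k * L) - ln (1 + real K * L)"
      using p by (simp add: ln_div)
    then have step: "8 * (L / (1 + k * L)) \<le> 8 * (ln (1 + k * L) - ln (1 + real K * L))"
      by (rule mult_left_mono) simp
    have "?l \<le> 8 * (L / (1 + k * L))"
    proof (cases "k * L \<le> 1")
      case True
      have "fourier_bound n L (Suc K) \<le> 1\<^sup>2 * L\<^sup>2"
        unfolding fourier_bound_def using L by (intro mult_mono power_mono) auto
      then have "?l \<le> k * L\<^sup>2" using k by simp
      also have "\<dots> = (k * L) * L" by (simp add: power2_eq_square)
      also have "\<dots> \<le> 1 * L" using True L by (intro mult_right_mono) auto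
      also have "\<dots> \<le> 8 * (L / (1 + k * L))" using True L p by (simp add: field_simps)
      finally show ?thesis .
    next
      case False
      have "fourier_bound n L (Suc K) \<le> 1\<^sup>2 * (2 / k)\<^sup>2"
        unfolding fourier_bound_def k_def[symmetric] using L k by (intro mult_mono power_mono) auto
      then have "?l \<le> k * (2 / k)\<^sup>2" using k by simp
      also have "\<dots> = 4 / k" using k by (simp add: power2_eq_square)
      \<comment> \<open>Here \<open>1 + k * L < 2 * (k * L)\<close>; this case is the origin of the
        factor 8.\<close>
      also have "\<dots> \<le> 8 * (L / (1 + k * L))" using False k p by (simp add: field_simps)
      finally show ?thesis .
    qed
    then show ?thesis using step by (rule order_trans)
  qed
  moreover have "?l \<le> 16 * (real n / real K - real n / k)" if "n < Suc K"
  proof -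
    have K: "real K \<ge> 1" "real n \<le> k" using that n by (auto simp: k_def)
    have "fourier_bound n L (Suc K) \<le> (2 * real n / k)\<^sup>2 * (2 / k)\<^sup>2"
      unfolding fourier_bound_def k_def[symmetric] using L k by (intro mult_mono power_mono) auto
    then have "?l \<le> k * ((2 * real n / k)\<^sup>2 * (2 / k)\<^sup>2)" using k by simp
    also have "\<dots> = 16 * real n * (real n / k) / k\<^sup>2" using k by (simp add: power2_eq_square)
    also have "\<dots> \<le> 16 * real n * 1 / k\<^sup>2"
      using K k by (intro divide_right_mono mult_left_mono) auto
    also have "\<dots> \<le> 16 * real n / (real K * k)"
      using K k by (intro frac_le) (auto simp: power2_eq_square k_def)
    also have "\<dots> = 16 * (real n / real K - real n / k)"
      using K k by (simp add: k_def field_simps)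
    finally show ?thesis .
  qed
  moreover have "min K n = n \<and> max K n = K \<and> min (Suc K) n = n \<and> max (Suc K) n = Suc K" if "n < Suc K"
    using that by auto
  moreover have "min K n = K \<and> max K n = n \<and> min (Suc K) n = Suc K \<and> max (Suc K) n = n" if "Suc K \<le> n"
    using that by auto
  ultimately show ?case
    using Suc by (cases "Suc K \<le> n") (auto simp: k_def)
qed

lemma cmod_cis_diff_le_2: "cmod (cis a - cis b) \<le> 2"
  using norm_triangle_ineq4[of "cis a" "cis b"] by simp

lemma norm_fourier_coeff_le:
  assumes h: "h = 1 / real n" and n: "n \<ge> 1" and k: "k \<ge> 1" and L: "\<bar>t - s\<bar> \<le> L"
  shows "(cmod (fourier_coeff h s t k))\<^sup>2 \<le> fourier_bound n L k"
proof -
  let ?k = "real k"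
  have pos: "h > 0" "?k > 0" using n k by (auto simp: h)
  have 1: "cmod (cis (- (?k * h)) - 1) \<le> min 2 (?k * h)"
    using cmod_cis_diff_le[of "- (?k * h)" 0] cmod_cis_diff_le_2[of "- (?k * h)" 0] pos by simp
  have "\<bar>- (?k * t) - - (?k * s)\<bar> = ?k * \<bar>t - s\<bar>"
  proof -
    have "- (?k * t) - - (?k * s) = ?k * - (t - s)" by (simp add: algebra_simps)
    then show ?thesis by (simp only: abs_mult abs_minus_cancel abs_of_nat)
  qed
  also have "\<dots> \<le> ?k * L" using L by (intro mult_left_mono) auto
  finally have 2: "cmod (cis (- (?k * t)) - cis (- (?k * s))) \<le> min 2 (?k * L)"
    using cmod_cis_diff_le[of "- (?k * t)" "- (?k * s)"] cmod_cis_diff_le_2[of "- (?k * t)" "- (?k * s)"] by simp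
  have L0: "L \<ge> 0" using L by linarith
  have "cmod (fourier_coeff h s t k) = 1 / (pi * h * ?k\<^sup>2) * (cmod (cis (- (?k * h)) - 1) * cmod (cis (- (?k * t)) - cis (- (?k * s))))"
    unfolding fourier_coeff_def using pos by (simp add: norm_mult norm_divide norm_power)
  also have "\<dots> \<le> 1 / (1 * h * ?k\<^sup>2) * (min 2 (?k * h) * min 2 (?k * L))"
    using pos 1 2 pi_ge_two L0 by (intro mult_mono frac_le) (auto intro!: mult_nonneg_nonneg)
  also have "\<dots> = (min 2 (?k * h) / (?k * h)) * (min 2 (?k * L) / ?k)"
    using pos by (simp add: power2_eq_square)
  also have "min 2 (?k * h) / (?k * h) = min 1 (2 * real n / ?k)"
    using pos n by (auto simp: min_def h field_simps)
  also have "min 2 (?k * L) / ?k = min L (2 / ?k)"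
    using pos by (auto simp: min_def field_simps)
  finally have "cmod (fourier_coeff h s t k) \<le> min 1 (2 * real n / ?k) * min L (2 / ?k)" .
  then have "(cmod (fourier_coeff h s t k))\<^sup>2 \<le> (min 1 (2 * real n / ?k) * min L (2 / ?k))\<^sup>2"
    by (intro power_mono) auto
  then show ?thesis unfolding fourier_bound_def by (simp add: power_mult_distrib)
qed

text \<open>Crude and not uniform in \<open>h\<close>, but summable in \<open>k\<close>: it serves
  as the majorant for the convergence of the Fourier series at fixed \<open>h\<close>.\<close>

lemma norm_fourier_coeff_le':
  assumes "h > 0"
  shows "cmod (fourier_coeff h s t k) \<le> 4 / (pi * h) * (1 / (real k)\<^sup>2)"
proof -
  have "cmod (fourier_coeff h s t k) = 1 / (pi * h * (real k)\<^sup>2) * (cmod (cis (- (real k * h)) - cis 0) * cmod (cis (- (real k * t)) - cis (- (real k * s))))"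
    unfolding fourier_coeff_def using assms by (simp add: norm_mult norm_divide norm_power)
  also have "\<dots> \<le> 1 / (pi * h * (real k)\<^sup>2) * (2 * 2)"
    using assms by (intro mult_left_mono mult_mono cmod_cis_diff_le_2) auto
  finally show ?thesis by simp
qed

text \<open>The power sums contribute 8 times \<open>resolvent_constant\<close>, replacing
  \<open>2 * k - 1\<close> by \<open>2 * k\<close> a factor 2, and the sum of the Fourier bounds the
  factor 32.\<close>

definition count_constant :: "real \<Rightarrow> real" where
  "count_constant \<beta> = 16 * resolvent_constant \<beta> * 32"

lemma fourier_moment_le:
  assumes \<beta>: "\<beta> > 0" and n: "n \<ge> 1" and h: "h = 1 / real n" and l: "l \<ge> 0" and ts: "\<bar>t - s\<bar> \<le> l + h"
  shows "(\<Sum>k=1..K. (cmod (fourier_coeff h s t k))\<^sup>2 * power_sum_moment \<beta> n k)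
    \<le> count_constant \<beta> * ln (2 + real n * l)"
proof -
  \<comment> \<open>Adding \<open>h\<close> keeps \<open>L\<close> positive for a degenerate arc,
    and \<open>real n * L\<close> is just \<open>1 + real n * l\<close>.\<close>
  define L where "L = l + h"
  have L: "L > 0" using l n by (simp add: L_def h add_nonneg_pos)
  let ?b = "fourier_bound n L"
  define A where "A = 8 * resolvent_constant \<beta>"
  have A: "A \<ge> 0" using resolvent_constant_pos[OF \<beta>] by (simp add: A_def)
  have b0: "?b k \<ge> 0" for k by (simp add: fourier_bound_def)
  have "(\<Sum>k=1..K. (cmod (fourier_coeff h s t k))\<^sup>2 * power_sum_moment \<beta> n k)
     \<le> (\<Sum>k=1..K. ?b k * power_sum_moment \<beta> n k)"
    using norm_fourier_coeff_le[OF h n _ ts] by (intro sum_mono mult_right_mono power_sum_moment_nonneg) (auto simp: L_def)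
  also have "\<dots> \<le> A * (\<Sum>k=1..K. (2 * real k - 1) * ?b k) - ?b K * (A * (real K)\<^sup>2 - (\<Sum>k=1..K. power_sum_moment \<beta> n k))"
    unfolding A_def using sum_power_sum_moment_le[OF \<beta>, of n] n
    by (intro sum_mult_decreasing_le fourier_bound_antimono L) auto
  also have "\<dots> \<le> A * (\<Sum>k=1..K. (2 * real k - 1) * ?b k)"
    using sum_power_sum_moment_le[OF \<beta>, of n K] n b0[of K] by (simp add: A_def)
  also have "\<dots> \<le> A * (2 * (\<Sum>k=1..K. real k * ?b k))"
    unfolding sum_distrib_left using b0 by (intro mult_left_mono[OF _ A] sum_mono) (simp add: algebra_simps)
  also have "\<dots> \<le> A * (2 * (32 * ln (2 + real n * l)))"
  proof (intro mult_left_mono A)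
    have "(\<Sum>k=1..K. real k * ?b k) \<le> 8 * ln (1 + real (min K n) * L) + 16 * (1 - real n / real (max K n))"
      by (rule sum_fourier_bound_le[OF L n])
    also have "\<dots> \<le> 8 * ln (2 + real n * l) + 16 * 1"
    proof (intro add_mono mult_left_mono)
      have "real (min K n) * L \<le> real n * L" using L by (intro mult_right_mono) auto
      also have "real n * L = 1 + real n * l" using n by (simp add: L_def h field_simps)
      finally show "ln (1 + real (min K n) * L) \<le> ln (2 + real n * l)"
        using L by (intro ln_mono) (auto intro: add_pos_nonneg)
    qed auto
    \<comment> \<open>The contribution of the frequencies above \<open>n\<close> is absorbed using
      \<open>2 / 3 \<le> ln 2\<close>; then 8 + 24 = 32.\<close>
    also have "16 * 1 \<le> 24 * ln (2 + real n * l)"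
    proof -
      have "2 / 3 \<le> ln (2::real)" using ln2_ge_two_thirds .
      also have "ln 2 \<le> ln (2 + real n * l)" using l by (intro ln_mono) auto
      finally show ?thesis by simp
    qed
    finally show "(\<Sum>k=1..K. real k * ?b k) \<le> 32 * ln (2 + real n * l)" by simp
  qed auto
  also have "\<dots> = count_constant \<beta> * ln (2 + real n * l)" by (simp add: A_def count_constant_def)
  finally show ?thesis .
qed

section \<open>Second moment of the smoothed count\<close>

lemma borel_measurable_Arg [measurable]: "Arg \<in> borel_measurable borel"
proof -
  have "Arg = (\<lambda>z. if z = 0 then 0 else if z \<in> \<real>\<^sub>\<le>\<^sub>0 then pi else Arg z)"
  proof
    fix z
    show "Arg z = (if z = 0 then 0 else if z \<in> \<real>\<^sub>\<le>\<^sub>0 then pi else Arg z)"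
    proof (cases "z = 0")
      case False
      then have "z \<in> \<real>\<^sub>\<le>\<^sub>0 \<Longrightarrow> Re z < 0 \<and> Im z = 0"
        by (auto simp: complex_nonpos_Reals_iff complex_eq_iff)
      with False show ?thesis using Arg_eq_pi[of z] by auto
    qed (simp add: Arg_zero)
  qed
  moreover have "(\<lambda>z. if z \<in> \<real>\<^sub>\<le>\<^sub>0 then pi else Arg z) \<in> borel_measurable borel"
    by (rule borel_measurable_continuous_on_if)
       (auto intro!: borel_closed closed_nonpos_Reals_complex continuous_at_imp_continuous_on continuous_at_Arg)
  then have "(\<lambda>z. if z = 0 then 0 else if z \<in> \<real>\<^sub>\<le>\<^sub>0 then pi else Arg z) \<in> borel_measurable borel"
    by measurable
  ultimately show ?thesis by simp
qed

lemma borel_measurable_ramp [measurable]: "ramp \<in> borel_measurable borel"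
proof (rule borel_measurable_continuous_onI)
  have "continuous_on UNIV (\<lambda>y. dilog (cis y))"
    by (rule continuous_on_compose2[OF continuous_on_dilog]) (auto intro!: continuous_intros)
  then show "continuous_on UNIV ramp"
    unfolding ramp_def[abs_def] by (intro continuous_intros) auto
qed

text \<open>A truncated Fourier series summed over the points is a linear combination of power sums,
  and by orthogonality its second moment has no cross terms. Absolute summability of the
  coefficients at fixed \<open>h\<close> bounds all truncations and justifies the limit.\<close>

lemma smooth_count_second_moment:
  assumes \<beta>: "\<beta> > 0" and n: "n \<ge> 1" and h: "h = 1 / real n" and l: "l \<ge> 0" and ts: "\<bar>t - s\<bar> \<le> l + h"
  defines "W \<equiv> \<lambda>z. \<Sum>j<n. smooth_count h s t (Arg (z j)) - (t - s) / (2 * pi)"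
  shows "integrable (cbe \<beta> n) (\<lambda>z. (W z)\<^sup>2)"
    and "(\<integral>z. (W z)\<^sup>2 \<partial>cbe \<beta> n) \<le> count_constant \<beta> * ln (2 + real n * l)"
proof -
  interpret prob_space "cbe \<beta> n" using \<beta> by (rule prob_space_cbe)
  have h0: "h > 0" using n by (simp add: h)
  let ?S = "\<lambda>K z. \<Sum>k=1..K. fourier_coeff h s t k * power_sum n k z"
  have swap: "?S K z = (\<Sum>j<n. \<Sum>k=1..K. fourier_coeff h s t k * z j ^ k)" for K z
    unfolding power_sum_def sum_distrib_left by (rule sum.swap)
  define B where "B = real n * (\<Sum>k. 4 / (pi * h) * (1 / (real k)\<^sup>2))"
  have S_le: "cmod (?S K z) \<le> B" if z: "on_torus n z" for K z
  proof -
    have "cmod (?S K z) \<le> (\<Sum>k=1..K. real n * (4 / (pi * h) * (1 / (real k)\<^sup>2)))"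
    proof (intro sum_norm_le)
      fix k
      have "cmod (fourier_coeff h s t k) * cmod (power_sum n k z) \<le> (4 / (pi * h) * (1 / (real k)\<^sup>2)) * real n"
        using h0 by (intro mult_mono norm_fourier_coeff_le' norm_power_sum_le z) auto
      then show "cmod (fourier_coeff h s t k * power_sum n k z) \<le> real n * (4 / (pi * h) * (1 / (real k)\<^sup>2))"
        by (simp add: norm_mult mult_ac)
    qed
    also have "\<dots> \<le> B"
      unfolding B_def sum_distrib_left[of "real n", symmetric] using h0
      by (intro mult_left_mono sum_le_suminf summable_mult summable_inverse_square)
         (auto intro!: divide_nonneg_nonneg)
    finally show ?thesis .
  qed
  have lim: "(\<lambda>K. Re (?S K z)) \<longlonglongrightarrow> W z" if z: "on_torus n z" for z
  proof -
    have "(\<lambda>K. \<Sum>j<n. Re (\<Sum>k=1..K. fourier_coeff h s t k * cis (Arg (z j)) ^ k)) \<longlonglongrightarrow> W z"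
      unfolding W_def by (intro tendsto_sum smooth_count_fourier h0)
    also have "(\<lambda>K. \<Sum>j<n. Re (\<Sum>k=1..K. fourier_coeff h s t k * cis (Arg (z j)) ^ k)) = (\<lambda>K. Re (?S K z))"
    proof
      fix K
      have "cis (Arg (z j)) = z j" if "j < n" for j
        using that z rcis_cmod_Arg[of "z j"] by (simp add: rcis_def)
      then show "(\<Sum>j<n. Re (\<Sum>k=1..K. fourier_coeff h s t k * cis (Arg (z j)) ^ k)) = Re (?S K z)"
        unfolding swap Re_sum[symmetric] by (intro arg_cong[where f=Re] sum.cong refl) auto
    qed
    finally show ?thesis .
  qed
  have meas: "(\<lambda>z. (W z)\<^sup>2) \<in> borel_measurable (cbe \<beta> n)"
    unfolding W_def smooth_count_def by measurable
  have sq: "(Re (?S K z))\<^sup>2 \<le> (cmod (?S K z))\<^sup>2" for K z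
    using abs_Re_le_cmod[of "?S K z"] by (metis abs_ge_zero power2_abs power_mono)
  have bnd: "AE z in cbe \<beta> n. norm ((Re (?S K z))\<^sup>2) \<le> B\<^sup>2" for K
    using AE_cbe_norm[OF \<beta>]
  proof eventually_elim
    case (elim z)
    have "(cmod (?S K z))\<^sup>2 \<le> B\<^sup>2" using S_le[OF elim] by (intro power_mono) auto
    from order_trans[OF sq this] show ?case by simp
  qed
  have lim2: "AE z in cbe \<beta> n. (\<lambda>K. (Re (?S K z))\<^sup>2) \<longlonglongrightarrow> (W z)\<^sup>2"
    using AE_cbe_norm[OF \<beta>] by eventually_elim (intro tendsto_power lim)
  have measS: "(\<lambda>z. (Re (?S K z))\<^sup>2) \<in> borel_measurable (cbe \<beta> n)" for K
    by measurable
  show "integrable (cbe \<beta> n) (\<lambda>z. (W z)\<^sup>2)"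
    by (rule integrable_dominated_convergence[OF meas measS _ lim2 bnd]) auto
  have lim3: "(\<lambda>K. \<integral>z. (Re (?S K z))\<^sup>2 \<partial>cbe \<beta> n) \<longlonglongrightarrow> (\<integral>z. (W z)\<^sup>2 \<partial>cbe \<beta> n)"
    by (rule integral_dominated_convergence[OF meas measS _ lim2 bnd]) auto
  have "(\<integral>z. (Re (?S K z))\<^sup>2 \<partial>cbe \<beta> n) \<le> count_constant \<beta> * ln (2 + real n * l)" for K
  proof -
    have "(\<integral>z. (Re (?S K z))\<^sup>2 \<partial>cbe \<beta> n) \<le> (\<integral>z. (cmod (?S K z))\<^sup>2 \<partial>cbe \<beta> n)"
    proof (rule integral_mono_AE)
      show "integrable (cbe \<beta> n) (\<lambda>z. (Re (?S K z))\<^sup>2)"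
        by (rule integrable_const_bound[OF bnd measS])
      show "integrable (cbe \<beta> n) (\<lambda>z. (cmod (?S K z))\<^sup>2)"
        using S_le by (intro integrable_cbe_bounded[OF \<beta>, where B="B\<^sup>2"]) (auto intro!: power_mono)
    qed (use sq in auto)
    also have "\<dots> \<le> count_constant \<beta> * ln (2 + real n * l)"
      unfolding integral_square_sum_power_sum[OF \<beta>] by (rule fourier_moment_le[OF \<beta> n h l ts])
    finally show ?thesis .
  qed
  then show "(\<integral>z. (W z)\<^sup>2 \<partial>cbe \<beta> n) \<le> count_constant \<beta> * ln (2 + real n * l)"
    by (intro LIMSEQ_le_const2[OF lim3]) blast
qed

text \<open>The variance is the smallest second moment about a constant, so any convenient centre
  \<open>c\<close> may replace the mean.\<close>

lemma variance_at_mostI: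
  assumes "prob_space M" and X: "X \<in> borel_measurable M" "integrable M (\<lambda>x. (X x)\<^sup>2)"
    and c: "(\<integral>x. (X x - c)\<^sup>2 \<partial>M) \<le> B"
  shows "variance_at_most M X B"
proof -
  interpret prob_space M by fact
  have int: "integrable M X" by (rule square_integrable_imp_integrable[OF X])
  have "(\<integral>x. (X x - c)\<^sup>2 \<partial>M) = (\<integral>x. (X x)\<^sup>2 - 2 * c * X x + c\<^sup>2 \<partial>M)"
    by (simp add: power2_eq_square algebra_simps)
  also have "\<dots> = expectation (\<lambda>x. (X x)\<^sup>2) - 2 * c * expectation X + c\<^sup>2"
    using int X by (simp add: prob_space)
  also have "\<dots> = variance X + (expectation X - c)\<^sup>2"
    unfolding variance_eq[OF int X(2)] by (simp add: power2_eq_square algebra_simps)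
  finally have "variance X \<le> B" using c zero_le_power2[of "expectation X - c"] by linarith
  with int X show ?thesis by (simp add: variance_at_most_def)
qed

section \<open>Counting the points in an arc\<close>

lemma cis_eq_iff: "cis x = cis y \<longleftrightarrow> (\<exists>m::int. y = x + 2 * pi * m)"
  using sin_cos_eq_iff[of y x] by (auto simp: complex_eq_iff)

lemma card_cbe_points_Int:
  assumes "inj_on z {..<n}"
  shows "real (card (cbe_points n z \<inter> I)) = (\<Sum>j<n. of_bool (z j \<in> I))"
proof -
  have "cbe_points n z \<inter> I = z ` {j \<in> {..<n}. z j \<in> I}"
    by (auto simp: cbe_points_def)
  also have "card \<dots> = card {j \<in> {..<n}. z j \<in> I}"
    by (rule card_image) (rule inj_on_subset[OF assms], auto)
  also have "real \<dots> = (\<Sum>j<n. of_bool (z j \<in> I))"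
    by (simp add: sum.If_cases of_bool_def Int_def)
  finally show ?thesis .
qed

lemma card_cbe_points_le: "card (cbe_points n z \<inter> I) \<le> n"
proof -
  have "card (cbe_points n z \<inter> I) \<le> card (cbe_points n z)"
    unfolding cbe_points_def by (intro card_mono) auto
  also have "\<dots> \<le> n" using card_image_le[of "{..<n}" z] by (simp add: cbe_points_def)
  finally show ?thesis .
qed

lemma prod_of_bool_neq:
  fixes n :: nat
  shows "(\<Prod>j<n. of_bool (z j \<noteq> w)) = (of_bool (w \<notin> z ` {..<n}) :: 'a::comm_semiring_1)"
proof (cases "w \<in> z ` {..<n}")
  case True
  then obtain j where "j < n" "z j = w" by auto
  then have "(\<Prod>j<n. of_bool (z j \<noteq> w)) = (0::'a)" by (intro prod_zero bexI[of _ j]) auto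
  then show ?thesis using True by simp
next
  case False
  then have "z j \<noteq> w" if "j < n" for j using that by (metis image_eqI lessThan_iff)
  then have "(\<Prod>j<n. of_bool (z j \<noteq> w)) = (\<Prod>j<n. 1::'a)" by (intro prod.cong) auto
  then show ?thesis using False by simp
qed

text \<open>Counting a repeated point at its first occurrence serves to make the count measurable in \<open>z\<close>.\<close>

lemma card_cbe_points_Int_first:
  "real (card (cbe_points n z \<inter> I)) = (\<Sum>k<n. of_bool (z k \<in> I) * (\<Prod>j<k. of_bool (z j \<noteq> z k)))"
proof (induction n)
  case (Suc n)
  have "cbe_points (Suc n) z \<inter> I = (if z n \<in> I then insert (z n) (cbe_points n z \<inter> I) else cbe_points n z \<inter> I)"
    by (auto simp: cbe_points_def lessThan_Suc)
  then have "real (card (cbe_points (Suc n) z \<inter> I)) = real (card (cbe_points n z \<inter> I)) + of_bool (z n \<in> I) * of_bool (z n \<notin> z ` {..<n})"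
    by (auto simp: cbe_points_def card_insert_if)
  then show ?case using Suc by (simp add: prod_of_bool_neq)
qed (simp add: cbe_points_def)

lemma borel_measurable_card_cbe_points:
  assumes "I \<in> sets borel"
  shows "(\<lambda>z. real (card (cbe_points n z \<inter> I))) \<in> borel_measurable (cbe \<beta> n)"
  unfolding card_cbe_points_Int_first
proof (intro borel_measurable_sum borel_measurable_times borel_measurable_prod)
  fix k assume k: "k \<in> {..<n}"
  have [measurable]: "I \<in> sets borel" by fact
  have "(\<lambda>y. of_bool (y \<in> I)) \<in> borel_measurable borel"
    unfolding of_bool_def by measurable
  from measurable_compose[OF borel_measurable_cbe_component this, of k n \<beta>] k
  show "(\<lambda>z. of_bool (z k \<in> I)) \<in> borel_measurable (cbe \<beta> n)"
    by simp
  fix j assume "j \<in> {..<k}"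
  then have jk: "j < n" "k < n" using k by auto
  have "(\<lambda>z. z j - z k) \<in> borel_measurable (cbe \<beta> n)"
    using jk by (intro borel_measurable_diff borel_measurable_cbe_component)
  moreover have "(\<lambda>y :: complex. of_bool (y \<noteq> 0)) \<in> borel_measurable borel"
    unfolding of_bool_def by measurable
  ultimately have "(\<lambda>z. of_bool (z j - z k \<noteq> 0)) \<in> borel_measurable (cbe \<beta> n)"
    by (rule measurable_compose)
  then show "(\<lambda>z. of_bool (z j \<noteq> z k)) \<in> borel_measurable (cbe \<beta> n)"
    by simp
qed

text \<open>Squeezing \<open>J\<close> between the open and the closed interval treats all kinds of
  endpoints at once, including a single point and the empty arc; the length condition keeps
  \<open>cis\<close> from winding around more than once.\<close>

locale arc =
  fixes a b :: real and J :: "real set"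
  assumes ab: "a \<le> b" "b - a \<le> 2 * pi" and J: "{a<..<b} \<subseteq> J" "J \<subseteq> {a..b}"
begin

lemma borel_arc: "cis ` J \<in> sets borel"
proof -
  have "cis ` J = cis ` {a..b} - (cis ` {a..b} - cis ` J)" using J by auto
  moreover have "cis ` {a..b} \<in> sets borel"
    by (intro borel_compact compact_continuous_image continuous_intros) auto
  moreover have "cis ` {a..b} - cis ` J \<subseteq> {cis a, cis b}"
  proof
    fix w assume w: "w \<in> cis ` {a..b} - cis ` J"
    then obtain x where x: "w = cis x" "a \<le> x" "x \<le> b" by auto
    with w have "x \<notin> J" by blast
    then have "x \<notin> {a<..<b}" using J by auto
    then show "w \<in> {cis a, cis b}" using x by auto
  qed
  then have "finite (cis ` {a..b} - cis ` J)" by (rule finite_subset) simp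
  then have "cis ` {a..b} - cis ` J \<in> sets borel" by (intro borel_closed finite_imp_closed)
  ultimately show ?thesis by (metis sets.Diff)
qed

text \<open>An inequality is enough because the variance bound increases with the length. After a
  shift by a multiple of \<open>2 * pi\<close>, the preimage of the arc in
  \<open>{0..<2 * pi}\<close> contains two disjoint open intervals: the part before
  \<open>2 * pi\<close> and the part that wraps around.\<close>

lemma length_le_measure_arc: "b - a \<le> measure circle_measure (cis ` J)"
proof -
  define q where "q = \<lfloor>a / (2 * pi)\<rfloor>"
  define c where "c = a - 2 * pi * of_int q"
  define d where "d = b - 2 * pi * of_int q"
  have c: "0 \<le> c" "c < 2 * pi"
    using floor_bounds_2pi[of a] by (simp_all add: c_def q_def algebra_simps)
  have cd: "c \<le> d" "d - c = b - a" "d \<le> c + 2 * pi" using ab by (auto simp: c_def d_def)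
  let ?S = "{t \<in> {0..<2 * pi}. cis t \<in> cis ` J}"
  have in_arc: "cis t \<in> cis ` J" if "t + 2 * pi * of_int m \<in> {a<..<b}" for t m
    using that J cis_eq_iff[of t "t + 2 * pi * of_int m"] by (intro image_eqI[of _ _ "t + 2 * pi * of_int m"]) auto
  have A1: "{c<..<min d (2 * pi)} \<subseteq> ?S"
  proof
    fix t assume t: "t \<in> {c<..<min d (2 * pi)}"
    then have "t + 2 * pi * of_int q \<in> {a<..<b}" by (auto simp: c_def d_def)
    then show "t \<in> ?S" using in_arc t c by auto
  qed
  have A2: "{0<..<d - 2 * pi} \<subseteq> ?S"
  proof
    fix t assume t: "t \<in> {0<..<d - 2 * pi}"
    then have "t + 2 * pi * of_int (q + 1) \<in> {a<..<b}" using c by (auto simp: c_def d_def algebra_simps)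
    then have "cis t \<in> cis ` J" by (rule in_arc)
    then show "t \<in> ?S" using t cd c by auto
  qed
  have S: "?S \<in> sets borel" by (rule borel_cis_preimage[OF borel_arc])
  have disj: "{c<..<min d (2 * pi)} \<inter> {0<..<d - 2 * pi} = {}" using cd by auto
  have "ennreal (b - a) \<le> emeasure lborel {c<..<min d (2 * pi)} + emeasure lborel {0<..<d - 2 * pi}"
  proof (cases "d \<le> 2 * pi")
    case True then show ?thesis using cd by (simp add: min_def)
  next
    case False
    then show ?thesis using cd c by (simp add: min_def ennreal_plus[symmetric] del: ennreal_plus)
  qed
  also have "\<dots> = emeasure lborel ({c<..<min d (2 * pi)} \<union> {0<..<d - 2 * pi})"
    using disj by (intro plus_emeasure) auto
  also have "\<dots> \<le> emeasure lborel ?S" using A1 A2 S by (intro emeasure_mono) auto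
  also have "\<dots> = emeasure circle_measure (cis ` J)" by (rule emeasure_circle_measure[OF borel_arc, symmetric])
  also have "\<dots> = ennreal (measure circle_measure (cis ` J))" by (rule circle.emeasure_eq_measure)
  finally show ?thesis by (simp add: ennreal_le_iff)
qed

lemma integrable_count_diff_square:
  assumes \<beta>: "\<beta> > 0"
  shows "integrable (cbe \<beta> n) (\<lambda>z. (real (card (cbe_points n z \<inter> cis ` J)) - c)\<^sup>2)" (is "integrable _ (\<lambda>z. (?X z - c)\<^sup>2)")
proof (rule integrable_cbe_bounded[OF \<beta>, where B="(real n + \<bar>c\<bar>)\<^sup>2"])
  fix z
  have "0 \<le> ?X z" "?X z \<le> real n" using card_cbe_points_le[of n z "cis ` J"] by auto
  then have "\<bar>?X z - c\<bar> \<le> real n + \<bar>c\<bar>" by linarith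
  then show "norm ((?X z - c)\<^sup>2) \<le> (real n + \<bar>c\<bar>)\<^sup>2" using power_mono[of "\<bar>?X z - c\<bar>" _ 2] by simp
qed (use borel_measurable_card_cbe_points[OF borel_arc] in measurable)

text \<open>With \<open>h = 1 / n\<close>, widening or shrinking the arc to the windows of the
  smoothed counts moves the mean by only \<open>1 / (2 * pi)\<close>. The deviation of the count is
  therefore at most the sum of the two smoothed deviations plus 1.\<close>

lemma count_second_moment:
  assumes \<beta>: "\<beta> > 0" and n: "n \<ge> 1"
  defines "X \<equiv> \<lambda>z. real (card (cbe_points n z \<inter> cis ` J))"
  shows "(\<integral>z. (X z - real n * (b - a) / (2 * pi))\<^sup>2 \<partial>cbe \<beta> n)
     \<le> (6 * count_constant \<beta> + 6) * ln (2 + real n * (b - a))"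
proof -
  interpret prob_space "cbe \<beta> n" using \<beta> by (rule prob_space_cbe)
  define h where "h = 1 / real n"
  have h: "h > 0" using n by (simp add: h_def)
  let ?W = "\<lambda>s t z. \<Sum>j<n. smooth_count h s t (Arg (z j)) - (t - s) / (2 * pi)"
  let ?c = "real n * (b - a) / (2 * pi)"
  let ?L = "ln (2 + real n * (b - a))"
  have l: "b - a \<ge> 0" using ab by simp
  have ts1: "\<bar>b - (a - h)\<bar> \<le> (b - a) + h" "\<bar>(b - h) - a\<bar> \<le> (b - a) + h" using ab h by auto
  note W1 = smooth_count_second_moment[OF \<beta> n h_def l ts1(1)]
  note W2 = smooth_count_second_moment[OF \<beta> n h_def l ts1(2)]
  have "AE z in cbe \<beta> n. (X z - ?c)\<^sup>2 \<le> 3 * ((?W (a - h) b z)\<^sup>2 + (?W a (b - h) z)\<^sup>2 + 1)"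
    using AE_cbe_norm[OF \<beta>, of n] AE_cbe_inj[OF \<beta>, of n]
  proof eventually_elim
    fix z :: "nat \<Rightarrow> complex" assume z: "on_torus n z" "inj_on z {..<n}"
    have zj: "z j = cis (Arg (z j))" if "j < n" for j
      using that z rcis_cmod_Arg[of "z j"] by (simp add: rcis_def)
    have X: "X z = (\<Sum>j<n. of_bool (z j \<in> cis ` J))"
      unfolding X_def by (rule card_cbe_points_Int[OF z(2)])
    have sumW: "(\<Sum>j<n. smooth_count h s t (Arg (z j))) = ?W s t z + real n * (t - s) / (2 * pi)" for s t
      by (simp add: sum_subtractf)
    have "X z \<le> (\<Sum>j<n. smooth_count h (a - h) b (Arg (z j)))"
      unfolding X
    proof (intro sum_mono)
      fix j assume "j \<in> {..<n}"
      then have zc: "z j = cis (Arg (z j))" by (intro zj) simp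
      have "\<exists>m::int. a \<le> Arg (z j) + 2 * pi * m \<and> Arg (z j) + 2 * pi * m \<le> b" if "z j \<in> cis ` J"
      proof -
        from that obtain y where y: "z j = cis y" "y \<in> J" by blast
        with zc obtain m :: int where "y = Arg (z j) + 2 * pi * m" using cis_eq_iff[of "Arg (z j)" y] by auto
        with y(2) J(2) show ?thesis by (intro exI[of _ m]) auto
      qed
      then have "of_bool (z j \<in> cis ` J) \<le> (of_bool (\<exists>m::int. a \<le> Arg (z j) + 2 * pi * m \<and> Arg (z j) + 2 * pi * m \<le> b) :: real)"
        by (simp only: of_bool_def) simp
      also have "\<dots> \<le> smooth_count h (a - h) b (Arg (z j))"
        by (rule smooth_count_upper[OF h ab(1)])
      finally show "of_bool (z j \<in> cis ` J) \<le> smooth_count h (a - h) b (Arg (z j))" .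
    qed
    also have "\<dots> = ?W (a - h) b z + ?c + 1 / (2 * pi)"
      unfolding sumW using n by (simp add: h_def field_simps)
    finally have up: "X z - ?c \<le> ?W (a - h) b z + 1 / (2 * pi)" by simp
    have "(\<Sum>j<n. smooth_count h a (b - h) (Arg (z j))) \<le> X z"
      unfolding X
    proof (intro sum_mono)
      fix j assume "j \<in> {..<n}"
      then have zc: "z j = cis (Arg (z j))" by (intro zj) simp
      have "z j \<in> cis ` J" if m: "a < Arg (z j) + 2 * pi * of_int m" "Arg (z j) + 2 * pi * of_int m < b" for m
      proof -
        have "cis (Arg (z j)) = cis (Arg (z j) + 2 * pi * of_int m)" unfolding cis_eq_iff by auto
        with zc have "z j = cis (Arg (z j) + 2 * pi * of_int m)" by simp
        then show ?thesis using m J(1) by auto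
      qed
      then have *: "(\<exists>m::int. a < Arg (z j) + 2 * pi * m \<and> Arg (z j) + 2 * pi * m < b) \<Longrightarrow> z j \<in> cis ` J" by blast
      have "smooth_count h a (b - h) (Arg (z j)) \<le> of_bool (\<exists>m::int. a < Arg (z j) + 2 * pi * m \<and> Arg (z j) + 2 * pi * m < b)"
        by (rule smooth_count_lower[OF h ab(2)])
      also have "\<dots> \<le> of_bool (z j \<in> cis ` J)" using * by (simp only: of_bool_def) simp
      finally show "smooth_count h a (b - h) (Arg (z j)) \<le> of_bool (z j \<in> cis ` J)" .
    qed
    also have "(\<Sum>j<n. smooth_count h a (b - h) (Arg (z j))) = ?W a (b - h) z + ?c - 1 / (2 * pi)"
      unfolding sumW using n by (simp add: h_def field_simps)
    finally have lo: "?W a (b - h) z - 1 / (2 * pi) \<le> X z - ?c" by simp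
    have "1 / (2 * pi) \<le> 1" using pi_ge_two by simp
    with up lo have "\<bar>X z - ?c\<bar> \<le> \<bar>?W (a - h) b z\<bar> + \<bar>?W a (b - h) z\<bar> + 1" by linarith
    then have "(X z - ?c)\<^sup>2 \<le> (\<bar>?W (a - h) b z\<bar> + \<bar>?W a (b - h) z\<bar> + 1)\<^sup>2"
      by (rule abs_le_square_iff[THEN iffD1, OF order_trans]) simp
    also have "(\<bar>u\<bar> + \<bar>v\<bar> + 1)\<^sup>2 \<le> 3 * (u\<^sup>2 + v\<^sup>2 + 1)" for u v :: real
    proof -
      have "0 \<le> (\<bar>u\<bar> - \<bar>v\<bar>)\<^sup>2 + (\<bar>u\<bar> - 1)\<^sup>2 + (\<bar>v\<bar> - 1)\<^sup>2" by simp
      then show ?thesis by (simp add: power2_eq_square algebra_simps)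
    qed
    finally show "(X z - ?c)\<^sup>2 \<le> 3 * ((?W (a - h) b z)\<^sup>2 + (?W a (b - h) z)\<^sup>2 + 1)" .
  qed
  then have "(\<integral>z. (X z - ?c)\<^sup>2 \<partial>cbe \<beta> n) \<le> (\<integral>z. 3 * ((?W (a - h) b z)\<^sup>2 + (?W a (b - h) z)\<^sup>2 + 1) \<partial>cbe \<beta> n)"
  proof (rule integral_mono_AE[rotated 2])
    show "integrable (cbe \<beta> n) (\<lambda>z. 3 * ((?W (a - h) b z)\<^sup>2 + (?W a (b - h) z)\<^sup>2 + 1))"
      using W1(1) W2(1) by auto
    show "integrable (cbe \<beta> n) (\<lambda>z. (X z - ?c)\<^sup>2)"
      unfolding X_def by (rule integrable_count_diff_square[OF \<beta>])
  qed
  also have "\<dots> = 3 * ((\<integral>z. (?W (a - h) b z)\<^sup>2 \<partial>cbe \<beta> n) + (\<integral>z. (?W a (b - h) z)\<^sup>2 \<partial>cbe \<beta> n) + 1)"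
    using W1(1) W2(1) by (simp add: prob_space)
  \<comment> \<open>The additive 1 enters the logarithm through
    \<open>1 \<le> 2 * ln 2\<close>.\<close>
  also have "\<dots> \<le> 3 * (count_constant \<beta> * ?L + count_constant \<beta> * ?L + 2 * ?L)"
  proof (intro mult_left_mono add_mono W1(2) W2(2))
    have "2 / 3 \<le> ln (2::real)" using ln2_ge_two_thirds .
    also have "ln 2 \<le> ?L" using l by (intro ln_mono) auto
    finally show "1 \<le> 2 * ?L" by simp
  qed auto
  also have "\<dots> = (6 * count_constant \<beta> + 6) * ?L" by (simp add: algebra_simps)
  finally show ?thesis .
qed

end

text \<open>If \<open>J\<close> contains two points at distance at least \<open>2 * pi\<close>, the
  arc is the whole circle and is parametrized anew by one closed period; otherwise the infimum and
  supremum of a nonempty \<open>J\<close> serve as endpoints.\<close>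

lemma arc_representation:
  assumes "circle_arc I"
  obtains a b J where "arc a b J" "I = cis ` J"
proof -
  from assms obtain J where J: "is_interval J" "I = cis ` J" by (auto simp: circle_arc_def)
  show ?thesis
  proof (cases "\<exists>x\<in>J. \<exists>y\<in>J. 2 * pi \<le> y - x")
    case True
    then obtain x y where xy: "x \<in> J" "y \<in> J" "2 * pi \<le> y - x" by auto
    have sub: "{x..x + 2 * pi} \<subseteq> J" using J(1) xy by (auto intro!: mem_is_interval_1_I[of J x y])
    have "cis ` J \<subseteq> cis ` {x..x + 2 * pi}"
    proof
      fix w assume "w \<in> cis ` J"
      then obtain t where t: "w = cis t" by auto
      define m where "m = \<lceil>(x - t) / (2 * pi)\<rceil>"
      have "2 * pi * (of_int m - 1) < x - t" "x - t \<le> 2 * pi * of_int m"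
        unfolding m_def by (rule ceiling_bounds_2pi)+
      then have "t + 2 * pi * of_int m \<in> {x..x + 2 * pi}" by (auto simp: algebra_simps)
      moreover have "w = cis (t + 2 * pi * of_int m)" unfolding t cis_eq_iff by auto
      ultimately show "w \<in> cis ` {x..x + 2 * pi}" by blast
    qed
    then have "I = cis ` {x..x + 2 * pi}" using sub J(2) by auto
    moreover have "arc x (x + 2 * pi) {x..x + 2 * pi}" by unfold_locales auto
    ultimately show ?thesis using that by blast
  next
    case False
    show ?thesis
    proof (cases "J = {}")
      case True
      have "arc 0 0 {}" by unfold_locales auto
      then show ?thesis using that True J(2) by blast
    next
      case ne: False
      then obtain x0 where x0: "x0 \<in> J" by auto
      have lt: "y - x < 2 * pi" if "x \<in> J" "y \<in> J" for x y
        using False that by (meson not_le)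
      have bd: "x0 - 2 * pi \<le> x" "x \<le> x0 + 2 * pi" if "x \<in> J" for x
        using lt[OF x0 that] lt[OF that x0] by linarith+
      have bb: "bdd_below J" "bdd_above J" using bd by (auto intro!: bdd_belowI bdd_aboveI)
      have "arc (Inf J) (Sup J) J"
      proof
        show "Inf J \<le> Sup J" using cInf_le_cSup ne bb by auto
        have "Sup J \<le> x + 2 * pi" if x: "x \<in> J" for x
        proof (rule cSup_least[OF ne])
          fix y assume "y \<in> J"
          from lt[OF x this] show "y \<le> x + 2 * pi" by linarith
        qed
        then have "Sup J - 2 * pi \<le> x" if "x \<in> J" for x using that by (simp add: diff_le_eq)
        then have "Sup J - 2 * pi \<le> Inf J" using ne by (intro cInf_greatest) blast+
        then show "Sup J - Inf J \<le> 2 * pi" by simp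
        show "J \<subseteq> {Inf J..Sup J}" using bb by (auto intro: cInf_lower cSup_upper)
        show "{Inf J<..<Sup J} \<subseteq> J"
        proof
          fix t assume t: "t \<in> {Inf J<..<Sup J}"
          obtain x where "x \<in> J" "x < t" using t ne bb cInf_less_iff[of J t] by auto
          moreover obtain y where "y \<in> J" "t < y" using t ne bb less_cSup_iff[of J t] by auto
          ultimately show "t \<in> J" using J(1) by (auto intro: mem_is_interval_1_I[of J x y])
        qed
      qed
      then show ?thesis using that J(2) by blast
    qed
  qed
qed

definition variance_constant :: "real \<Rightarrow> real" where
  "variance_constant \<beta> = 6 * count_constant \<beta> + 6"

lemma variance_constant_pos: "\<beta> > 0 \<Longrightarrow> variance_constant \<beta> > 0"
  using resolvent_constant_pos[of \<beta>] by (simp add: variance_constant_def count_constant_def add_pos_pos)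

theorem cbe_variance_bound:
  assumes \<beta>: "\<beta> > 0" and n: "n \<ge> 1" and I: "circle_arc I"
  shows "variance_at_most (cbe \<beta> n) (\<lambda>z. real (card (cbe_points n z \<inter> I)))
    (variance_constant \<beta> * ln (2 + real n * measure circle_measure I))"
proof -
  obtain a b J where "arc a b J" and I: "I = cis ` J" using arc_representation[OF I] .
  then interpret arc a b J by simp
  let ?X = "\<lambda>z. real (card (cbe_points n z \<inter> I))"
  have meas: "?X \<in> borel_measurable (cbe \<beta> n)"
    unfolding I by (rule borel_measurable_card_cbe_points[OF borel_arc])
  show ?thesis
  proof (rule variance_at_mostI[OF prob_space_cbe[OF \<beta>] meas])
    show "integrable (cbe \<beta> n) (\<lambda>z. (?X z)\<^sup>2)"
      using integrable_count_diff_square[OF \<beta>, of n 0] by (simp add: I)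
    have "(\<integral>z. (?X z - real n * (b - a) / (2 * pi))\<^sup>2 \<partial>cbe \<beta> n) \<le> variance_constant \<beta> * ln (2 + real n * (b - a))"
      unfolding I variance_constant_def by (rule count_second_moment[OF \<beta> n])
    also have "\<dots> \<le> variance_constant \<beta> * ln (2 + real n * measure circle_measure I)"
      using length_le_measure_arc variance_constant_pos[OF \<beta>] ab n
      by (intro mult_left_mono ln_mono add_left_mono) (auto simp: I intro: add_pos_nonneg)
    finally show "(\<integral>z. (?X z - real n * (b - a) / (2 * pi))\<^sup>2 \<partial>cbe \<beta> n)
      \<le> variance_constant \<beta> * ln (2 + real n * measure circle_measure I)" .
  qed
qed

subsection \<open>Point measures and the limit process\<close>

lemma point_measuresD:
  assumes "\<mu> \<in> point_measures"
  shows "sets \<mu> = sets borel" "space \<mu> = UNIV"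
    "A \<in> sets borel \<Longrightarrow> bounded A \<Longrightarrow> emeasure \<mu> A < \<infinity>"
proof -
  show s: "sets \<mu> = sets borel" using assms by (simp add: point_measures_def)
  then show "space \<mu> = UNIV" using sets_eq_imp_space_eq[OF s] by simp
  assume "A \<in> sets borel" "bounded A"
  then have "emeasure \<mu> A \<in> range of_nat" using assms by (simp add: point_measures_def)
  then show "emeasure \<mu> A < \<infinity>" by (auto simp: ennreal_of_nat_eq_real_of_nat)
qed

lemma nn_integral_measurable_point_measure_algebra:
  assumes "f \<in> borel_measurable borel"
  shows "(\<lambda>\<mu>. \<integral>\<^sup>+x. f x \<partial>\<mu>) \<in> borel_measurable point_measure_algebra" (is "_ \<in> ?B")
  using assms
proof (induct rule: borel_measurable_induct)
  case (cong f g)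
  then have "(\<lambda>\<mu>. \<integral>\<^sup>+x. f x \<partial>\<mu>) \<in> ?B \<longleftrightarrow> (\<lambda>\<mu>. \<integral>\<^sup>+x. g x \<partial>\<mu>) \<in> ?B"
    by (intro measurable_cong nn_integral_cong) simp
  with cong show ?case by simp
next
  case (set B)
  then have "(\<lambda>\<mu>. \<integral>\<^sup>+x. indicator B x \<partial>\<mu>) \<in> ?B \<longleftrightarrow> (\<lambda>\<mu>. emeasure \<mu> B) \<in> ?B"
    by (intro measurable_cong nn_integral_indicator) (simp add: point_measuresD)
  with set show ?case by (simp add: measurable_emeasure_point_measure_algebra)
next
  case (mult f c)
  then have "(\<lambda>\<mu>. \<integral>\<^sup>+x. c * f x \<partial>\<mu>) \<in> ?B \<longleftrightarrow> (\<lambda>\<mu>. c * \<integral>\<^sup>+x. f x \<partial>\<mu>) \<in> ?B"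
    by (intro measurable_cong nn_integral_cmult) (simp add: point_measuresD cong: measurable_cong_sets)
  with mult show ?case by simp
next
  case (add f g)
  then have "(\<lambda>\<mu>. \<integral>\<^sup>+x. f x + g x \<partial>\<mu>) \<in> ?B \<longleftrightarrow> (\<lambda>\<mu>. (\<integral>\<^sup>+x. f x \<partial>\<mu>) + (\<integral>\<^sup>+x. g x \<partial>\<mu>)) \<in> ?B"
    by (intro measurable_cong nn_integral_add) (simp_all add: point_measuresD cong: measurable_cong_sets)
  with add show ?case by (simp add: ac_simps)
next
  case (seq F)
  then have "(\<lambda>\<mu>. \<integral>\<^sup>+x. (SUP i. F i) x \<partial>\<mu>) \<in> ?B \<longleftrightarrow> (\<lambda>\<mu>. SUP i. \<integral>\<^sup>+x. F i x \<partial>\<mu>) \<in> ?B"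
    unfolding SUP_apply
    by (intro measurable_cong nn_integral_monotone_convergence_SUP) (simp_all add: point_measuresD cong: measurable_cong_sets)
  with seq show ?case by (simp add: ac_simps)
qed

lemma borel_measurable_point_measure:
  assumes "\<mu> \<in> point_measures" "f \<in> borel_measurable borel"
  shows "f \<in> borel_measurable \<mu>"
  using assms(2) by (simp add: measurable_cong_sets[OF point_measuresD(1)[OF assms(1)] refl])

text \<open>For \<open>p \<le> q\<close> a plateau of height 1 on \<open>{p..q}\<close> that
  vanishes outside \<open>{p - 1<..<q + 1}\<close>: the compactly supported test function to which
  vague convergence is applied. Flanks of width 1 change the mean count by a bounded amount
  only.\<close>

definition trapezoid :: "real \<Rightarrow> real \<Rightarrow> real \<Rightarrow> real" where
  "trapezoid p q x = max 0 (min 1 (1 - max (p - x) (x - q)))"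

lemma trapezoid_bounds:
  "indicator {p..q} x \<le> trapezoid p q x" "trapezoid p q x \<le> indicator {p - 1<..<q + 1} x" "0 \<le> trapezoid p q x"
  by (auto simp: trapezoid_def indicator_def)

lemma continuous_on_trapezoid: "continuous_on A (trapezoid p q)"
  unfolding trapezoid_def[abs_def] by (intro continuous_intros)

lemma borel_measurable_trapezoid [measurable]: "trapezoid p q \<in> borel_measurable borel"
  by (intro borel_measurable_continuous_onI continuous_on_trapezoid)

lemma compact_support_trapezoid: "compact (closure {x. trapezoid p q x \<noteq> 0})"
proof -
  have "{x. trapezoid p q x \<noteq> 0} \<subseteq> {p - 1..q + 1}"
    by (auto simp: trapezoid_def)
  then have "bounded {x. trapezoid p q x \<noteq> 0}" by (rule bounded_subset[rotated]) simp
  then show ?thesis by (simp add: compact_closure)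
qed

lemma integral_trapezoid_bounds:
  assumes "\<mu> \<in> point_measures"
  shows "measure \<mu> {p..q} \<le> (\<integral>x. trapezoid p q x \<partial>\<mu>)"
    "(\<integral>x. trapezoid p q x \<partial>\<mu>) \<le> measure \<mu> {p - 1<..<q + 1}"
proof -
  have int: "integrable \<mu> (indicator A :: real \<Rightarrow> real)" if "A \<in> sets borel" "bounded A" for A
    using point_measuresD[OF assms] that by (intro integrable_real_indicator) auto
  have i1: "integrable \<mu> (indicator {p..q} :: real \<Rightarrow> real)" by (rule int) auto
  have i2: "integrable \<mu> (indicator {p - 1<..<q + 1} :: real \<Rightarrow> real)" by (rule int) auto
  have i3: "integrable \<mu> (trapezoid p q)"
    using trapezoid_bounds(2,3)[of p q]
    by (intro Bochner_Integration.integrable_bound[OF i2] borel_measurable_point_measure[OF assms] AE_I2) auto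
  have "(\<integral>x. indicator {p..q} x \<partial>\<mu>) \<le> (\<integral>x. trapezoid p q x \<partial>\<mu>)"
    by (rule integral_mono[OF i1 i3 trapezoid_bounds(1)])
  then show "measure \<mu> {p..q} \<le> (\<integral>x. trapezoid p q x \<partial>\<mu>)"
    using point_measuresD(2)[OF assms] by simp
  have "(\<integral>x. trapezoid p q x \<partial>\<mu>) \<le> (\<integral>x. indicator {p - 1<..<q + 1} x \<partial>\<mu>)"
    by (rule integral_mono[OF i3 i2 trapezoid_bounds(2)])
  then show "(\<integral>x. trapezoid p q x \<partial>\<mu>) \<le> measure \<mu> {p - 1<..<q + 1}"
    using point_measuresD(2)[OF assms] by simp
qed

lemma measurable_integral_trapezoid:
  "(\<lambda>\<mu>. \<integral>x. trapezoid p q x \<partial>\<mu>) \<in> borel_measurable point_measure_algebra"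
proof -
  have "(\<lambda>\<mu>. \<integral>x. trapezoid p q x \<partial>\<mu>) \<in> borel_measurable point_measure_algebra
      \<longleftrightarrow> (\<lambda>\<mu>. enn2real (\<integral>\<^sup>+x. ennreal (trapezoid p q x) \<partial>\<mu>)) \<in> borel_measurable point_measure_algebra"
    using borel_measurable_point_measure[OF _ borel_measurable_trapezoid]
    by (intro measurable_cong integral_eq_nn_integral) (auto simp: trapezoid_bounds(3))
  also have "\<dots>"
    by (intro measurable_compose[OF nn_integral_measurable_point_measure_algebra]) auto
  finally show ?thesis .
qed

lemma continuous_map_integral_vague:
  assumes "continuous_on UNIV f" "compact (closure {x. f x \<noteq> (0::real)})"
  shows "continuous_map vague_topology euclideanreal (\<lambda>\<mu>. \<integral>x. f x \<partial>\<mu>)"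
  unfolding continuous_map_def
proof (intro conjI allI impI)
  fix U :: "real set" assume "openin euclideanreal U"
  then have "open U" by simp
  then show "openin vague_topology {\<mu> \<in> topspace vague_topology. (\<integral>x. f x \<partial>\<mu>) \<in> U}"
    unfolding topspace_vague_topology unfolding vague_topology_def using assms
    by (intro topology_generated_by_Basis) blast
qed auto

section \<open>Measurability of the rescaled point configuration\<close>

lemma emeasure_args_of_point:
  assumes N: "N > 0" and A: "A \<in> sets borel"
  shows "emeasure (count_space UNIV) (A \<inter> {N * \<theta> | \<theta>. cis \<theta> = w})
    = (if cmod w = 1 then (\<Sum>i. indicator A (N * (Arg w + 2 * pi * of_int (int_decode i)))) else 0)"
proof (cases "cmod w = 1")
  case False
  then have "cis \<theta> \<noteq> w" for \<theta> using norm_cis by metis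
  with False show ?thesis by simp
next
  case True
  \<comment> \<open>Enumerating the determinations by \<open>int_decode\<close> turns the number of
    them in \<open>A\<close> into a series, from which measurability in \<open>w\<close> can be read
    off.\<close>
  define g where "g i = N * (Arg w + 2 * pi * of_int (int_decode i))" for i
  have w: "cis (Arg w) = w" using True rcis_cmod_Arg[of w] by (simp add: rcis_def)
  have range: "{N * \<theta> | \<theta>. cis \<theta> = w} = range g"
  proof (intro equalityI subsetI)
    fix y assume "y \<in> {N * \<theta> | \<theta>. cis \<theta> = w}"
    then obtain \<theta> where t: "y = N * \<theta>" "cis \<theta> = w" by auto
    then have "cis (Arg w) = cis \<theta>" using w by simp
    then obtain m :: int where "\<theta> = Arg w + 2 * pi * m" unfolding cis_eq_iff by blast
    then have "y = g (int_encode m)" using t by (simp add: g_def)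
    then show "y \<in> range g" by blast
  next
    fix y assume "y \<in> range g"
    then obtain i where "y = g i" by auto
    moreover have "cis (Arg w) = cis (Arg w + 2 * pi * of_int (int_decode i))" unfolding cis_eq_iff by auto
    ultimately show "y \<in> {N * \<theta> | \<theta>. cis \<theta> = w}" using w by (auto simp: g_def)
  qed
  have "inj g"
  proof (rule injI)
    fix i j assume "g i = g j"
    then have "int_decode i = int_decode j" using N by (simp add: g_def)
    then show "i = j" by (simp add: int_decode_eq)
  qed
  then have inj: "inj_on g (g -` A)" by (rule inj_on_subset) simp
  have "emeasure (count_space UNIV) (g ` (g -` A)) = emeasure (count_space UNIV) (g -` A)"
    by (simp only: emeasure_count_space[OF subset_UNIV] card_image[OF inj] finite_image_iff[OF inj])
  then have "emeasure (count_space UNIV) (A \<inter> {N * \<theta> | \<theta>. cis \<theta> = w}) = emeasure (count_space UNIV) (g -` A)"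
    by (simp only: range image_vimage_eq)
  also have "\<dots> = (\<integral>\<^sup>+i. indicator (g -` A) i \<partial>count_space UNIV)"
    by (rule nn_integral_indicator[symmetric]) simp
  also have "\<dots> = (\<Sum>i. indicator (g -` A) i)" by (rule nn_integral_count_space_nat)
  also have "\<dots> = (\<Sum>i. indicator A (g i))"
    by (intro suminf_cong) (simp add: indicator_def)
  finally show ?thesis unfolding g_def using True by simp
qed

text \<open>Each point contributes at its first occurrence only: the determinations form a set, and
  the formula has to hold at every \<open>z\<close>, also where points coincide.\<close>

lemma emeasure_args_first:
  fixes N :: real and n :: nat
  assumes N: "N > 0"
  shows "emeasure (count_space UNIV) (A \<inter> {N * \<theta> | \<theta>. cis \<theta> \<in> z ` {..<n}})
    = (\<Sum>k<n. emeasure (count_space UNIV) (A \<inter> {N * \<theta> | \<theta>. cis \<theta> = z k}) * (\<Prod>j<k. of_bool (z j \<noteq> z k)))"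
proof (induction n)
  case (Suc n)
  let ?S = "\<lambda>W. A \<inter> {N * \<theta> | \<theta>. cis \<theta> \<in> W}"
  have un: "?S (z ` {..<Suc n}) = ?S (z ` {..<n}) \<union> ?S {z n}"
    by (auto simp: lessThan_Suc)
  show ?case
  proof (cases "z n \<in> z ` {..<n}")
    case True
    then have "z ` {..<Suc n} = z ` {..<n}" by (auto simp: lessThan_Suc)
    then show ?thesis using Suc True by (simp add: prod_of_bool_neq)
  next
    case False
    then have "?S (z ` {..<n}) \<inter> ?S {z n} = {}" using N by auto
    then have "emeasure (count_space UNIV) (?S (z ` {..<Suc n})) =
        emeasure (count_space UNIV) (?S (z ` {..<n})) + emeasure (count_space UNIV) (?S {z n})"
      unfolding un by (intro plus_emeasure[symmetric]) auto
    then show ?thesis using Suc False by (simp add: prod_of_bool_neq)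
  qed
qed simp

text \<open>\<open>cbe_args_law\<close> is a \<open>distr\<close>, and integrals under it are pulled
  back to the ensemble along this map, which has to be measurable with all values in
  \<open>point_measures\<close>.\<close>

lemma measurable_cbe_args:
  "(\<lambda>z. point_measure_of (cbe_args n z)) \<in> cbe \<beta> n \<rightarrow>\<^sub>M point_measure_algebra"
proof -
  have em: "emeasure (point_measure_of (cbe_args n z)) A = (\<Sum>k<n. emeasure (count_space UNIV) (A \<inter> {real n * \<theta> | \<theta>. cis \<theta> = z k}) * (\<Prod>j<k. of_bool (z j \<noteq> z k)))"
    if A: "A \<in> sets borel" for A z
  proof (cases "n = 0")
    case True
    then show ?thesis using A by (simp add: emeasure_point_measure_of cbe_args_def cbe_points_def)
  next
    case False
    then show ?thesis
      unfolding emeasure_point_measure_of[OF A] cbe_args_def cbe_points_def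
      by (intro emeasure_args_first) simp
  qed
  have pm: "point_measure_of (cbe_args n z) \<in> point_measures" for z
    unfolding point_measures_def
  proof (safe)
    fix A :: "real set" assume A: "A \<in> sets borel" "bounded A"
    \<comment> \<open>Distinct determinations of one point, multiplied by \<open>n\<close>, differ
      by a nonzero multiple of \<open>2 * pi * n\<close>, hence by at least 1; a bounded set
      contains finitely many.\<close>
    have fin: "finite (A \<inter> {real n * \<theta> | \<theta>. cis \<theta> = w})" if n: "n > 0" for w
    proof -
      from A obtain R where R: "\<And>x. x \<in> A \<Longrightarrow> \<bar>x\<bar> \<le> R" unfolding bounded_real by auto
      show ?thesis
      proof (cases "A \<inter> {real n * \<theta> | \<theta>. cis \<theta> = w} = {}")
        case False
        then obtain \<theta>0 where t0: "real n * \<theta>0 \<in> A" "cis \<theta>0 = w" by auto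
        have "A \<inter> {real n * \<theta> | \<theta>. cis \<theta> = w} \<subseteq>
          (\<lambda>m. real n * (\<theta>0 + 2 * pi * of_int m)) ` {- \<lceil>2 * R\<rceil>..\<lceil>2 * R\<rceil>}"
        proof
          fix y assume "y \<in> A \<inter> {real n * \<theta> | \<theta>. cis \<theta> = w}"
          then obtain \<theta> where t: "y = real n * \<theta>" "y \<in> A" "cis \<theta> = w" by auto
          with t0 obtain m :: int where m: "\<theta> = \<theta>0 + 2 * pi * m" using cis_eq_iff[of \<theta>0 \<theta>] by auto
          have "\<bar>real_of_int m\<bar> * 1 \<le> \<bar>real_of_int m\<bar> * (real n * (2 * pi))"
          proof (rule mult_left_mono)
            have "1 * 1 \<le> real n * (2 * pi)" using n pi_ge_two by (intro mult_mono) auto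
            then show "1 \<le> real n * (2 * pi)" by simp
          qed simp
          also have "\<dots> = \<bar>real n * \<theta> - real n * \<theta>0\<bar>"
            by (simp add: m abs_mult algebra_simps)
          also have "\<dots> \<le> 2 * R" using R[OF t0(1)] R[OF t(2)] t(1) by linarith
          finally have "\<bar>real_of_int m\<bar> \<le> 2 * R" by simp
          then have "m \<in> {- \<lceil>2 * R\<rceil>..\<lceil>2 * R\<rceil>}" by (simp, linarith)
          then show "y \<in> (\<lambda>m. real n * (\<theta>0 + 2 * pi * of_int m)) ` {- \<lceil>2 * R\<rceil>..\<lceil>2 * R\<rceil>}"
            using t(1) m by blast
        qed
        then show ?thesis by (rule finite_subset) simp
      qed simp
    qed
    have "finite (\<Union>w\<in>z ` {..<n}. A \<inter> {real n * \<theta> | \<theta>. cis \<theta> = w})"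
    proof (intro finite_UN_I finite_imageI finite_lessThan)
      fix w assume "w \<in> z ` {..<n}"
      then have "n > 0" by auto
      then show "finite (A \<inter> {real n * \<theta> | \<theta>. cis \<theta> = w})"
        by (rule fin)
    qed
    moreover have "A \<inter> cbe_args n z = (\<Union>w\<in>z ` {..<n}. A \<inter> {real n * \<theta> | \<theta>. cis \<theta> = w})"
      by (auto simp: cbe_args_def cbe_points_def)
    ultimately show "emeasure (point_measure_of (cbe_args n z)) A \<in> range of_nat"
      using A by (simp add: emeasure_point_measure_of emeasure_count_space)
  qed (simp_all add: point_measure_of_def)
  have meas: "(\<lambda>z. emeasure (point_measure_of (cbe_args n z)) A) \<in> borel_measurable (cbe \<beta> n)"
    if A: "A \<in> sets borel" for A
    unfolding em[OF A]
  proof (intro borel_measurable_sum borel_measurable_times_ennreal borel_measurable_prod_ennreal)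
    fix k assume k: "k \<in> {..<n}"
    have [measurable]: "A \<in> sets borel" by fact
    have "(\<lambda>w. if cmod w = 1 then (\<Sum>i. indicator A (real n * (Arg w + 2 * pi * of_int (int_decode i)))) else 0 :: ennreal)
       \<in> borel_measurable borel" by measurable
    then have "(\<lambda>w. emeasure (count_space UNIV) (A \<inter> {real n * \<theta> | \<theta>. cis \<theta> = w})) \<in> borel_measurable borel"
      using k by (subst emeasure_args_of_point[OF _ A]) auto
    from measurable_compose[OF borel_measurable_cbe_component this, of k n \<beta>] k
    show "(\<lambda>z. emeasure (count_space UNIV) (A \<inter> {real n * \<theta> | \<theta>. cis \<theta> = z k})) \<in> borel_measurable (cbe \<beta> n)"
      by simp
    fix j assume "j \<in> {..<k}"
    then have jk: "j < n" "k < n" using k by auto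
    have "(\<lambda>z. z j - z k) \<in> borel_measurable (cbe \<beta> n)"
      using jk by (intro borel_measurable_diff borel_measurable_cbe_component)
    moreover have "(\<lambda>y :: complex. of_bool (y \<noteq> 0) :: ennreal) \<in> borel_measurable borel"
      unfolding of_bool_def by measurable
    ultimately have "(\<lambda>z. of_bool (z j - z k \<noteq> 0) :: ennreal) \<in> borel_measurable (cbe \<beta> n)"
      by (rule measurable_compose)
    then show "(\<lambda>z. of_bool (z j \<noteq> z k) :: ennreal) \<in> borel_measurable (cbe \<beta> n)"
      by simp
  qed
  show ?thesis
    unfolding point_measure_algebra_def
  proof (rule measurable_SUP2)
    fix A :: "real set" assume "A \<in> sets borel"
    then show "(\<lambda>z. point_measure_of (cbe_args n z)) \<in> cbe \<beta> n \<rightarrow>\<^sub>M vimage_algebra point_measures (\<lambda>\<mu>. emeasure \<mu> A) borel"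
      using pm by (intro measurable_vimage_algebra2 meas) auto
  qed auto
qed

section \<open>Smoothed counts of the rescaled ensemble and of its limit\<close>

lemma measure_args_interval:
  assumes n: "n \<ge> 1" and len: "(q - p) / real n < 2 * pi"
  shows "measure (point_measure_of (cbe_args n z)) {p..q} = real (card (cbe_points n z \<inter> cis ` {p / real n..q / real n}))"
proof -
  let ?A = "{p..q} \<inter> cbe_args n z"
  let ?f = "\<lambda>y. cis (y / real n)"
  have n0: "real n > 0" using n by simp
  \<comment> \<open>The window is shorter than the period \<open>2 * pi * n\<close>, so no point of
    the ensemble enters it twice.\<close>
  have inj: "inj_on ?f ?A"
  proof (rule inj_onI)
    fix x y assume xy: "x \<in> ?A" "y \<in> ?A" and "?f x = ?f y"
    then obtain m :: int where m: "y / real n = x / real n + 2 * pi * m" unfolding cis_eq_iff by blast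
    have "\<bar>y / real n - x / real n\<bar> = \<bar>y - x\<bar> / real n" by (simp add: diff_divide_distrib[symmetric])
    also have "\<dots> \<le> (q - p) / real n" using xy by (intro divide_right_mono) auto
    also have "\<dots> < 2 * pi" by (rule len)
    finally have "2 * pi * \<bar>real_of_int m\<bar> < 2 * pi * 1" unfolding m by (simp add: abs_mult)
    then have "\<bar>real_of_int m\<bar> < 1" by simp
    then have "m = 0" by linarith
    then show "x = y" using m n0 by simp
  qed
  have img: "?f ` ?A = cbe_points n z \<inter> cis ` {p / real n..q / real n}"
  proof (intro equalityI subsetI)
    fix w assume "w \<in> ?f ` ?A"
    then obtain \<theta> where "w = cis \<theta>" "p \<le> real n * \<theta>" "real n * \<theta> \<le> q" "cis \<theta> \<in> cbe_points n z"
      using n0 by (auto simp: cbe_args_def)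
    moreover have "\<theta> \<in> {p / real n..q / real n}" using calculation n0 by (simp add: field_simps)
    ultimately show "w \<in> cbe_points n z \<inter> cis ` {p / real n..q / real n}" by blast
  next
    fix w assume "w \<in> cbe_points n z \<inter> cis ` {p / real n..q / real n}"
    then obtain \<theta> where t: "w = cis \<theta>" "\<theta> \<in> {p / real n..q / real n}" "cis \<theta> \<in> cbe_points n z" by auto
    then have "real n * \<theta> \<in> ?A" using n0 by (auto simp: cbe_args_def field_simps)
    moreover have "?f (real n * \<theta>) = w" using t n0 by simp
    ultimately show "w \<in> ?f ` ?A" by (metis image_eqI)
  qed
  have "finite (?f ` ?A)" unfolding img by (simp add: cbe_points_def)
  then have fin: "finite ?A" using inj by (simp add: finite_image_iff)
  have "card ?A = card (?f ` ?A)" by (rule card_image[OF inj, symmetric])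
  then show ?thesis
    using fin unfolding img measure_def
    by (simp add: emeasure_point_measure_of emeasure_count_space ennreal_of_nat_eq_real_of_nat[symmetric])
qed

text \<open>An inner and an outer interval with different means will be compared with the same
  \<open>c\<close>, hence the free centre.\<close>

lemma (in arc) count_second_moment_shift:
  assumes \<beta>: "\<beta> > 0" and n: "n \<ge> 1"
  shows "(\<integral>z. (real (card (cbe_points n z \<inter> cis ` J)) - c)\<^sup>2 \<partial>cbe \<beta> n)
     \<le> 2 * (variance_constant \<beta> * ln (2 + real n * (b - a))) + 2 * (c - real n * (b - a) / (2 * pi))\<^sup>2"
proof -
  interpret prob_space "cbe \<beta> n" using \<beta> by (rule prob_space_cbe)
  let ?X = "\<lambda>z. real (card (cbe_points n z \<inter> cis ` J))"
  let ?d = "real n * (b - a) / (2 * pi)"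
  have "(\<integral>z. (?X z - c)\<^sup>2 \<partial>cbe \<beta> n) \<le> (\<integral>z. 2 * (?X z - ?d)\<^sup>2 + 2 * (c - ?d)\<^sup>2 \<partial>cbe \<beta> n)"
  proof (rule integral_mono)
    show "(?X z - c)\<^sup>2 \<le> 2 * (?X z - ?d)\<^sup>2 + 2 * (c - ?d)\<^sup>2" for z
    proof -
      have "(x - c)\<^sup>2 \<le> 2 * (x - d)\<^sup>2 + 2 * (c - d)\<^sup>2" for x d :: real
        using zero_le_power2[of "(x - d) + (c - d)"] by (simp add: power2_eq_square algebra_simps)
      then show ?thesis .
    qed
  qed (use integrable_count_diff_square[OF \<beta>] in auto)
  also have "\<dots> = 2 * (\<integral>z. (?X z - ?d)\<^sup>2 \<partial>cbe \<beta> n) + 2 * (c - ?d)\<^sup>2"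
    using integrable_count_diff_square[OF \<beta>, of n ?d] by (simp add: prob_space)
  also have "\<dots> \<le> 2 * (variance_constant \<beta> * ln (2 + real n * (b - a))) + 2 * (c - ?d)\<^sup>2"
    using count_second_moment[OF \<beta> n] by (simp add: variance_constant_def)
  finally show ?thesis .
qed

text \<open>Twice \<open>variance_constant\<close> for each of the inner and the outer interval; 32
  covers the additive constants 2 and 8, as the logarithm is at least 2/3.\<close>

definition sine_constant :: "real \<Rightarrow> real" where
  "sine_constant \<beta> = 4 * variance_constant \<beta> + 32"

lemma square_diff_between_le:
  fixes x t y c :: real
  assumes "x \<le> t" "t \<le> y"
  shows "(t - c)\<^sup>2 \<le> (x - c)\<^sup>2 + (y - c)\<^sup>2"
proof (cases "c \<le> t")
  case True
  then have "(t - c)\<^sup>2 \<le> (y - c)\<^sup>2" using assms by (intro power_mono) auto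
  then show ?thesis using zero_le_power2[of "x - c"] by linarith
next
  case False
  then have "(c - t)\<^sup>2 \<le> (c - x)\<^sup>2" using assms by (intro power_mono) auto
  then have "(t - c)\<^sup>2 \<le> (x - c)\<^sup>2" by (simp only: power2_commute)
  then show ?thesis using zero_le_power2[of "y - c"] by linarith
qed

lemma point_measure_of_cbe_args:
  assumes "z \<in> space (cbe \<beta> n)"
  shows "point_measure_of (cbe_args n z) \<in> point_measures"
  using measurable_space[OF measurable_cbe_args assms] by simp

lemma measure_mono_point_measures:
  assumes "\<mu> \<in> point_measures" "A \<subseteq> B" "A \<in> sets borel" "B \<in> sets borel" "bounded B"
  shows "measure \<mu> A \<le> measure \<mu> B"
  using assms point_measuresD[OF assms(1)]
  by (intro measure_mono_fmeasurable) (auto intro!: fmeasurableI)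

text \<open>The bound depends neither on \<open>n\<close> nor on the truncation level
  \<open>K\<close>, so it survives both limits. The slack in \<open>c\<close> allows trapezoids
  inside and outside a given interval to share a centre; \<open>len\<close> makes even the widened
  window shorter than a period.\<close>

lemma cbe_args_law_trapezoid:
  assumes \<beta>: "\<beta> > 0" and n: "n \<ge> 1" and pq: "p \<le> q" and len: "q - p + 2 \<le> real n"
    and c: "\<bar>c - (q - p) / (2 * pi)\<bar> \<le> 1" and K: "K \<ge> 0"
  shows "(\<integral>\<mu>. min (((\<integral>x. trapezoid p q x \<partial>\<mu>) - c)\<^sup>2) K \<partial>cbe_args_law \<beta> n)
     \<le> sine_constant \<beta> * ln (4 + (q - p))"
proof -
  interpret prob_space "cbe \<beta> n" using \<beta> by (rule prob_space_cbe)
  let ?N = "\<lambda>p q z. real (card (cbe_points n z \<inter> cis ` {p / real n..q / real n}))"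
  let ?F = "\<lambda>\<mu>. min (((\<integral>x. trapezoid p q x \<partial>\<mu>) - c)\<^sup>2) K"
  have n0: "real n > 0" using n by simp
  have F: "?F \<in> borel_measurable point_measure_algebra"
    using measurable_integral_trapezoid[of p q] by measurable
  have F': "(\<lambda>z. ?F (point_measure_of (cbe_args n z))) \<in> borel_measurable (cbe \<beta> n)"
    by (rule measurable_compose[OF measurable_cbe_args F])
  have short: "arc (p' / real n) (q' / real n) {p' / real n..q' / real n}" "(q' - p') / real n < 2 * pi"
    if "p' \<le> q'" "q' - p' \<le> real n" for p' q'
  proof -
    have "(q' - p') / real n \<le> 1" using that n0 by simp
    then have *: "(q' - p') / real n < 2 * pi" using pi_ge_two by linarith
    then show "(q' - p') / real n < 2 * pi" .
    show "arc (p' / real n) (q' / real n) {p' / real n..q' / real n}"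
      using * that n0 by unfold_locales (auto simp: divide_right_mono diff_divide_distrib)
  qed
  have pq1: "p \<le> q" "q - p \<le> real n" and pq2: "p - 1 \<le> q + 1" "(q + 1) - (p - 1) \<le> real n"
    using pq len by auto
  interpret A1: arc "p / real n" "q / real n" "{p / real n..q / real n}" by (rule short(1)[OF pq1])
  interpret A2: arc "(p - 1) / real n" "(q + 1) / real n" "{(p - 1) / real n..(q + 1) / real n}" by (rule short(1)[OF pq2])
  have le: "?F (point_measure_of (cbe_args n z)) \<le> (?N p q z - c)\<^sup>2 + (?N (p - 1) (q + 1) z - c)\<^sup>2"
    if z: "z \<in> space (cbe \<beta> n)" for z
  proof -
    let ?\<mu> = "point_measure_of (cbe_args n z)"
    note pm = point_measure_of_cbe_args[OF z]
    have "?N p q z \<le> (\<integral>x. trapezoid p q x \<partial>?\<mu>)"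
      using integral_trapezoid_bounds(1)[OF pm, of p q] measure_args_interval[OF n short(2)[OF pq1]] by simp
    moreover have "(\<integral>x. trapezoid p q x \<partial>?\<mu>) \<le> measure ?\<mu> {p - 1..q + 1}"
      by (rule order_trans[OF integral_trapezoid_bounds(2)[OF pm]], rule measure_mono_point_measures[OF pm]) auto
    then have "(\<integral>x. trapezoid p q x \<partial>?\<mu>) \<le> ?N (p - 1) (q + 1) z"
      using measure_args_interval[OF n short(2)[OF pq2]] by simp
    ultimately show ?thesis
      using square_diff_between_le[of "?N p q z" "\<integral>x. trapezoid p q x \<partial>?\<mu>" "?N (p - 1) (q + 1) z" c] by simp
  qed
  have "(\<integral>\<mu>. ?F \<mu> \<partial>cbe_args_law \<beta> n) = (\<integral>z. ?F (point_measure_of (cbe_args n z)) \<partial>cbe \<beta> n)"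
    unfolding cbe_args_law_def by (rule integral_distr[OF measurable_cbe_args F])
  also have "\<dots> \<le> (\<integral>z. (?N p q z - c)\<^sup>2 + (?N (p - 1) (q + 1) z - c)\<^sup>2 \<partial>cbe \<beta> n)"
  proof (rule integral_mono)
    show "integrable (cbe \<beta> n) (\<lambda>z. ?F (point_measure_of (cbe_args n z)))"
      using F' K by (intro integrable_const_bound[where B=K]) auto
    show "integrable (cbe \<beta> n) (\<lambda>z. (?N p q z - c)\<^sup>2 + (?N (p - 1) (q + 1) z - c)\<^sup>2)"
      using A1.integrable_count_diff_square[OF \<beta>] A2.integrable_count_diff_square[OF \<beta>] by auto
  qed (rule le)
  also have "\<dots> = (\<integral>z. (?N p q z - c)\<^sup>2 \<partial>cbe \<beta> n) + (\<integral>z. (?N (p - 1) (q + 1) z - c)\<^sup>2 \<partial>cbe \<beta> n)"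
    using A1.integrable_count_diff_square[OF \<beta>] A2.integrable_count_diff_square[OF \<beta>]
    by (rule Bochner_Integration.integral_add)
  also have "\<dots> \<le> (2 * (variance_constant \<beta> * ln (2 + (q - p))) + 2 * (c - (q - p) / (2 * pi))\<^sup>2)
    + (2 * (variance_constant \<beta> * ln (2 + (q - p + 2))) + 2 * (c - (q - p + 2) / (2 * pi))\<^sup>2)"
  proof -
    have e: "real n * (q / real n - p / real n) = q - p" "real n * ((q + 1) / real n - (p - 1) / real n) = q - p + 2"
      using n0 by (simp_all add: field_simps)
    show ?thesis
      using A1.count_second_moment_shift[OF \<beta> n, of c] A2.count_second_moment_shift[OF \<beta> n, of c]
      unfolding e by (rule add_mono)
  qed
  also have "\<dots> \<le> (2 * (variance_constant \<beta> * ln (4 + (q - p))) + 2 * 1)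
    + (2 * (variance_constant \<beta> * ln (4 + (q - p))) + 2 * 4)"
  proof (intro add_mono mult_left_mono)
    show "ln (2 + (q - p)) \<le> ln (4 + (q - p))" "ln (2 + (q - p + 2)) \<le> ln (4 + (q - p))"
      using pq by (auto intro!: ln_mono)
    show "(c - (q - p) / (2 * pi))\<^sup>2 \<le> 1" using c by (simp add: abs_square_le_1)
    have "(q - p + 2) / (2 * pi) = (q - p) / (2 * pi) + 1 / pi" by (simp add: add_divide_distrib)
    moreover have "0 \<le> 1 / pi" "1 / pi \<le> 1" using pi_ge_two by auto
    ultimately have "\<bar>c - (q - p + 2) / (2 * pi)\<bar> \<le> 2" using c by linarith
    then show "(c - (q - p + 2) / (2 * pi))\<^sup>2 \<le> 4" using abs_le_square_iff[of "c - (q - p + 2) / (2 * pi)" 2] by simp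
  qed (use variance_constant_pos[OF \<beta>] in auto)
  also have "\<dots> \<le> sine_constant \<beta> * ln (4 + (q - p))"
  proof -
    have "2 / 3 \<le> ln (2::real)" using ln2_ge_two_thirds .
    also have "ln 2 \<le> ln (4 + (q - p))" using pq by (intro ln_mono) auto
    finally show ?thesis by (simp add: sine_constant_def algebra_simps)
  qed
  finally show ?thesis .
qed

text \<open>Stated with the nonnegative integral because square integrability under \<open>P\<close>
  is still to be derived from it.\<close>

lemma sine_beta_trapezoid:
  assumes \<beta>: "\<beta> > 0" and P: "sine_beta_law \<beta> P" and pq: "p \<le> q"
    and c: "\<bar>c - (q - p) / (2 * pi)\<bar> \<le> 1"
  shows "(\<integral>\<^sup>+\<mu>. ennreal (((\<integral>x. trapezoid p q x \<partial>\<mu>) - c)\<^sup>2) \<partial>P) \<le> ennreal (sine_constant \<beta> * ln (4 + (q - p)))"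
proof -
  interpret P: prob_space P using P by (simp add: sine_beta_law_def)
  have sets: "sets P = sets point_measure_algebra" and conv: "converges_in_law (cbe_args_law \<beta>) P"
    using P by (auto simp: sine_beta_law_def)
  let ?T = "\<lambda>\<mu>. ((\<integral>x. trapezoid p q x \<partial>\<mu>) - c)\<^sup>2"
  let ?F = "\<lambda>K \<mu>. min (?T \<mu>) (real K)"
  let ?B = "sine_constant \<beta> * ln (4 + (q - p))"
  have T: "?T \<in> borel_measurable P"
    using measurable_integral_trapezoid[of p q] unfolding measurable_cong_sets[OF sets refl] by measurable
  have bnd: "(\<integral>\<mu>. ?F K \<mu> \<partial>P) \<le> ?B" for K
  proof -
    have "continuous_map vague_topology euclideanreal ((\<lambda>y. min ((y - c)\<^sup>2) (real K)) \<circ> (\<lambda>\<mu>. \<integral>x. trapezoid p q x \<partial>\<mu>))"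
      by (rule continuous_map_compose[OF continuous_map_integral_vague[OF continuous_on_trapezoid compact_support_trapezoid]])
         (auto intro!: continuous_intros)
    moreover have "bounded (?F K ` point_measures)"
      by (rule boundedI[where B="real K"]) auto
    ultimately have lim: "(\<lambda>n. \<integral>\<mu>. ?F K \<mu> \<partial>cbe_args_law \<beta> n) \<longlonglongrightarrow> (\<integral>\<mu>. ?F K \<mu> \<partial>P)"
      using conv unfolding converges_in_law_def by (simp add: o_def)
    show ?thesis
    proof (rule LIMSEQ_le_const2[OF lim])
      show "\<exists>N. \<forall>n\<ge>N. (\<integral>\<mu>. ?F K \<mu> \<partial>cbe_args_law \<beta> n) \<le> ?B"
      proof (intro exI allI impI)
        fix n assume "nat \<lceil>q - p + 2\<rceil> \<le> n"
        then have "q - p + 2 \<le> real n" by linarith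
        then show "(\<integral>\<mu>. ?F K \<mu> \<partial>cbe_args_law \<beta> n) \<le> ?B"
          using pq by (intro cbe_args_law_trapezoid \<beta> c) auto
      qed
    qed
  qed
  have "(\<integral>\<^sup>+\<mu>. ennreal (?T \<mu>) \<partial>P) \<le> (\<integral>\<^sup>+\<mu>. (SUP K. ennreal (?F K \<mu>)) \<partial>P)"
  proof (rule nn_integral_mono)
    fix \<mu>
    obtain K :: nat where "?T \<mu> \<le> real K" using real_arch_simple by blast
    then have "ennreal (?T \<mu>) = ennreal (?F K \<mu>)" by simp
    also have "\<dots> \<le> (SUP K. ennreal (?F K \<mu>))" by (rule SUP_upper) simp
    finally show "ennreal (?T \<mu>) \<le> (SUP K. ennreal (?F K \<mu>))" .
  qed
  also have "\<dots> = (SUP K. \<integral>\<^sup>+\<mu>. ennreal (?F K \<mu>) \<partial>P)"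
    using T by (intro nn_integral_monotone_convergence_SUP) (auto simp: incseq_def le_fun_def intro!: ennreal_leI)
  also have "\<dots> \<le> ennreal ?B"
  proof (rule SUP_least)
    fix K
    have "integrable P (?F K)" using T by (intro P.integrable_const_bound[where B="real K"]) auto
    then have "(\<integral>\<^sup>+\<mu>. ennreal (?F K \<mu>) \<partial>P) = ennreal (\<integral>\<mu>. ?F K \<mu> \<partial>P)"
      by (intro nn_integral_eq_integral) auto
    then show "(\<integral>\<^sup>+\<mu>. ennreal (?F K \<mu>) \<partial>P) \<le> ennreal ?B" using bnd[of K] by (simp add: ennreal_leI)
  qed
  finally show ?thesis .
qed

lemma sine_constant_ge: "\<beta> > 0 \<Longrightarrow> sine_constant \<beta> \<ge> 32"
  using variance_constant_pos[of \<beta>] by (simp add: sine_constant_def)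

lemma bounded_interval_endpoints:
  fixes I :: "real set"
  assumes "is_interval I" "bounded I" "I \<noteq> {}"
  obtains a b where "a \<le> b" "{a<..<b} \<subseteq> I" "I \<subseteq> {a..b}" "measure lborel I = b - a" "I \<in> sets borel"
proof -
  have bb: "bdd_below I" "bdd_above I" using assms(2) by (auto simp: bounded_imp_bdd_below bounded_imp_bdd_above)
  let ?a = "Inf I" and ?b = "Sup I"
  have ab: "?a \<le> ?b" using cInf_le_cSup assms bb by auto
  have sub1: "I \<subseteq> {?a..?b}" using bb by (auto intro: cInf_lower cSup_upper)
  have sub2: "{?a<..<?b} \<subseteq> I"
  proof
    fix t assume t: "t \<in> {?a<..<?b}"
    obtain x where "x \<in> I" "x < t" using t assms bb cInf_less_iff[of I t] by auto
    moreover obtain y where "y \<in> I" "t < y" using t assms bb less_cSup_iff[of I t] by auto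
    ultimately show "t \<in> I" using assms(1) by (auto intro: mem_is_interval_1_I[of I x y])
  qed
  have meas: "I \<in> sets borel"
  proof -
    have "{?a..?b} - I \<subseteq> {?a, ?b}"
    proof
      fix x assume x: "x \<in> {?a..?b} - I"
      then have "x \<notin> {?a<..<?b}" using sub2 by blast
      then show "x \<in> {?a, ?b}" using x by auto
    qed
    then have "finite ({?a..?b} - I)" by (rule finite_subset) simp
    then have "{?a..?b} - I \<in> sets borel" by (intro borel_closed finite_imp_closed)
    then have "{?a..?b} - ({?a..?b} - I) \<in> sets borel" by (rule sets.Diff[rotated]) simp
    moreover have "{?a..?b} - ({?a..?b} - I) = I" using sub1 by auto
    ultimately show ?thesis by simp
  qed
  have "emeasure lborel {?a<..<?b} \<le> emeasure lborel I" using sub2 meas by (intro emeasure_mono) auto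
  moreover have "emeasure lborel I \<le> emeasure lborel {?a..?b}" using sub1 by (intro emeasure_mono) auto
  ultimately have "emeasure lborel I = ennreal (?b - ?a)" using ab by simp
  then have "measure lborel I = ?b - ?a" using ab by (simp add: measure_def)
  with that ab sub1 sub2 meas show ?thesis by blast
qed

theorem sine_beta_variance_bound:
  assumes \<beta>: "\<beta> > 0" and P: "sine_beta_law \<beta> P" and I: "is_interval I" "bounded I"
  shows "variance_at_most P (\<lambda>\<mu>. measure \<mu> I) (4 * sine_constant \<beta> * ln (2 + measure lborel I))"
proof -
  interpret P: prob_space P using P by (simp add: sine_beta_law_def)
  have sets: "sets P = sets point_measure_algebra" using P by (simp add: sine_beta_law_def)
  then have space: "space P = point_measures" using sets_eq_imp_space_eq[OF sets] by simp
  let ?D = "sine_constant \<beta>"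
  have D: "?D \<ge> 32" by (rule sine_constant_ge[OF \<beta>])
  show ?thesis
  proof (cases "I = {}")
    case True
    then show ?thesis using D by (intro variance_at_mostI[OF P.prob_space_axioms, where c=0]) auto
  next
    case False
    obtain a b where ab: "a \<le> b" "{a<..<b} \<subseteq> I" "I \<subseteq> {a..b}" "measure lborel I = b - a" "I \<in> sets borel"
      using bounded_interval_endpoints[OF I False] .
    define l where "l = b - a"
    define c where "c = l / (2 * pi)"
    have l: "l \<ge> 0" using ab by (simp add: l_def)
    have c0: "c \<ge> 0" using l by (simp add: c_def)
    let ?T = "\<lambda>p q \<mu>. ((\<integral>x. trapezoid p q x \<partial>\<mu>) - c)\<^sup>2"
    let ?X = "\<lambda>\<mu>. measure \<mu> I"
    have T: "?T p q \<in> borel_measurable P" for p q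
      using measurable_integral_trapezoid[of p q] unfolding measurable_cong_sets[OF sets refl] by measurable
    have X: "?X \<in> borel_measurable P"
      using measurable_emeasure_point_measure_algebra[OF ab(5)]
      unfolding measure_def measurable_cong_sets[OF sets refl] by measurable
    have up: "?X \<mu> \<le> (\<integral>x. trapezoid a b x \<partial>\<mu>)" if \<mu>: "\<mu> \<in> point_measures" for \<mu>
      by (rule order_trans[OF _ integral_trapezoid_bounds(1)[OF \<mu>]])
         (rule measure_mono_point_measures[OF \<mu> ab(3,5)], auto)
    have L1: "ln (4 + l) \<ge> 1 / 2"
    proof -
      have "1 / 2 \<le> ln (2::real)" using ln2_ge_two_thirds by simp
      also have "ln 2 \<le> ln (4 + l)" using l by (intro ln_mono) auto
      finally show ?thesis .
    qed
    have T1: "(\<integral>\<^sup>+\<mu>. ennreal (?T a b \<mu>) \<partial>P) \<le> ennreal (?D * ln (4 + l))"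
      unfolding l_def using ab by (intro sine_beta_trapezoid[OF \<beta> P]) (auto simp: c_def l_def)
    have main: "(\<integral>\<^sup>+\<mu>. ennreal ((?X \<mu> - c)\<^sup>2) \<partial>P) \<le> ennreal (2 * ?D * ln (4 + l))"
    proof (cases "2 \<le> l")
      \<comment> \<open>The inner trapezoid has its plateau on \<open>{a + 1..b - 1}\<close>, which
        requires length 2. For shorter intervals 0 is the lower bound for the count, and the centre
        \<open>c\<close> is at most 1.\<close>
      case True
      have pt: "(?X \<mu> - c)\<^sup>2 \<le> ?T (a + 1) (b - 1) \<mu> + ?T a b \<mu>" if \<mu>: "\<mu> \<in> point_measures" for \<mu>
      proof (rule square_diff_between_le[OF _ up[OF \<mu>]])
        have "measure \<mu> {a + 1 - 1<..<b - 1 + 1} \<le> ?X \<mu>"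
          using ab I by (intro measure_mono_point_measures[OF \<mu>]) auto
        then show "(\<integral>x. trapezoid (a + 1) (b - 1) x \<partial>\<mu>) \<le> ?X \<mu>"
          by (rule order_trans[OF integral_trapezoid_bounds(2)[OF \<mu>]])
      qed
      have "(\<integral>\<^sup>+\<mu>. ennreal ((?X \<mu> - c)\<^sup>2) \<partial>P) \<le> (\<integral>\<^sup>+\<mu>. ennreal (?T (a + 1) (b - 1) \<mu>) + ennreal (?T a b \<mu>) \<partial>P)"
        using pt space by (intro nn_integral_mono) (auto simp: ennreal_plus[symmetric] simp del: ennreal_plus intro!: ennreal_leI)
      also have "\<dots> = (\<integral>\<^sup>+\<mu>. ennreal (?T (a + 1) (b - 1) \<mu>) \<partial>P) + (\<integral>\<^sup>+\<mu>. ennreal (?T a b \<mu>) \<partial>P)"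
        using T by (intro nn_integral_add) auto
      also have "\<dots> \<le> ennreal (?D * ln (4 + (b - 1 - (a + 1)))) + ennreal (?D * ln (4 + l))"
      proof (intro add_mono T1 sine_beta_trapezoid[OF \<beta> P])
        show "a + 1 \<le> b - 1" using True by (simp add: l_def)
        have "c - (b - 1 - (a + 1)) / (2 * pi) = 1 / pi" by (simp add: c_def l_def field_simps)
        moreover have "\<bar>1 / pi\<bar> \<le> 1" using pi_ge_two by simp
        ultimately show "\<bar>c - (b - 1 - (a + 1)) / (2 * pi)\<bar> \<le> 1" by simp
      qed
      also have "\<dots> \<le> ennreal (?D * ln (4 + l)) + ennreal (?D * ln (4 + l))"
        using True D by (intro add_mono ennreal_leI mult_left_mono ln_mono) (auto simp: l_def)
      also have "\<dots> = ennreal (2 * ?D * ln (4 + l))"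
        using D L1 by (simp add: ennreal_plus[symmetric] del: ennreal_plus)
      finally show ?thesis .
    next
      case False
      have "c \<le> 2 / (2 * pi)" unfolding c_def using False by (intro divide_right_mono) auto
      also have "\<dots> \<le> 1" using pi_ge_two by simp
      finally have c1: "c \<le> 1" .
      then have c2: "(0 - c)\<^sup>2 \<le> 1" using c0 by (simp add: power_le_one)
      have pt: "(?X \<mu> - c)\<^sup>2 \<le> 1 + ?T a b \<mu>" if \<mu>: "\<mu> \<in> point_measures" for \<mu>
        using square_diff_between_le[OF measure_nonneg[of \<mu> I] up[OF \<mu>], of c] c2 by linarith
      have "(\<integral>\<^sup>+\<mu>. ennreal ((?X \<mu> - c)\<^sup>2) \<partial>P) \<le> (\<integral>\<^sup>+\<mu>. ennreal 1 + ennreal (?T a b \<mu>) \<partial>P)"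
        using pt space by (intro nn_integral_mono) (auto simp: ennreal_plus[symmetric] simp del: ennreal_plus ennreal_1 intro!: ennreal_leI)
      also have "\<dots> = ennreal 1 + (\<integral>\<^sup>+\<mu>. ennreal (?T a b \<mu>) \<partial>P)"
        using T by (subst nn_integral_add) (auto simp: P.emeasure_space_1)
      also have "\<dots> \<le> ennreal 1 + ennreal (?D * ln (4 + l))" by (intro add_mono T1 order_refl)
      also have "\<dots> \<le> ennreal (?D * ln (4 + l)) + ennreal (?D * ln (4 + l))"
      proof (intro add_mono order_refl ennreal_leI)
        have "32 * (1 / 2) \<le> ?D * ln (4 + l)" using D L1 by (intro mult_mono) auto
        then show "1 \<le> ?D * ln (4 + l)" by simp
      qed
      also have "\<dots> = ennreal (2 * ?D * ln (4 + l))"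
        using D L1 by (simp add: ennreal_plus[symmetric] del: ennreal_plus)
      finally show ?thesis .
    qed
    have int: "integrable P (\<lambda>\<mu>. (?X \<mu> - c)\<^sup>2)"
      using X le_less_trans[OF main ennreal_less_top] by (intro integrableI_bounded) auto
    have "ennreal (\<integral>\<mu>. (?X \<mu> - c)\<^sup>2 \<partial>P) \<le> ennreal (2 * ?D * ln (4 + l))"
      using main nn_integral_eq_integral[OF int] by simp
    then have bnd: "(\<integral>\<mu>. (?X \<mu> - c)\<^sup>2 \<partial>P) \<le> 2 * ?D * ln (4 + l)"
      using D L1 by (subst (asm) ennreal_le_iff) auto
    have "integrable P (\<lambda>\<mu>. (?X \<mu>)\<^sup>2)"
    proof (rule Bochner_Integration.integrable_bound)
      show "integrable P (\<lambda>\<mu>. 2 * (?X \<mu> - c)\<^sup>2 + 2 * c\<^sup>2)" using int by auto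
      have "(?X \<mu>)\<^sup>2 \<le> 2 * (?X \<mu> - c)\<^sup>2 + 2 * c\<^sup>2" for \<mu>
        using zero_le_power2[of "?X \<mu> - 2 * c"] by (simp add: power2_eq_square algebra_simps)
      then show "AE \<mu> in P. norm ((?X \<mu>)\<^sup>2) \<le> norm (2 * (?X \<mu> - c)\<^sup>2 + 2 * c\<^sup>2)" by simp
    qed (use X in auto)
    moreover have "2 * ?D * ln (4 + l) \<le> 4 * ?D * ln (2 + measure lborel I)"
    proof -
      \<comment> \<open>The inequality \<open>4 + l \<le> (2 + l)\<^sup>2\<close> trades the 4 for a
        doubled constant.\<close>
      have "ln (4 + l) \<le> ln ((2 + l)\<^sup>2)" using l by (intro ln_mono) (auto simp: power2_eq_square algebra_simps)
      also have "\<dots> = 2 * ln (2 + l)" using l by (subst ln_realpow) auto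
      finally have "2 * ?D * ln (4 + l) \<le> 2 * ?D * (2 * ln (2 + l))" using D by (intro mult_left_mono) auto
      then show ?thesis by (simp add: ab(4) l_def)
    qed
    ultimately show ?thesis
      using bnd by (intro variance_at_mostI[OF P.prob_space_axioms X, of c]) auto
  qed
qed

theorem theorem1:
  fixes \<beta> :: real
  assumes "\<beta> > 0"
  shows "\<exists>C>0.
    (\<forall>n\<ge>1. \<forall>I. circle_arc I \<longrightarrow>
       variance_at_most (cbe \<beta> n) (\<lambda>z. real (card (cbe_points n z \<inter> I)))
         (C * ln (2 + real n * measure circle_measure I))) \<and>
    (\<forall>P. sine_beta_law \<beta> P \<longrightarrow>
       (\<forall>I :: real set. is_interval I \<and> bounded I \<longrightarrow>
          variance_at_most P (\<lambda>\<mu>. measure \<mu> I) (C * ln (2 + measure lborel I))))"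
proof (intro exI[of _ "4 * sine_constant \<beta>"] conjI allI impI)
  show "4 * sine_constant \<beta> > 0" using sine_constant_ge[OF assms] by simp
  fix n :: nat and I assume n: "n \<ge> 1" and I: "circle_arc I"
  \<comment> \<open>The constant obtained for the limit process is the larger one and serves for
    both parts.\<close>
  have "variance_constant \<beta> * ln (2 + real n * measure circle_measure I)
      \<le> 4 * sine_constant \<beta> * ln (2 + real n * measure circle_measure I)"
    using variance_constant_pos[OF assms] by (intro mult_right_mono) (auto simp: sine_constant_def intro!: ln_ge_zero add_increasing2)
  with cbe_variance_bound[OF assms n I]
  show "variance_at_most (cbe \<beta> n) (\<lambda>z. real (card (cbe_points n z \<inter> I)))
      (4 * sine_constant \<beta> * ln (2 + real n * measure circle_measure I))"
    unfolding variance_at_most_def by linarith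
next
  fix P and I :: "real set" assume "sine_beta_law \<beta> P" "is_interval I \<and> bounded I"
  then show "variance_at_most P (\<lambda>\<mu>. measure \<mu> I) (4 * sine_constant \<beta> * ln (2 + measure lborel I))"
    by (intro sine_beta_variance_bound[OF assms]) auto
qed

end
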